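(* Let $F(x,y) \in \mathbb{C}[x,y]$ be a polynomial of total degree $d \ge 1$ and let $G(x,y) \in \mathbb{C}[x,y]$ be a polynomial with exactly $t \ge 1$ monomials (i.e., $t$ nonzero coefficients). Suppose $p = (a,b) \in (\mathbb{C}\setminus\{0\})^2$ is an isolated solution of the system $F(x,y) = G(x,y) = 0$, i.e., $F(a,b)=G(a,b)=0$ and $I_p(F,G) < +\infty$. Then \[ I_p(F,G) \le \tfrac{5}{2} d^2 t^2 . \]
   Context: For $p=(a,b)\in\mathbb{C}^2$, let $O_p \subset \mathbb{C}(x,y)$ be the local ring of rational functions $F/G$ with $F,G\in\mathbb{C}[x,y]$ and $G(a,b)\neq 0$. The intersection multiplicity of $F,G\in\mathbb{C}[x,y]$ at $p$ is $I_p(F,G) := \dim_{\mathbb{C}} \bigl(O_p/\langle F,G\rangle\bigr)$, where $\langle F,G\rangle$ is the ideal of $O_p$ generated by $F$ and $G$ (possibly $+\infty$). *)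

theory Defs
  imports "HOL-Computational_Algebra.Polynomial" "HOL-Computational_Algebra.Fraction_Field"
    "HOL-Library.Extended_Nat" Complex_Main
begin

text \<open>Bivariate polynomials over C are represented as complex poly poly:
  the outer variable is y, the inner variable is x.  So the coefficient of
  the monomial x^i y^j of F is coeff (coeff F j) i.\<close>

type_synonym bipoly = "complex poly poly"

definition bcoeff :: "bipoly \<Rightarrow> nat \<Rightarrow> nat \<Rightarrow> complex" where
  "bcoeff F i j = coeff (coeff F j) i"

definition beval :: "bipoly \<Rightarrow> complex \<Rightarrow> complex \<Rightarrow> complex" where
  "beval F a b = poly (map_poly (\<lambda>c. poly c a) F) b"

definition bsupport :: "bipoly \<Rightarrow> (nat \<times> nat) set" where
  "bsupport F = {(i, j). bcoeff F i j \<noteq> 0}"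

definition total_degree :: "bipoly \<Rightarrow> nat" where
  "total_degree F = (if F = 0 then 0 else Max ((\<lambda>(i, j). i + j) ` bsupport F))"

definition num_monomials :: "bipoly \<Rightarrow> nat" where
  "num_monomials F = card (bsupport F)"

definition local_ring :: "complex \<Rightarrow> complex \<Rightarrow> bipoly fract set" where
  "local_ring a b = {r. \<exists>f g. r = Fract f g \<and> beval g a b \<noteq> 0}"

definition const_fract :: "complex \<Rightarrow> bipoly fract" where
  "const_fract c = Fract [:[:c:]:] 1"

definition loc_ideal :: "complex \<Rightarrow> complex \<Rightarrow> bipoly \<Rightarrow> bipoly \<Rightarrow> bipoly fract set" where
  "loc_ideal a b F G = {u * Fract F 1 + v * Fract G 1 | u v. u \<in> local_ring a b \<and> v \<in> local_ring a b}"

definition indep_mod :: "complex \<Rightarrow> complex \<Rightarrow> bipoly \<Rightarrow> bipoly \<Rightarrow> bipoly fract list \<Rightarrow> bool" where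
  "indep_mod a b F G rs \<longleftrightarrow> set rs \<subseteq> local_ring a b \<and>
     (\<forall>c :: nat \<Rightarrow> complex.
        (\<Sum>k<length rs. const_fract (c k) * rs ! k) \<in> loc_ideal a b F G \<longrightarrow>
        (\<forall>k<length rs. c k = 0))"

text \<open>I_p(F,G) = dim_C O_p/<F,G>, possibly infinite.\<close>
definition int_mult :: "bipoly \<Rightarrow> bipoly \<Rightarrow> complex \<Rightarrow> complex \<Rightarrow> enat" where
  "int_mult F G a b = Sup {enat (length rs) | rs. indep_mod a b F G rs}"

end

(*
  Idea. Intersection multiplicity is subadditive in F and infinite if a prime factor of F through p
  divides G, so F may be taken prime. A generic linear change of coordinates makes F monic of
  degree d in v, with no zero on the line u = 0 lying on a coordinate axis. By Puiseux's theorem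
  F(s^N, v) splits into linear factors v - v_i(s), and N * I_p(F, G) is at most the sum over i of
  the orders in s of G(s^N, v_i(s)).

  The derivation D = x y (F_v d/du - F_u d/dv) is tangent to the curve, loses at most N in the order
  along a branch, and maps a monomial m to m times a polynomial of degree d. Choose a minimal set
  of n <= t monomials such that G is a combination of them modulo F. Their Wronskian under D is a
  monomial times a polynomial W of degree d n (n - 1) / 2 that vanishes on no branch, and Cramer's rule
  gives ord G <= ord W + (n - 1) N on each branch. By Bezout the orders of W add up to at most
  N * d * deg W, whence N * I_p(F, G) <= N * d^2 * (n (n - 1) / 2 + n - 1).
*)

theory Submission
  imports Defs "HOL-Computational_Algebra.Formal_Laurent_Series"
    "HOL-Computational_Algebra.Field_as_Ring"
    "HOL-Computational_Algebra.Fundamental_Theorem_Algebra"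
    "Jordan_Normal_Form.Char_Poly"
begin

no_notation vec_index (infixl "$" 100)

section \<open>Puiseux's theorem\<close>

text \<open>The degree of G is arbitrary, so nothing in the bound may depend on the exponents of its
  monomials. The factor x y in D achieves this: the monomials can be pulled out of the columns of
  their Wronskian, and the degree of what remains is governed by d and n alone. Dividing by
  monomials requires x and y to be units, not only at p but at every point of the curve on the line
  u = 0: Bezout's bound comes from the order of a norm, which sees all branches over u = 0 at once.
  Primality of F matters mainly through one fact: a polynomial that vanishes on a single branch is
  divisible by F. Hence independence modulo F survives on each branch separately. Passing to all of
  F costs nothing, since the squares of the degrees of the factors add up to at most d^2, and n (n -
  1) / 2 + n - 1 <= n^2 <= t^2 gives d^2 t^2, within the claimed 5/2 d^2 t^2. Finiteness of the
  multiplicity enters by linear algebra: the powers of u are dependent modulo the ideal, so some u^r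
  lies in it locally, and power series may be cut off to polynomials.\<close>

definition ramify :: "nat \<Rightarrow> complex fps \<Rightarrow> complex fps" where
  "ramify N f = f oo fps_X ^ N"

lemma ramify_nth: "N > 0 \<Longrightarrow> ramify N f $ n = (if N dvd n then f $ (n div N) else 0)"
  unfolding ramify_def by (subst fps_nth_compose_X_power) auto

lemma ramify_0 [simp]: "ramify N 0 = 0"
  by (simp add: ramify_def)

lemma ramify_hom: "N > 0 \<Longrightarrow> comm_ring_hom (ramify N)"
  unfolding ramify_def
  by unfold_locales (auto simp: fps_compose_mult_distrib fps_compose_add_distrib)

lemma ramify_ramify: "N > 0 \<Longrightarrow> M > 0 \<Longrightarrow> ramify M (ramify N f) = ramify (N * M) f"
  by (rule fps_ext) (auto simp: ramify_nth mult.commute div_mult2_eq dvd_div_iff_mult elim!: dvd_mult_left dvd_mult_right)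

lemma ramify_X_power: "N > 0 \<Longrightarrow> ramify N (fps_X ^ k) = fps_X ^ (N * k)"
  unfolding ramify_def by (simp add: fps_compose_power[symmetric] power_mult)

lemma map_poly_prod_linear:
  assumes "comm_ring_hom h"
  shows "map_poly h (\<Prod>v\<leftarrow>vs. [:-v, 1:]) = (\<Prod>v\<leftarrow>vs. [:- h v, 1:])"
proof -
  interpret comm_ring_hom h by fact
  interpret mp: map_poly_comm_ring_hom h ..
  show ?thesis by (induction vs) (simp_all add: hom_distribs)
qed

lemma degree_prod_linear: "degree (\<Prod>v\<leftarrow>vs. [:-v, 1:] :: 'a :: idom poly) = length vs"
proof (induction vs)
  case (Cons v vs)
  have "(\<Prod>v\<leftarrow>vs. [:-v, 1:] :: 'a poly) \<noteq> 0" by (auto simp: prod_list_zero_iff)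
  thus ?case using Cons by (simp add: degree_mult_eq del: mult_pCons_left)
qed simp

lemma lead_coeff_prod_linear: "lead_coeff (\<Prod>v\<leftarrow>vs. [:-v, 1:] :: 'a :: idom poly) = 1"
  by (induction vs) (simp_all add: lead_coeff_mult del: mult_pCons_left)

text \<open>Scale a Bezout relation by \<open>R\<close>, reduce the cofactor of
  \<open>\<beta>\<close> modulo \<open>\<alpha>\<close> and move the quotient to the other cofactor.
  The bound on \<open>B\<close> then follows by comparing degrees in
  \<open>\<alpha> * B = R - \<beta> * A\<close>.\<close>

lemma coprime_bezout_degree:
  fixes \<alpha> \<beta> R :: "complex poly"
  assumes "coprime \<alpha> \<beta>" "degree \<alpha> \<ge> 1" "degree \<beta> \<ge> 1" "degree R < degree \<alpha> + degree \<beta>"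
  shows "\<exists>A B. degree A < degree \<alpha> \<and> degree B < degree \<beta> \<and> \<alpha> * B + \<beta> * A = R"
proof -
  obtain x y where xy: "x * \<alpha> + y * \<beta> = 1"
    using bezout_coefficients_fst_snd[of \<alpha> \<beta>] assms(1) by (metis coprime_imp_gcd_eq_1)
  define A where "A = (R * y) mod \<alpha>"
  have a0: "\<alpha> \<noteq> 0" using assms(2) by auto
  have dA: "degree A < degree \<alpha>"
    unfolding A_def using a0 assms(2) degree_mod_less[of \<alpha> "R*y"] by auto
  define B where "B = R * x + \<beta> * ((R * y) div \<alpha>)"
  define D where "D = (R * y) div \<alpha>"
  have DA: "\<alpha> * D + A = R * y" unfolding A_def D_def by simp
  have "\<alpha> * B + \<beta> * A = R * (x * \<alpha>) + \<beta> * (\<alpha> * D + A)"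
    unfolding B_def D_def[symmetric] by (simp add: algebra_simps)
  also have "\<dots> = R * (x * \<alpha> + y * \<beta>)" unfolding DA by (simp add: algebra_simps)
  finally have eq: "\<alpha> * B + \<beta> * A = R" using xy by simp
  have "degree B < degree \<beta>"
  proof (cases "B = 0")
    case False
    have "degree (\<alpha> * B) = degree \<alpha> + degree B" using a0 False by (simp add: degree_mult_eq)
    moreover have "\<alpha> * B = R - \<beta> * A" using eq by (simp add: algebra_simps)
    moreover have "degree (\<beta> * A) < degree \<alpha> + degree \<beta>"
      using dA degree_mult_le[of \<beta> A] by linarith
    ultimately have "degree \<alpha> + degree B < degree \<alpha> + degree \<beta>"
      using assms(4) degree_diff_less[of R "degree \<alpha> + degree \<beta>" "\<beta> * A"] by simp
    thus ?thesis by simp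
  qed (use assms(3) in auto)
  with eq dA show ?thesis by blast
qed

text \<open>The coefficients of \<open>s ^ k\<close> in the two factors are found one \<open>k\<close> at a time: each step is a
  Bezout equation for \<open>\<alpha>\<close> and \<open>\<beta>\<close>.\<close>

lemma hensel:
  fixes P :: "complex fps poly"
  assumes lc: "lead_coeff P = 1"
    and fact: "map_poly (\<lambda>c. c $ 0) P = \<alpha> * \<beta>"
    and cop: "coprime \<alpha> \<beta>" and mon: "lead_coeff \<alpha> = 1" "lead_coeff \<beta> = 1"
    and deg: "degree \<alpha> \<ge> 1" "degree \<beta> \<ge> 1"
  shows "\<exists>A B. P = A * B \<and> lead_coeff A = 1 \<and> lead_coeff B = 1 \<and>
               degree A = degree \<alpha> \<and> degree B = degree \<beta>"
proof -
  define p where "p k = map_poly (\<lambda>c. c $ k) P" for k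
  have cp: "coeff (p k) j = coeff P j $ k" for k j unfolding p_def by (simp add: coeff_map_poly)
  have nz: "\<alpha> \<noteq> 0" "\<beta> \<noteq> 0" using deg by auto
  have dP: "degree (p 0) = degree P"
    by (rule antisym, simp add: degree_le coeff_eq_0 cp, rule le_degree, simp add: cp lc)
  have dP': "degree P = degree \<alpha> + degree \<beta>"
    using dP fact nz unfolding p_def by (simp add: degree_mult_eq)
  have dpk: "degree (p k) < degree P" if "k > 0" for k
  proof -
    have "degree (p k) \<le> degree P - 1"
    proof (rule degree_le, intro allI impI)
      fix i assume "degree P - 1 < i"
      hence "i = degree P \<or> i > degree P" by auto
      thus "coeff (p k) i = 0" using that lc by (auto simp: cp coeff_eq_0)
    qed
    thus ?thesis using dP' deg by linarith
  qed
  \<comment> \<open>\<open>Q f k r\<close> says that \<open>r\<close> is a correct pair of k-th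
    coefficients, given the earlier ones. The convolution runs over 1 <= i < k, since the terms i =
    0 and i = k hold the unknowns and form the left-hand side. Strict degree bounds for k > 0 keep
    both leading coefficients equal to 1.\<close>
  define Q where "Q = (\<lambda>(f :: nat \<Rightarrow> complex poly \<times> complex poly) k r.
     if k = 0 then r = (\<alpha>, \<beta>) else
     degree (fst r) < degree \<alpha> \<and> degree (snd r) < degree \<beta> \<and>
     \<alpha> * snd r + \<beta> * fst r = p k - (\<Sum>i\<in>{1..<k}. fst (f i) * snd (f (k - i))))"
  have "\<exists>f. \<forall>k. Q f k (f k)"
  proof (rule dependent_wellorder_choice)
    fix r and f g :: "nat \<Rightarrow> complex poly \<times> complex poly" and x :: nat
    assume *: "\<And>y. y < x \<Longrightarrow> f y = g y"
    have "(\<Sum>i\<in>{1..<x}. fst (f i) * snd (f (x - i))) = (\<Sum>i\<in>{1..<x}. fst (g i) * snd (g (x - i)))"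
      by (rule sum.cong) (auto simp: *)
    thus "Q f x r = Q g x r" unfolding Q_def by simp
  next
    fix x :: nat and f :: "nat \<Rightarrow> complex poly \<times> complex poly"
    assume IH: "\<And>y. y < x \<Longrightarrow> Q f y (f y)"
    show "\<exists>r. Q f x r"
    proof (cases "x = 0")
      case False
      define R where "R = p x - (\<Sum>i\<in>{1..<x}. fst (f i) * snd (f (x - i)))"
      have "degree (\<Sum>i\<in>{1..<x}. fst (f i) * snd (f (x - i))) \<le> degree P - 1"
      proof (rule degree_sum_le, simp)
        fix i assume i: "i \<in> {1..<x}"
        have "degree (fst (f i)) < degree \<alpha>" "degree (snd (f (x - i))) < degree \<beta>"
          using IH[of i] IH[of "x - i"] i unfolding Q_def by auto
        thus "degree (fst (f i) * snd (f (x - i))) \<le> degree P - 1"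
          using degree_mult_le[of "fst (f i)" "snd (f (x - i))"] dP' by linarith
      qed
      hence "degree R < degree \<alpha> + degree \<beta>"
        unfolding R_def using dpk[of x] False dP' deg
        by (intro degree_diff_less) auto
      from coprime_bezout_degree[OF cop deg this] obtain A B where
        "degree A < degree \<alpha>" "degree B < degree \<beta>" "\<alpha> * B + \<beta> * A = R" by blast
      thus ?thesis using False unfolding Q_def R_def by (intro exI[of _ "(A, B)"]) auto
    qed (auto simp: Q_def)
  qed
  then obtain f where f: "\<And>k. Q f k (f k)" by blast
  define a where "a k = fst (f k)" for k
  define b where "b k = snd (f k)" for k
  have a0: "a 0 = \<alpha>" "b 0 = \<beta>" using f[of 0] by (auto simp: Q_def a_def b_def)
  have ak: "degree (a k) < degree \<alpha>" "degree (b k) < degree \<beta>"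
     "\<alpha> * b k + \<beta> * a k = p k - (\<Sum>i\<in>{1..<k}. a i * b (k - i))" if "k > 0" for k
    using f[of k] that by (auto simp: Q_def a_def b_def)
  have conv: "(\<Sum>i\<le>k. a i * b (k - i)) = p k" for k
  proof (cases "k = 0")
    case True thus ?thesis using a0 fact by (simp add: p_def)
  next
    case False
    have "{..k} = insert 0 (insert k {1..<k})" using False by auto
    hence "(\<Sum>i\<le>k. a i * b (k - i)) = a 0 * b k + (a k * b 0 + (\<Sum>i\<in>{1..<k}. a i * b (k - i)))"
      using False by simp
    thus ?thesis using ak(3)[of k] False a0 by (simp add: algebra_simps)
  qed
  define A where "A = (\<Sum>j\<le>degree \<alpha>. monom (Abs_fps (\<lambda>k. coeff (a k) j)) j)"
  define B where "B = (\<Sum>j\<le>degree \<beta>. monom (Abs_fps (\<lambda>k. coeff (b k) j)) j)"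
  have dle: "degree (a k) \<le> degree \<alpha>" "degree (b k) \<le> degree \<beta>" for k
    using ak(1,2)[of k] a0 by (cases "k = 0"; simp)+
  have cA: "coeff A j $ k = coeff (a k) j" for j k
    unfolding A_def using dle(1)[of k] by (auto simp: coeff_sum fps_sum_nth coeff_eq_0)
  have cB: "coeff B j $ k = coeff (b k) j" for j k
    unfolding B_def using dle(2)[of k] by (auto simp: coeff_sum fps_sum_nth coeff_eq_0)
  have "P = A * B"
  proof (rule poly_eqI, rule fps_ext)
    fix j k
    have "coeff (A * B) j $ k = (\<Sum>i\<le>j. \<Sum>l=0..k. coeff (a l) i * coeff (b (k - l)) (j - i))"
      by (simp add: coeff_mult fps_sum_nth fps_mult_nth cA cB)
    also have "\<dots> = (\<Sum>l=0..k. \<Sum>i\<le>j. coeff (a l) i * coeff (b (k - l)) (j - i))"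
      by (rule sum.swap)
    also have "\<dots> = coeff (\<Sum>l\<le>k. a l * b (k - l)) j"
      by (simp add: coeff_sum coeff_mult atMost_atLeast0)
    finally show "coeff P j $ k = coeff (A * B) j $ k" by (simp add: conv cp)
  qed
  moreover have cA1: "coeff A (degree \<alpha>) = 1"
    by (rule fps_ext) (use ak(1) a0 mon in \<open>auto simp: cA coeff_eq_0\<close>)
  moreover have cB1: "coeff B (degree \<beta>) = 1"
    by (rule fps_ext) (use ak(2) a0 mon in \<open>auto simp: cB coeff_eq_0\<close>)
  moreover have "degree A = degree \<alpha>"
  proof (rule antisym)
    show "degree A \<le> degree \<alpha>" unfolding A_def
      by (intro degree_sum_le order.trans[OF degree_monom_le]) auto
    show "degree \<alpha> \<le> degree A" by (rule le_degree) (simp add: cA1)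
  qed
  moreover have "degree B = degree \<beta>"
  proof (rule antisym)
    show "degree B \<le> degree \<beta>" unfolding B_def
      by (intro degree_sum_le order.trans[OF degree_monom_le]) auto
    show "degree \<beta> \<le> degree B" by (rule le_degree) (simp add: cB1)
  qed
  ultimately show ?thesis by metis
qed

section \<open>Depressed polynomials and the Newton polygon\<close>

text \<open>The coefficient of X^j is homogeneous of degree n - j in the n roots. This undoes the
  substitution v = s^p z once the scaled polynomial has been split.\<close>

lemma coeff_prod_linear_scale:
  fixes \<tau> :: "'a :: idom"
  assumes "j \<le> length ws"
  shows "coeff (\<Prod>w\<leftarrow>ws. [:-(\<tau> * w), 1:]) j = \<tau> ^ (length ws - j) * coeff (\<Prod>w\<leftarrow>ws. [:-w, 1:]) j"
  using assms
proof (induction ws arbitrary: j)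
  case (Cons w ws)
  define A where "A = (\<Prod>w\<leftarrow>ws. [:-(\<tau> * w), 1:])"
  define B where "B = (\<Prod>w\<leftarrow>ws. [:-w, 1:])"
  have A_map: "A = (\<Prod>v\<leftarrow>map ((*) \<tau>) ws. [:-v, 1:])" by (simp add: A_def o_def)
  have zero: "coeff A j = 0" "coeff B j = 0" if "j > length ws" for j
    using that degree_prod_linear[of "map ((*) \<tau>) ws"] degree_prod_linear[of ws]
    unfolding A_map B_def by (auto intro: coeff_eq_0)
  have IH: "coeff A i = \<tau> ^ (length ws - i) * coeff B i" if "i \<le> length ws" for i
    using Cons.IH[OF that] by (simp add: A_def B_def)
  have 1: "\<tau> * coeff A j = \<tau> ^ (Suc (length ws) - j) * coeff B j"
    using zero[of j] IH[of j] Cons.prems by (cases "j = Suc (length ws)") (auto simp: Suc_diff_le)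
  show ?case
    using Cons.prems 1 IH[of "j - 1"] unfolding list.map prod_list.Cons A_def[symmetric] B_def[symmetric]
    by (cases j) (auto simp: algebra_simps coeff_pCons)
qed simp

lemma pcompose_prod_linear:
  "pcompose (\<Prod>v\<leftarrow>vs. [:-v, 1:]) [:h, 1:] = (\<Prod>v\<leftarrow>vs. [:-(v - h), 1 :: 'a :: comm_ring_1:])"
  by (induction vs) (simp_all add: pcompose_mult pcompose_pCons del: mult_pCons_left)

text \<open>Tschirnhaus shift: when \<open>P\<close> splits, \<open>h\<close> is minus the mean of
  its roots, so the shifted roots have sum zero. Only the two top terms of \<open>P\<close> reach
  degree n - 1; \<open>R\<close> collects the others.\<close>

lemma coeff_pcompose_depress:
  fixes P :: "complex fps poly"
  assumes "lead_coeff P = 1" "degree P = n" "n \<ge> 1"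
  defines "h \<equiv> coeff P (n - 1) * fps_const (1 / of_nat n)"
  shows "coeff (pcompose P [:-h, 1:]) (n - 1) = 0"
proof -
  define R where "R = P - monom 1 n - monom (coeff P (n - 1)) (n - 1)"
  have R0: "coeff R i = 0" if "i \<ge> n - 1" for i
  proof -
    have "i = n - 1 \<or> i = n \<or> i > n" using that by auto
    thus ?thesis using assms(1-3) by (auto simp: R_def coeff_eq_0)
  qed
  have cR: "coeff (pcompose R [:-h, 1:]) (n - 1) = 0"
  proof (cases "R = 0")
    case False
    have "degree R < n - 1" using R0 False by (meson leading_coeff_0_iff not_less)
    thus ?thesis by (intro coeff_eq_0) (simp add: degree_pcompose)
  qed simp
  have m: "pcompose (monom c k) [:-h, 1:] = Polynomial.smult c ([:-h, 1:] ^ k)" for c k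
    by (induction k) (simp_all add: monom_0 monom_Suc pcompose_pCons mult.commute)
  have P: "P = monom 1 n + monom (coeff P (n - 1)) (n - 1) + R" by (simp add: R_def)
  have e: "of_nat n * h = coeff P (n - 1)"
  proof -
    have "of_nat n * fps_const (1 / of_nat n :: complex) = 1"
      using assms(3) by (simp add: fps_of_nat[symmetric])
    thus ?thesis unfolding h_def by (metis mult.left_commute mult.right_neutral)
  qed
  have "n choose (n - 1) = n" using assms(3) by (subst binomial_symmetric) auto
  hence "coeff ([:-h, 1:] ^ n) (n - 1) = - (of_nat n * h)"
    using assms(3) by (subst coeff_linear_poly_power) auto
  moreover have "coeff ([:-h, 1:] ^ (n - 1)) (n - 1) = 1" by (rule coeff_linear_power)
  ultimately show ?thesis
    using cR by (subst P) (simp add: pcompose_add m e)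
qed

lemma ramify_1: "ramify 1 f = f"
  by (rule fps_ext) (simp add: ramify_nth)

text \<open>Substituting \<open>u = s ^ k\<close> and \<open>v = s ^ p * z\<close> for the first slope \<open>p / k\<close> of the Newton polygon gives
  a polynomial whose reduction at \<open>s = 0\<close> has zero sum of roots but is not \<open>z ^ n\<close>, so it has two
  distinct roots and Hensel's lemma applies.\<close>

lemma puiseux_depressed:
  fixes Q :: "complex fps poly"
  assumes mon: "lead_coeff Q = 1" and deg: "degree Q = n" "n \<ge> 1" and c0: "coeff Q (n - 1) = 0"
  and IH: "\<And>P. lead_coeff P = 1 \<Longrightarrow> degree P < n \<Longrightarrow> \<exists>N>0. \<exists>vs. map_poly (ramify N) P = (\<Prod>v\<leftarrow>vs. [:-v, 1:])"
  shows "\<exists>N>0. \<exists>vs. map_poly (ramify N) Q = (\<Prod>v\<leftarrow>vs. [:-v, 1:])"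
proof -
  define K where "K = {k\<in>{1..n}. coeff Q (n - k) \<noteq> 0}"
  show ?thesis
  proof (cases "K = {}")
    case True
    have "coeff Q j = coeff (monom 1 n) j" for j
    proof (cases "j < n")
      case True
      hence "n - j \<in> {1..n}" "n - (n - j) = j" by auto
      hence "coeff Q j = 0" using \<open>K = {}\<close> unfolding K_def by fastforce
      thus ?thesis using True by simp
    qed (use mon deg in \<open>auto simp: coeff_eq_0\<close>)
    hence "Q = monom 1 n" by (intro poly_eqI)
    moreover have "map_poly (ramify 1) Q = Q" by (intro poly_eqI) (simp add: coeff_map_poly ramify_def)
    moreover have "monom 1 n = (\<Prod>v\<leftarrow>replicate n 0. [:-v, 1 :: complex fps:])"
      by (induction n) (auto simp: monom_0 monom_Suc)
    ultimately have "map_poly (ramify 1) Q = (\<Prod>v\<leftarrow>replicate n 0. [:-v, 1:])" by simp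
    moreover have "(1 :: nat) > 0" by simp
    ultimately show ?thesis by blast
  next
    case False
    define \<rho> where "\<rho> k = real (subdegree (coeff Q (n - k))) / real k" for k
    have "finite K" by (simp add: K_def)
    then obtain k where k: "k \<in> K" "\<And>j. j \<in> K \<Longrightarrow> \<rho> k \<le> \<rho> j"
      using False ex_min_if_finite[of "\<rho> ` K"] by (force simp: not_less)
    define p where "p = subdegree (coeff Q (n - k))"
    have kn: "k \<ge> 1" "k \<le> n" "coeff Q (n - k) \<noteq> 0" using k by (auto simp: K_def)
    have slope: "p * j \<le> subdegree (coeff Q (n - j)) * k" if "j \<in> K" for j
    proof -
      have "j \<ge> 1" using that by (auto simp: K_def)
      hence "real p * real j \<le> real (subdegree (coeff Q (n - j))) * real k"
        using k(2)[OF that] kn unfolding \<rho>_def p_def by (simp add: field_simps)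
      thus ?thesis by (metis of_nat_le_iff of_nat_mult)
    qed
    \<comment> \<open>\<open>c j\<close> is the coefficient of z^j in Q(s^k, s^p z) / s^(p n).
      Minimality of the slope p / k ensures that the shift discards no nonzero term, and where the
      minimum is attained the constant coefficient is nonzero.\<close>
    define c where "c j = fps_shift (p * (n - j)) (ramify k (coeff Q j))" for j
    have low: "ramify k (coeff Q j) $ m = 0" if "m < p * (n - j)" for j m
    proof (rule ccontr)
      assume "ramify k (coeff Q j) $ m \<noteq> 0"
      hence *: "k dvd m" "coeff Q j $ (m div k) \<noteq> 0" using kn by (auto simp: ramify_nth split: if_splits)
      have "j < n" using that by (cases "j < n") auto
      moreover have "coeff Q j \<noteq> 0" using * by auto
      ultimately have "n - j \<in> K" "n - (n - j) = j" by (auto simp: K_def)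
      hence "p * (n - j) \<le> subdegree (coeff Q j) * k" using slope[of "n - j"] by simp
      moreover have "subdegree (coeff Q j) \<le> m div k" using * by (intro subdegree_leI)
      hence "subdegree (coeff Q j) * k \<le> m div k * k" by simp
      hence "subdegree (coeff Q j) * k \<le> m" using *(1) by simp
      ultimately show False using that by simp
    qed
    have cj: "ramify k (coeff Q j) = c j * fps_X ^ (p * (n - j))" for j
      by (rule fps_ext) (auto simp: c_def low fps_X_power_mult_right_nth)
    define P1 where "P1 = (\<Sum>j\<le>n. monom (c j) j)"
    have cP1: "coeff P1 j = (if j \<le> n then c j else 0)" for j
      by (auto simp: P1_def coeff_sum)
    have kpos: "k > 0" using kn by simp
    interpret rk: comm_ring_hom "ramify k" by (rule ramify_hom) fact
    have cn: "c n = 1" using mon deg unfolding c_def by simp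
    have dP1: "degree P1 = n"
      by (intro antisym degree_le le_degree) (auto simp: cP1 cn)
    define P0 where "P0 = map_poly (\<lambda>c. c $ 0) P1"
    have cP0: "coeff P0 j = coeff P1 j $ 0" for j by (simp add: P0_def coeff_map_poly)
    have dP0: "degree P0 = n"
      by (intro antisym degree_le le_degree) (auto simp: cP0 cP1 cn)
    have lP0: "lead_coeff P0 = 1" by (simp add: dP0 cP0 cP1 cn)
    have "coeff P0 (n - 1) = 0" using c0 by (simp add: cP0 cP1 c_def)
    have "coeff P0 (n - k) \<noteq> 0"
      using kn by (simp add: cP0 cP1 c_def ramify_nth p_def)
    have "\<not> constant (poly P0)" using dP0 deg by (simp add: constant_degree)
    then obtain r where r: "poly P0 r = 0" using fundamental_theorem_of_algebra by blast
    have P0nz: "P0 \<noteq> 0" using lP0 by auto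
    define m where "m = order r P0"
    have m: "m \<ge> 1" using r P0nz unfolding m_def by (metis One_nat_def Suc_leI gr0I order_root)
    obtain \<beta> where \<beta>: "P0 = [:-r, 1:] ^ m * \<beta>" "\<not> [:-r, 1:] dvd \<beta>"
      using order_decomp[OF P0nz] unfolding m_def by blast
    define \<alpha> where "\<alpha> = [:-r, 1:] ^ m"
    have \<alpha>: "lead_coeff \<alpha> = 1" "degree \<alpha> = m"
      unfolding \<alpha>_def by (simp_all add: degree_linear_power coeff_linear_power)
    have l\<beta>: "lead_coeff \<beta> = 1" using lP0 \<beta>(1) \<alpha> unfolding \<alpha>_def[symmetric] by (simp add: lead_coeff_mult)
    have cop: "coprime \<alpha> \<beta>"
    proof -
      have "coprime [:-r, 1:] \<beta>"
        using \<beta>(2) by (intro prime_elem_imp_coprime) (auto intro: prime_elem_linear_field_poly)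
      thus ?thesis unfolding \<alpha>_def by simp
    qed
    have d\<beta>: "degree \<beta> \<ge> 1"
    proof (rule ccontr)
      assume "\<not> degree \<beta> \<ge> 1"
      hence "degree \<beta> = 0" by simp
      hence "\<beta> = 1" using l\<beta> by (metis degree_eq_zeroE lead_coeff_pCons(2) one_pCons)
      hence P0: "P0 = [:-r, 1:] ^ n" using \<beta>(1) dP0 \<alpha> unfolding \<alpha>_def by simp
      have "n choose (n - 1) = n" using deg by (subst binomial_symmetric) auto
      with P0 have "coeff P0 (n - 1) = of_nat n * (- r)"
        using deg by (simp add: coeff_linear_poly_power)
      with \<open>coeff P0 (n - 1) = 0\<close> deg have "r = 0" by simp
      hence "coeff P0 (n - k) = 0" using kn unfolding P0 by (simp add: coeff_linear_poly_power)
      thus False using \<open>coeff P0 (n - k) \<noteq> 0\<close> by simp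
    qed
    have "\<exists>A B. P1 = A * B \<and> lead_coeff A = 1 \<and> lead_coeff B = 1 \<and>
               degree A = degree \<alpha> \<and> degree B = degree \<beta>"
      by (rule hensel[OF _ _ cop]) (use \<alpha> l\<beta> d\<beta> m \<beta>(1) in \<open>auto simp: dP1 cP1 cn P0_def \<alpha>_def\<close>)
    then obtain A B where AB: "P1 = A * B" "lead_coeff A = 1" "lead_coeff B = 1"
      "degree A = degree \<alpha>" "degree B = degree \<beta>" by blast
    have "degree P1 = degree A + degree B" using AB by (metis degree_mult_eq leading_coeff_0_iff zero_neq_one)
    hence lt: "degree A < n" "degree B < n" using dP1 AB d\<beta> m \<alpha> by auto
    obtain N1 vs1 where 1: "N1 > 0" "map_poly (ramify N1) A = (\<Prod>v\<leftarrow>vs1. [:-v, 1:])"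
      using IH[OF AB(2) lt(1)] by blast
    obtain N2 vs2 where 2: "N2 > 0" "map_poly (ramify N2) B = (\<Prod>v\<leftarrow>vs2. [:-v, 1:])"
      using IH[OF AB(3) lt(2)] by blast
    \<comment> \<open>The two factors split after different ramifications; both are refined to the
      common index \<open>N1 * N2\<close>.\<close>
    define N where "N = N1 * N2"
    have N: "N > 0" using 1 2 by (simp add: N_def)
    interpret h1: comm_ring_hom "ramify N1" by (rule ramify_hom) fact
    interpret h2: comm_ring_hom "ramify N2" by (rule ramify_hom) fact
    interpret hN: comm_ring_hom "ramify N" by (rule ramify_hom) fact
    interpret mN: map_poly_comm_ring_hom "ramify N" ..
    have rr: "map_poly (ramify N) X = map_poly (ramify N2) (map_poly (ramify N1) X)"
             "map_poly (ramify N) X = map_poly (ramify N1) (map_poly (ramify N2) X)" for X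
      using 1 2 by (auto intro!: poly_eqI simp: coeff_map_poly ramify_ramify N_def mult.commute)
    define ws where "ws = map (ramify N2) vs1 @ map (ramify N1) vs2"
    have "map_poly (ramify N) P1 = map_poly (ramify N) A * map_poly (ramify N) B"
      by (simp add: AB hom_distribs)
    also have "map_poly (ramify N) A = (\<Prod>v\<leftarrow>vs1. [:- ramify N2 v, 1:])"
      unfolding rr(1) 1 by (rule map_poly_prod_linear) (rule ramify_hom, fact)
    also have "map_poly (ramify N) B = (\<Prod>v\<leftarrow>vs2. [:- ramify N1 v, 1:])"
      unfolding rr(2) 2 by (rule map_poly_prod_linear) (rule ramify_hom, fact)
    finally have sP1: "map_poly (ramify N) P1 = (\<Prod>v\<leftarrow>ws. [:-v, 1:])"
      by (simp add: ws_def o_def)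
    have "degree (map_poly (ramify N) P1) = n"
    proof (rule antisym)
      show "degree (map_poly (ramify N) P1) \<le> n" using degree_map_poly_le[of "ramify N" P1] dP1 by simp
      show "n \<le> degree (map_poly (ramify N) P1)" by (rule le_degree) (simp add: coeff_map_poly cP1 cn)
    qed
    hence lws: "length ws = n" using degree_prod_linear[of ws] sP1 by simp
    \<comment> \<open>In the final parameter u = s^(k N), the old scaling factor s^p reads s^(N
      p).\<close>
    define \<tau> :: "complex fps" where "\<tau> = fps_X ^ (N * p)"
    have "map_poly (ramify (k * N)) Q = (\<Prod>v\<leftarrow>ws. [:-(\<tau> * v), 1:])"
    proof (rule poly_eqI)
      fix j
      show "coeff (map_poly (ramify (k * N)) Q) j = coeff (\<Prod>v\<leftarrow>ws. [:-(\<tau> * v), 1:]) j"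
      proof (cases "j \<le> n")
        case True
        have "coeff (map_poly (ramify (k * N)) Q) j = ramify N (ramify k (coeff Q j))"
          using kpos N by (simp add: coeff_map_poly ramify_ramify)
        also have "\<dots> = ramify N (c j) * \<tau> ^ (n - j)"
          unfolding cj hN.hom_mult ramify_X_power[OF N] by (simp add: \<tau>_def power_mult[symmetric] mult.assoc)
        also have "ramify N (c j) = coeff (\<Prod>v\<leftarrow>ws. [:-v, 1:]) j"
          using True by (simp add: sP1[symmetric] coeff_map_poly cP1)
        finally show ?thesis
          using coeff_prod_linear_scale[of j ws \<tau>] True lws by simp
      next
        case False
        have "degree (\<Prod>v\<leftarrow>ws. [:-(\<tau> * v), 1:]) = n"
          using degree_prod_linear[of "map ((*) \<tau>) ws"] lws by (simp add: o_def)
        thus ?thesis using False deg kpos N by (simp add: coeff_map_poly coeff_eq_0 ramify_def)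
      qed
    qed
    also have "(\<Prod>v\<leftarrow>ws. [:-(\<tau> * v), 1:]) = (\<Prod>v\<leftarrow>map ((*) \<tau>) ws. [:-v, 1:])" by (simp add: o_def)
    finally show ?thesis using kpos N by (metis mult_pos_pos)
  qed
qed

text \<open>Being monic makes the roots integral, hence power series and not merely Laurent series.
  Depressing \<open>P\<close> first only translates the roots by \<open>ramify N h\<close>.\<close>

theorem puiseux:
  fixes P :: "complex fps poly"
  assumes "lead_coeff P = 1"
  shows "\<exists>N>0. \<exists>vs. map_poly (ramify N) P = (\<Prod>v\<leftarrow>vs. [:-v, 1:])"
  using assms
proof (induction "degree P" arbitrary: P rule: less_induct)
  case less
  define n where "n = degree P"
  show ?case
  proof (cases "n = 0")
    case True
    hence "P = 1" using less.prems by (metis degree_eq_zeroE lead_coeff_pCons(2) n_def one_pCons)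
    thus ?thesis by (intro exI[of _ 1]) (auto intro!: exI[of _ "[]"] simp: ramify_1 map_poly_1 ramify_def)
  next
    case False
    define h where "h = coeff P (n - 1) * fps_const (1 / of_nat n)"
    define Q where "Q = pcompose P [:-h, 1:]"
    have dQ: "degree Q = n" unfolding Q_def n_def by (simp add: degree_pcompose)
    have lQ: "lead_coeff Q = 1" unfolding Q_def using less.prems by (subst lead_coeff_comp) auto
    have cQ: "coeff Q (n - 1) = 0"
      unfolding Q_def h_def using less.prems False by (intro coeff_pcompose_depress) (auto simp: n_def)
    obtain N vs where N: "N > 0" "map_poly (ramify N) Q = (\<Prod>v\<leftarrow>vs. [:-v, 1:])"
      using puiseux_depressed[OF lQ dQ _ cQ] less.hyps False unfolding n_def by auto
    interpret hN: comm_ring_hom "ramify N" by (rule ramify_hom) fact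
    have "P = pcompose Q [:h, 1:]"
      unfolding Q_def by (simp add: pcompose_assoc[symmetric] pcompose_pCons)
    hence "map_poly (ramify N) P = pcompose (map_poly (ramify N) Q) [:ramify N h, 1:]"
      by (simp add: hN.map_poly_pcompose hom_distribs)
    also have "\<dots> = (\<Prod>v\<leftarrow>map (\<lambda>v. v - ramify N h) vs. [:-v, 1:])"
      unfolding N(2) pcompose_prod_linear by (simp add: o_def)
    finally show ?thesis using N(1) by blast
  qed
qed

section \<open>Intersection dimension and orders along branches\<close>

text \<open>Elimination of the last equation with pivot \<open>i\<close>. Kept as bare linear
  algebra because it serves twice: to count dimensions over power series and to compare independent
  with spanning lists in the local ring.\<close>

lemma nontrivial_relation:
  fixes a :: "'i \<Rightarrow> nat \<Rightarrow> 'a :: field"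
  assumes "finite J" "card J > E"
  shows "\<exists>c. (\<exists>j\<in>J. c j \<noteq> 0) \<and> (\<forall>k<E. (\<Sum>j\<in>J. c j * a j k) = 0)"
  using assms
proof (induction E arbitrary: J a)
  case 0
  hence "J \<noteq> {}" by auto
  thus ?case by (intro exI[of _ "\<lambda>_. 1"]) auto
next
  case (Suc E)
  show ?case
  proof (cases "\<forall>j\<in>J. a j E = 0")
    case True
    have "\<exists>c. (\<exists>j\<in>J. c j \<noteq> 0) \<and> (\<forall>k<E. (\<Sum>j\<in>J. c j * a j k) = 0)"
      by (rule Suc.IH) (use Suc.prems in auto)
    then obtain c where c: "\<exists>j\<in>J. c j \<noteq> 0" "\<forall>k<E. (\<Sum>j\<in>J. c j * a j k) = 0" by blast
    have "(\<Sum>j\<in>J. c j * a j E) = 0" using True by simp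
    with c show ?thesis by (intro exI[of _ c]) (auto simp: less_Suc_eq)
  next
    case False
    then obtain i where i: "i \<in> J" "a i E \<noteq> 0" by blast
    define a' where "a' j k = a j k - a j E / a i E * a i k" for j k
    have "\<exists>c. (\<exists>j\<in>J - {i}. c j \<noteq> 0) \<and> (\<forall>k<E. (\<Sum>j\<in>J - {i}. c j * a' j k) = 0)"
      by (rule Suc.IH) (use Suc.prems i in auto)
    then obtain c where c: "\<exists>j\<in>J - {i}. c j \<noteq> 0" "\<forall>k<E. (\<Sum>j\<in>J - {i}. c j * a' j k) = 0" by blast
    define s where "s = (\<Sum>j\<in>J - {i}. c j * a j E)"
    define c' where "c' = c(i := - s / a i E)"
    have sum: "(\<Sum>j\<in>J. c' j * a j k) = (\<Sum>j\<in>J - {i}. c j * a j k) - s / a i E * a i k" for k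
      using Suc.prems i by (simp add: sum.remove[of J i] c'_def)
    have sum': "(\<Sum>j\<in>J - {i}. c j * a' j k) = (\<Sum>j\<in>J - {i}. c j * a j k) - s / a i E * a i k" for k
      unfolding a'_def s_def
      by (simp add: right_diff_distrib sum_subtractf sum_divide_distrib sum_distrib_right mult.assoc)
    have "(\<Sum>j\<in>J. c' j * a j k) = 0" if "k < Suc E" for k
    proof (cases "k = E")
      case True thus ?thesis unfolding sum using i by (simp add: s_def)
    next
      case False thus ?thesis using that c(2) unfolding sum sum'[symmetric] by simp
    qed
    moreover have "\<exists>j\<in>J. c' j \<noteq> 0" using c(1) by (auto simp: c'_def)
    ultimately show ?thesis by blast
  qed
qed

section \<open>Spanning sets of quotients over power series\<close>

lemma fps_const_sum: "fps_const (\<Sum>i\<in>I. f i) = (\<Sum>i\<in>I. fps_const (f i :: 'a :: comm_ring_1))"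
  by (induction I rule: infinite_finite_induct) (auto simp flip: fps_const_add)

text \<open>One root is peeled off at a time. Modulo \<open>[:-v, 1:]\<close> the quotient by
  \<open>g\<close> is C[[s]] / (g(v)), spanned by 1, ..., s^(n - 1) where n is the order of g(v);
  what remains is \<open>[:-v, 1:]\<close> times an element of the quotient for the other
  roots.\<close>

lemma fps_poly_quotient_span:
  fixes g :: "complex fps poly"
  assumes "\<And>v. v \<in> set vs \<Longrightarrow> poly g v \<noteq> 0"
  shows "\<exists>e :: nat \<Rightarrow> complex fps poly. \<forall>P. \<exists>c A B.
    P = (\<Sum>k<(\<Sum>v\<leftarrow>vs. subdegree (poly g v)). [:fps_const (c k):] * e k) + A * (\<Prod>v\<leftarrow>vs. [:-v, 1:]) + B * g"
  using assms
proof (induction vs)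
  case Nil
  have "P = (\<Sum>k<0. [:fps_const (0 :: complex):] * (0 :: complex fps poly)) + P * 1 + 0 * g" for P by simp
  thus ?case by (simp only: list.map sum_list.Nil prod_list.Nil) (intro exI[of _ "\<lambda>_. 0"] allI, blast)
next
  case (Cons v vs)
  define E where "E = (\<Sum>v\<leftarrow>vs. subdegree (poly g v))"
  define n where "n = subdegree (poly g v)"
  define F where "F = (\<Prod>v\<leftarrow>vs. [:-v, 1:])"
  define L where "L = [:-v, 1:]"
  from Cons obtain e where e: "\<And>P. \<exists>c A B. P = (\<Sum>k<E. [:fps_const (c k):] * e k) + A * F + B * g"
    unfolding E_def F_def by auto
  define e' where "e' k = (if k < n then [:fps_X ^ k:] else L * e (k - n))" for k
  have "\<exists>c A B. P = (\<Sum>k<n + E. [:fps_const (c k):] * e' k) + A * (L * F) + B * g" for P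
  proof -
    define p where "p = poly P v"
    \<comment> \<open>The part of \<open>p\<close> of order at least \<open>n\<close>, hence a
      multiple of \<open>poly g v\<close>.\<close>
    define w where "w = p - (\<Sum>k<n. fps_const (fps_nth p k) * fps_X ^ k)"
    have w0: "fps_nth w i = 0" if "i < n" for i
      using that by (simp add: w_def fps_sum_nth if_distrib cong: if_cong)
    have "poly g v dvd w"
    proof (cases "w = 0")
      case False
      hence "n \<le> subdegree w" using w0 by (intro subdegree_geI) auto
      thus ?thesis using Cons.prems[of v] False by (simp add: fps_dvd_iff n_def)
    qed auto
    then obtain T where T: "w = poly g v * T" by (elim dvdE)
    define S where "S = synthetic_div g v"
    have S: "L * S + [:poly g v:] = g" unfolding S_def L_def by (rule synthetic_div_correct')
    have Q: "L * synthetic_div P v + [:p:] = P" unfolding L_def p_def by (rule synthetic_div_correct')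
    \<comment> \<open>Since g(v) = g - L S, replacing \<open>w\<close> by \<open>g * T\<close> is
      off by \<open>L * S * T\<close>. This error is a multiple of \<open>L\<close> and is charged
      to the quotient of \<open>P\<close> by \<open>L\<close> before the induction hypothesis is
      applied.\<close>
    obtain c A B where cAB: "synthetic_div P v - S * [:T:] = (\<Sum>k<E. [:fps_const (c k):] * e k) + A * F + B * g"
      using e by blast
    define c' where "c' k = (if k < n then fps_nth p k else c (k - n))" for k
    have "(\<Sum>k<n + E. [:fps_const (c' k):] * e' k) =
      (\<Sum>k<n. [:fps_const (c' k):] * e' k) + (\<Sum>k<E. [:fps_const (c' (n + k)):] * e' (n + k))"
      by (induction E) (simp_all add: algebra_simps)
    also have "(\<Sum>k<n. [:fps_const (c' k):] * e' k) = (\<Sum>k<n. [:fps_const (fps_nth p k) * fps_X ^ k:])"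
      by (rule sum.cong) (auto simp: c'_def e'_def)
    also have "\<dots> = [:p - w:]" unfolding w_def by (induction n) simp_all
    also have "(\<Sum>k<E. [:fps_const (c' (n + k)):] * e' (n + k)) = L * (\<Sum>k<E. [:fps_const (c k):] * e k)"
      by (simp add: c'_def e'_def sum_distrib_left mult_ac del: mult_pCons_left mult_pCons_right)
    finally have sum: "(\<Sum>k<n + E. [:fps_const (c' k):] * e' k) = 
        [:p - w:] + L * (synthetic_div P v - S * [:T:] - A * F - B * g)"
      using cAB by (simp add: algebra_simps)
    define T' where "T' = [:T:]"
    have "[:w:] = [:poly g v:] * T'" using T by (simp add: T'_def)
    also have "[:poly g v:] = g - L * S" using S by (metis add_diff_cancel_left')
    finally have w: "[:w:] = (g - L * S) * T'" .
    have "[:p - w:] + [:w:] = [:p:]" by simp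
    hence "P = [:p - w:] + [:w:] + L * synthetic_div P v" using Q by (metis add.commute)
    also have "\<dots> = ([:p - w:] + L * (synthetic_div P v - S * T' - A * F - B * g)) + A * (L * F) + (T' + L * B) * g"
      unfolding w by (simp add: algebra_simps)
    finally have "P = (\<Sum>k<n + E. [:fps_const (c' k):] * e' k) + A * (L * F) + (T' + L * B) * g"
      unfolding sum T'_def .
    thus ?thesis by blast
  qed
  thus ?case unfolding E_def n_def F_def L_def by auto
qed

text \<open>The substitution \<open>u = s ^ N\<close>; a branch of \<open>F\<close> is then a root in \<open>\<complex>[[s]]\<close> of \<open>branch_poly N F\<close>.\<close>

definition branch_coeff :: "nat \<Rightarrow> complex poly \<Rightarrow> complex fps" where
  "branch_coeff N p = ramify N (fps_of_poly p)"

definition branch_poly :: "nat \<Rightarrow> bipoly \<Rightarrow> complex fps poly" where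
  "branch_poly N F = map_poly (branch_coeff N) F"

lemma branch_coeff_hom: "N > 0 \<Longrightarrow> comm_ring_hom (branch_coeff N)"
proof -
  assume "N > 0"
  then interpret comm_ring_hom "ramify N" by (rule ramify_hom)
  show ?thesis unfolding branch_coeff_def
    by unfold_locales (simp_all add: fps_of_poly_add fps_of_poly_mult hom_distribs)
qed

lemma comm_ring_hom_map_poly: "comm_ring_hom h \<Longrightarrow> comm_ring_hom (map_poly h)"
proof -
  assume "comm_ring_hom h"
  then interpret h: comm_ring_hom h .
  interpret mh: map_poly_comm_ring_hom h ..
  show ?thesis by unfold_locales
qed

lemma branch_poly_hom: "N > 0 \<Longrightarrow> comm_ring_hom (branch_poly N)"
  using comm_ring_hom_map_poly[OF branch_coeff_hom] by (simp add: branch_poly_def[abs_def])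

lemma branch_coeff_pCons:
  assumes "N > 0"
  shows "branch_coeff N (pCons a p) = fps_const a + fps_X ^ N * branch_coeff N p"
proof -
  interpret comm_ring_hom "ramify N" by (rule ramify_hom) fact
  have "branch_coeff N (pCons a p) = ramify N (fps_const a) + ramify N fps_X * branch_coeff N p"
    by (simp add: branch_coeff_def fps_of_poly_pCons hom_add hom_mult mult.commute)
  also have "ramify N fps_X = fps_X ^ N" using ramify_X_power[of N 1] assms by simp
  finally show ?thesis by (simp add: ramify_def)
qed

text \<open>C[[s]] is a free module over C[[u]], u = s^N, with basis 1, s, ..., s^(N - 1). For k < N
  this is the coordinate at s^k, written as a series in u.\<close>

definition fps_section :: "nat \<Rightarrow> nat \<Rightarrow> complex fps \<Rightarrow> complex fps" where
  "fps_section N k A = Abs_fps (\<lambda>n. fps_nth A (k + N * n))"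

lemma fps_section_0: "fps_section N k 0 = 0"
  by (rule fps_ext) (simp add: fps_section_def)

lemma fps_section_add: "fps_section N k (A + B) = fps_section N k A + fps_section N k B"
  by (rule fps_ext) (simp add: fps_section_def)

lemma fps_section_sum: "fps_section N k (\<Sum>i\<in>I. f i) = (\<Sum>i\<in>I. fps_section N k (f i))"
  by (induction I rule: infinite_finite_induct) (simp_all add: fps_section_0 fps_section_add)

lemma fps_section_const_mult: "fps_section N k (fps_const c * A) = fps_const c * fps_section N k A"
  by (rule fps_ext) (simp add: fps_section_def)

text \<open>Linearity of the coordinate map over C[u]: multiplication by u = s^N moves the exponents
  within one residue class. It lets relations with coefficients in C[[s]] descend to C[[u]].\<close>

lemma fps_section_mult:
  assumes "k < N"
  shows "fps_section N k (A * branch_coeff N p) = fps_section N k A * fps_of_poly p"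
proof (induction p arbitrary: A)
  case 0
  thus ?case by (simp add: branch_coeff_def ramify_def fps_section_0)
next
  case (pCons a p)
  have X: "fps_section N k (fps_X ^ N * C) = fps_X * fps_section N k C" for C
  proof (rule fps_ext)
    fix n show "fps_nth (fps_section N k (fps_X ^ N * C)) n = fps_nth (fps_X * fps_section N k C) n"
      using assms by (cases n) (auto simp: fps_section_def fps_X_power_mult_nth)
  qed
  have "A * branch_coeff N (pCons a p) = fps_const a * A + fps_X ^ N * (A * branch_coeff N p)"
    using assms by (simp add: branch_coeff_pCons algebra_simps)
  thus ?case
    by (simp only: fps_section_add fps_section_const_mult X pCons.IH) (simp add: fps_of_poly_pCons algebra_simps)
qed

lemma map_poly_fps_section_mult:
  assumes "k < N"
  shows "map_poly (fps_section N k) (A * branch_poly N F) = map_poly (fps_section N k) A * map_poly fps_of_poly F"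
proof -
  interpret comm_ring_hom "branch_coeff N" using assms by (intro branch_coeff_hom) auto
  show ?thesis
    by (rule poly_eqI) (use assms in \<open>simp add: coeff_map_poly fps_section_0 coeff_mult fps_section_sum
      fps_section_mult branch_poly_def\<close>)
qed

lemma fps_section_X_power:
  "k < N \<Longrightarrow> l < N \<Longrightarrow> fps_section N k (fps_X ^ l) = (if k = l then 1 else 0)"
proof (rule fps_ext)
  fix n assume kl: "k < N" "l < N"
  have "k + N * n = l \<longleftrightarrow> k = l \<and> n = 0"
  proof
    assume "k + N * n = l"
    hence "(k + N * n) mod N = l mod N" "(k + N * n) div N = l div N" by auto
    thus "k = l \<and> n = 0" using kl by simp
  qed auto
  thus "fps_nth (fps_section N k (fps_X ^ l)) n = fps_nth (if k = l then 1 else 0) n"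
    by (auto simp: fps_section_def)
qed

lemma const_monom_dvd_iff:
  "[:monom 1 r:] dvd (D :: bipoly) \<longleftrightarrow> (\<forall>j. \<forall>i<r. coeff (coeff D j) i = 0)"
  by (simp add: const_poly_dvd_iff monom_1_dvd_iff')

text \<open>If the \<open>P j\<close> are independent, then so are the \<open>N * m\<close> elements \<open>s ^ k * P j\<close> with \<open>k < N\<close> over
  power series. Cutting off the power series at order \<open>r\<close> is harmless because \<open>u ^ r\<close> is in the ideal.\<close>

lemma intersection_dim_le_branch_orders:
  fixes f g :: bipoly and P :: "nat \<Rightarrow> bipoly"
  assumes N: "N > 0"
    and f: "branch_poly N f = (\<Prod>v\<leftarrow>vs. [:-v, 1:])"
    and g: "\<And>v. v \<in> set vs \<Longrightarrow> poly (branch_poly N g) v \<noteq> 0"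
    and H0: "H0 * [:monom 1 r:] = U0 * f + V0 * g" "beval H0 0 0 \<noteq> 0"
    and indep: "\<And>c U V H. beval H 0 0 \<noteq> 0 \<Longrightarrow> H * (\<Sum>j<m. [:[:c j:]:] * P j) = U * f + V * g
                 \<Longrightarrow> \<forall>j<m. c j = 0"
  shows "N * m \<le> (\<Sum>v\<leftarrow>vs. subdegree (poly (branch_poly N g) v))"
proof (rule ccontr)
  define E where "E = (\<Sum>v\<leftarrow>vs. subdegree (poly (branch_poly N g) v))"
  define J where "J = {..<m} \<times> {..<N}"
  define h where "h = (\<lambda>(j, k). [:fps_X ^ k:] * branch_poly N (P j))"
  interpret bc: comm_ring_hom "branch_coeff N" by (rule branch_coeff_hom) fact
  assume "\<not> ?thesis"
  hence cJ: "card J > E" "finite J" by (auto simp: J_def E_def mult.commute)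
  obtain e where e: "\<And>Q. \<exists>c A B. Q = (\<Sum>k<E. [:fps_const (c k):] * e k) + A * branch_poly N f + B * branch_poly N g"
    using fps_poly_quotient_span[of vs "branch_poly N g"] g unfolding E_def f by blast
  have "\<forall>j. \<exists>c A B. h j = (\<Sum>k<E. [:fps_const (c k):] * e k) + A * branch_poly N f + B * branch_poly N g"
    using e by blast
  then obtain a A B where aAB: "\<And>j. h j = (\<Sum>k<E. [:fps_const (a j k):] * e k) + A j * branch_poly N f + B j * branch_poly N g"
    by metis
  obtain c where c: "\<exists>j\<in>J. c j \<noteq> 0" "\<And>k. k < E \<Longrightarrow> (\<Sum>j\<in>J. c j * a j k) = 0"
    using nontrivial_relation[OF cJ(2,1), of a] by blast
  define AA where "AA = (\<Sum>j\<in>J. [:fps_const (c j):] * A j)"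
  define BB where "BB = (\<Sum>j\<in>J. [:fps_const (c j):] * B j)"
  have "(\<Sum>j\<in>J. [:fps_const (c j):] * h j) =
     (\<Sum>j\<in>J. \<Sum>k<E. [:fps_const (c j * a j k):] * e k) + AA * branch_poly N f + BB * branch_poly N g"
    unfolding AA_def BB_def
    by (subst aAB) (simp add: algebra_simps sum.distrib sum_distrib_left sum_distrib_right smult_sum2 fps_const_mult[symmetric] del: fps_const_mult)
  also have "(\<Sum>j\<in>J. \<Sum>k<E. [:fps_const (c j * a j k):] * e k) = (\<Sum>k<E. \<Sum>j\<in>J. [:fps_const (c j * a j k):] * e k)"
    by (rule sum.swap)
  also have "\<dots> = (\<Sum>k<E. [:fps_const (\<Sum>j\<in>J. c j * a j k):] * e k)"
    by (rule sum.cong) (simp_all add: fps_const_sum Polynomial.smult_sum)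
  also have "\<dots> = 0" using c(2) by simp
  finally have rel: "(\<Sum>j\<in>J. [:fps_const (c j):] * h j) = AA * branch_poly N f + BB * branch_poly N g" by simp
  \<comment> \<open>Projecting to the coordinate at \<open>k0\<close>, where some coefficient is
    nonzero, turns the relation over C[[s]] into one over C[[u]] that involves only the constants
    \<open>c (j, k0)\<close>.\<close>
  obtain j0 k0 where jk0: "j0 < m" "k0 < N" "c (j0, k0) \<noteq> 0" using c(1) by (auto simp: J_def)
  define sec where "sec = map_poly (fps_section N k0)"
  have sec_add: "sec (X + Y) = sec X + sec Y" for X Y
    by (rule poly_eqI) (simp add: sec_def coeff_map_poly fps_section_0 fps_section_add)
  have sec_sum: "sec (\<Sum>j\<in>J. X j) = (\<Sum>j\<in>J. sec (X j))" for X
    by (rule poly_eqI) (simp add: sec_def coeff_map_poly fps_section_0 fps_section_sum coeff_sum)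
  have sec_h: "sec ([:fps_const x:] * h (j, k)) = (if k = k0 then map_poly fps_of_poly ([:[:x:]:] * P j) else 0)"
    if "k < N" for x j k
  proof (rule poly_eqI)
    fix n
    have "coeff (sec ([:fps_const x:] * h (j, k))) n =
       fps_section N k0 (fps_const x * (fps_X ^ k * branch_coeff N (coeff (P j) n)))"
      by (simp add: sec_def coeff_map_poly fps_section_0 h_def branch_poly_def mult_ac)
    also have "\<dots> = fps_const x * (if k0 = k then fps_of_poly (coeff (P j) n) else 0)"
      using that jk0 by (simp add: fps_section_const_mult fps_section_mult fps_section_X_power)
    finally show "coeff (sec ([:fps_const x:] * h (j, k))) n = coeff (if k = k0 then map_poly fps_of_poly ([:[:x:]:] * P j) else 0) n"
      by (auto simp: coeff_map_poly fps_of_poly_smult)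
  qed
  define S where "S = (\<Sum>j<m. [:[:c (j, k0):]:] * P j)"
  have "sec (\<Sum>j\<in>J. [:fps_const (c j):] * h j) = (\<Sum>j<m. \<Sum>k<N. sec ([:fps_const (c (j, k)):] * h (j, k)))"
    unfolding sec_sum unfolding J_def sum.cartesian_product by (rule sum.cong) auto
  also have "\<dots> = (\<Sum>j<m. map_poly fps_of_poly ([:[:c (j, k0):]:] * P j))"
  proof (intro sum.cong refl)
    fix j
    have "(\<Sum>k<N. sec ([:fps_const (c (j, k)):] * h (j, k))) =
      (\<Sum>k<N. if k = k0 then map_poly fps_of_poly ([:[:c (j, k0):]:] * P j) else 0)"
      by (rule sum.cong[OF refl], subst sec_h) auto
    thus "(\<Sum>k<N. sec ([:fps_const (c (j, k)):] * h (j, k))) = map_poly fps_of_poly ([:[:c (j, k0):]:] * P j)"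
      using jk0 by simp
  qed
  also have "\<dots> = map_poly fps_of_poly S"
    by (rule poly_eqI) (simp add: S_def coeff_map_poly coeff_sum fps_of_poly_sum)
  finally have S: "map_poly fps_of_poly S = sec AA * map_poly fps_of_poly f + sec BB * map_poly fps_of_poly g"
    unfolding rel sec_add unfolding sec_def using jk0 by (simp add: map_poly_fps_section_mult)
  define tr where "tr = map_poly (\<lambda>w. \<Sum>i<r. monom (fps_nth w i) i :: complex poly)"
  have ctr: "coeff (coeff (tr X) j) i = (if i < r then fps_nth (coeff X j) i else 0)" for X i j
    by (auto simp: tr_def coeff_map_poly coeff_sum)
  \<comment> \<open>Truncation changes the two cofactors only from order \<open>r\<close> in u on,
    so u^r divides \<open>D\<close>.\<close>
  define D where "D = S - (tr (sec AA) * f + tr (sec BB) * g)"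
  have low: "(\<Sum>l\<le>i. coeff (coeff (tr X) a) l * coeff (coeff Y b) (i - l)) =
             (\<Sum>l\<le>i. fps_nth (coeff X a) l * coeff (coeff Y b) (i - l))" if "i < r" for X Y a b i
    using that by (intro sum.cong) (auto simp: ctr)
  have "coeff (coeff D n) i = 0" if "i < r" for n i
  proof -
    have "coeff (coeff S n) i = fps_nth (coeff (map_poly fps_of_poly S) n) i"
      by (simp add: coeff_map_poly)
    thus ?thesis using that unfolding S
      by (simp add: D_def coeff_map_poly coeff_mult coeff_sum fps_sum_nth fps_mult_nth low atLeast0AtMost)
  qed
  hence "[:monom 1 r:] dvd D" by (simp add: const_monom_dvd_iff)
  then obtain D' where D': "D = [:monom 1 r:] * D'" by (elim dvdE)
  \<comment> \<open>u^r lies in the polynomial ideal only after multiplication by \<open>H0\<close>,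
    a unit at the origin; the hypothesis \<open>indep\<close> allows for such a multiplier.\<close>
  have "H0 * S = H0 * D + H0 * (tr (sec AA) * f + tr (sec BB) * g)"
    by (simp add: D_def algebra_simps)
  also have "H0 * D = (U0 * f + V0 * g) * D'" unfolding D' H0(1)[symmetric] by (simp only: mult.assoc)
  finally have "H0 * S = (U0 * D' + H0 * tr (sec AA)) * f + (V0 * D' + H0 * tr (sec BB)) * g"
    by (simp only: algebra_simps)
  from indep[OF H0(2) this[unfolded S_def]] jk0 show False by simp
qed

section \<open>Bezout bound along branches\<close>

text \<open>An upper bound instead of the exact degree: it passes through sums and products without
  any case of cancellation, and zero satisfies it for every \<open>D\<close>.\<close>

definition tdeg_le :: "nat \<Rightarrow> bipoly \<Rightarrow> bool" where
  "tdeg_le D F \<longleftrightarrow> (\<forall>i j. bcoeff F i j \<noteq> 0 \<longrightarrow> i + j \<le> D)"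

lemma tdeg_leI: "(\<And>i j. coeff (coeff F j) i \<noteq> 0 \<Longrightarrow> i + j \<le> D) \<Longrightarrow> tdeg_le D F"
  by (auto simp: tdeg_le_def bcoeff_def)

lemma tdeg_leD: "tdeg_le D F \<Longrightarrow> coeff (coeff F j) i \<noteq> 0 \<Longrightarrow> i + j \<le> D"
  by (auto simp: tdeg_le_def bcoeff_def)

lemma tdeg_le_mono: "tdeg_le D F \<Longrightarrow> D \<le> E \<Longrightarrow> tdeg_le E F"
  by (fastforce simp: tdeg_le_def)

lemma tdeg_le_zero [simp]: "tdeg_le D 0"
  by (simp add: tdeg_le_def bcoeff_def)

lemma tdeg_le_const [simp]: "tdeg_le D [:[:c:]:]"
  by (rule tdeg_leI) (auto simp: coeff_pCons split: nat.splits)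

lemma tdeg_le_one [simp]: "tdeg_le D 1"
  using tdeg_le_const[of D 1] by (simp add: one_pCons)

lemma tdeg_le_add: "tdeg_le D F \<Longrightarrow> tdeg_le D G \<Longrightarrow> tdeg_le D (F + G)"
  by (rule tdeg_leI) (metis add.right_neutral coeff_add tdeg_leD)

lemma tdeg_le_uminus: "tdeg_le D F \<Longrightarrow> tdeg_le D (- F)"
  by (rule tdeg_leI) (simp add: tdeg_leD)

lemma tdeg_le_diff: "tdeg_le D F \<Longrightarrow> tdeg_le D G \<Longrightarrow> tdeg_le D (F - G)"
  using tdeg_le_add[of D F "- G"] tdeg_le_uminus[of D G] by simp

lemma tdeg_le_sum: "(\<And>i. i \<in> I \<Longrightarrow> tdeg_le D (f i)) \<Longrightarrow> tdeg_le D (\<Sum>i\<in>I. f i)"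
  by (induction I rule: infinite_finite_induct) (auto intro: tdeg_le_add)

lemma tdeg_le_mult:
  assumes "tdeg_le D F" "tdeg_le E G"
  shows "tdeg_le (D + E) (F * G)"
proof (rule tdeg_leI)
  fix i j assume "coeff (coeff (F * G) j) i \<noteq> 0"
  hence "(\<Sum>k\<le>j. \<Sum>l\<le>i. coeff (coeff F k) l * coeff (coeff G (j - k)) (i - l)) \<noteq> 0"
    by (simp add: coeff_mult coeff_sum)
  then obtain k where k: "k \<le> j" "(\<Sum>l\<le>i. coeff (coeff F k) l * coeff (coeff G (j - k)) (i - l)) \<noteq> 0"
    by (meson atMost_iff sum.not_neutral_contains_not_neutral)
  then obtain l where l: "l \<le> i" "coeff (coeff F k) l * coeff (coeff G (j - k)) (i - l) \<noteq> 0"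
    by (meson atMost_iff sum.not_neutral_contains_not_neutral)
  hence "l + k \<le> D" "(i - l) + (j - k) \<le> E" using assms by (auto dest!: tdeg_leD)
  thus "i + j \<le> D + E" using k l by linarith
qed

lemma tdeg_le_prod:
  "finite I \<Longrightarrow> (\<And>i. i \<in> I \<Longrightarrow> tdeg_le (D i) (f i)) \<Longrightarrow> tdeg_le (\<Sum>i\<in>I. D i) (\<Prod>i\<in>I. f i)"
  by (induction I rule: finite_induct) (auto intro: tdeg_le_mult)

lemma tdeg_le_power: "tdeg_le D F \<Longrightarrow> tdeg_le (n * D) (F ^ n)"
  by (induction n) (auto intro: tdeg_le_mult)

section \<open>Division and determinants with control of the degree\<close>

text \<open>The degree of \<open>f\<close> in v already equals the bound on its total degree.
  Therefore the multiple \<open>T * f\<close> that cancels the top coefficient of \<open>P\<close>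
  stays within total degree \<open>D\<close>. The induction is on a bound \<open>n\<close> for the
  number of coefficients in v.\<close>

lemma monic_division_tdeg_aux:
  fixes f P :: bipoly
  assumes f: "lead_coeff f = 1" "degree f = d" "tdeg_le d f"
    and "\<forall>k\<ge>n. coeff P k = 0" "tdeg_le D P"
  shows "\<exists>Q R. P = Q * f + R \<and> (\<forall>k\<ge>d. coeff R k = 0) \<and> tdeg_le D R"
  using assms(4,5)
proof (induction n arbitrary: P)
  case 0
  have "P = 0 * f + P" by simp
  thus ?case using 0 by blast
next
  case (Suc n)
  consider "coeff P n = 0" | "n < d" "coeff P n \<noteq> 0" | "n \<ge> d" "coeff P n \<noteq> 0" by linarith
  then show ?case 
  proof cases
    case 1
    hence "\<forall>k\<ge>n. coeff P k = 0" using Suc.prems(1) by (metis le_antisym not_less_eq_eq)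
    thus ?thesis using Suc by blast
  next
    case 2
    have "P = 0 * f + P" by simp
    moreover have "\<forall>k\<ge>d. coeff P k = 0" using Suc.prems(1) 2 by auto
    ultimately show ?thesis using Suc.prems(2) by blast
  next
    case 3
    define T where "T = monom (coeff P n) (n - d)"
    have "coeff (coeff P n) (degree (coeff P n)) \<noteq> 0" using 3 by simp
    hence nD: "n \<le> D" using tdeg_leD[OF Suc.prems(2)] by fastforce
    have "tdeg_le (D - d) T"
    proof (rule tdeg_leI)
      fix i j assume "coeff (coeff T j) i \<noteq> 0"
      hence "j = n - d" "coeff (coeff P n) i \<noteq> 0" by (auto simp: T_def split: if_splits)
      thus "i + j \<le> D - d" using tdeg_leD[OF Suc.prems(2), of n i] 3 by auto
    qed
    hence "tdeg_le (D - d + d) (T * f)" using f by (intro tdeg_le_mult)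
    hence tP: "tdeg_le D (P - T * f)" using Suc.prems(2) nD 3 by (intro tdeg_le_diff) auto
    have "coeff (P - T * f) k = 0" if "k \<ge> n" for k
    proof (cases "k = n")
      case True
      thus ?thesis using 3 f(1,2) by (simp add: T_def coeff_monom_mult)
    next
      case False
      hence "coeff P k = 0" using Suc.prems(1) that by auto
      moreover have "coeff f (k - (n - d)) = 0"
        using that False f(2) 3 by (intro coeff_eq_0) auto
      ultimately show ?thesis by (simp add: T_def coeff_monom_mult)
    qed
    then obtain Q R where QR: "P - T * f = Q * f + R" "\<forall>k\<ge>d. coeff R k = 0" "tdeg_le D R"
      using Suc.IH[of "P - T * f"] tP by blast
    from QR(1) have "P = (Q + T) * f + R" by (simp add: algebra_simps)
    thus ?thesis using QR(2,3) by blast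
  qed
qed

lemma monic_division_tdeg:
  fixes f P :: bipoly
  assumes f: "lead_coeff f = 1" "degree f = d" "tdeg_le d f" and P: "tdeg_le D P"
  shows "\<exists>Q R. P = Q * f + R \<and> (\<forall>k\<ge>d. coeff R k = 0) \<and> tdeg_le D R"
  by (rule monic_division_tdeg_aux[OF f _ P, of "Suc (degree P)"]) (auto simp: coeff_eq_0)

text \<open>Over a permutation the row weights and the column weights cancel, leaving
  \<open>e\<close> per row. The condition is additive to avoid truncated subtraction and restricted
  to nonzero entries, as the zero polynomial has degree 0.\<close>

lemma degree_det_le:
  fixes M :: "complex poly mat"
  assumes M: "M \<in> carrier_mat n n"
    and deg: "\<And>j k. j < n \<Longrightarrow> k < n \<Longrightarrow> M $$ (j, k) \<noteq> 0 \<Longrightarrow> degree (M $$ (j, k)) + k \<le> e + j"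
  shows "degree (det M) \<le> n * e"
  unfolding det_def'[OF M]
proof (intro degree_sum_le finite_permutations, simp)
  fix p assume "p \<in> {p. p permutes {0..<n}}"
  hence p: "p permutes {0..<n}" by simp
  have "degree (\<Prod>i=0..<n. M $$ (i, p i)) \<le> n * e"
  proof (cases "\<forall>i\<in>{0..<n}. M $$ (i, p i) \<noteq> 0")
    case True
    have "(\<Sum>i=0..<n. degree (M $$ (i, p i))) + (\<Sum>i=0..<n. p i) = (\<Sum>i=0..<n. degree (M $$ (i, p i)) + p i)"
      by (simp add: sum.distrib)
    also have "\<dots> \<le> (\<Sum>i=0..<n. e + i)"
    proof (rule sum_mono)
      fix i assume i: "i \<in> {0..<n}"
      hence "p i \<in> {0..<n}" using permutes_in_image[OF p] by blast
      thus "degree (M $$ (i, p i)) + p i \<le> e + i" using deg[of i "p i"] i True by auto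
    qed
    also have "\<dots> = n * e + (\<Sum>i=0..<n. i)" by (simp add: sum.distrib)
    also have "(\<Sum>i=0..<n. i) = (\<Sum>i=0..<n. p i)" using sum.permute[OF p, of "\<lambda>i. i"] by (simp add: o_def)
    finally have "(\<Sum>i=0..<n. degree (M $$ (i, p i))) \<le> n * e" by simp
    thus ?thesis using degree_prod_sum_le[of "{0..<n}" "\<lambda>i. M $$ (i, p i)"] by (simp add: o_def)
  next
    case False
    hence "(\<Prod>i=0..<n. M $$ (i, p i)) = 0" by (intro prod_zero) auto
    thus ?thesis by (metis degree_0 le0)
  qed
  thus "degree (signof p * (\<Prod>i=0..<n. M $$ (i, p i))) \<le> n * e" by simp
qed

text \<open>Repeated synthetic division by the linear factors. The value of \<open>t 0\<close> is
  recorded because it becomes a diagonal entry of multiplication by \<open>P\<close> in the Newton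
  basis.\<close>

lemma newton_expansion:
  fixes P :: "'a :: comm_ring_1 poly"
  shows "\<exists>t Q. P = (\<Sum>k<length vs. [:t k:] * (\<Prod>v\<leftarrow>take k vs. [:-v, 1:])) + Q * (\<Prod>v\<leftarrow>vs. [:-v, 1:])
     \<and> (vs \<noteq> [] \<longrightarrow> t 0 = poly P (hd vs))"
proof (induction vs arbitrary: P)
  case (Cons v vs)
  define L where "L = [:-v, 1:]"
  obtain t Q where tQ: "synthetic_div P v = (\<Sum>k<length vs. [:t k:] * (\<Prod>v\<leftarrow>take k vs. [:-v, 1:])) + Q * (\<Prod>v\<leftarrow>vs. [:-v, 1:])"
    using Cons.IH by blast
  have "P = L * synthetic_div P v + [:poly P v:]" unfolding L_def by (simp only: synthetic_div_correct')
  also have "\<dots> = [:poly P v:] + (\<Sum>k<length vs. [:t k:] * (L * (\<Prod>v\<leftarrow>take k vs. [:-v, 1:]))) + Q * (L * (\<Prod>v\<leftarrow>vs. [:-v, 1:]))"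
    unfolding tQ by (simp only: algebra_simps sum_distrib_left)
  also have "\<dots> = (\<Sum>k<length (v # vs). [:(case k of 0 \<Rightarrow> poly P v | Suc k \<Rightarrow> t k):] * (\<Prod>v\<leftarrow>take k (v # vs). [:-v, 1:])) + Q * (\<Prod>v\<leftarrow>v # vs. [:-v, 1:])"
    by (simp only: L_def list.size sum.lessThan_Suc_shift add_Suc_right Nat.add_0_right nat.case take_Suc_Cons take_0 list.map prod_list.Cons prod_list.Nil mult_1_right)
  finally show ?case by (intro exI conjI) (assumption, simp)
qed (auto intro: exI[of _ P])

text \<open>In the Newton basis \<open>\<Prod>i<j. (X - v\<^sub>i)\<close>, multiplication by \<open>W\<close> is triangular.\<close>

lemma det_mult_matrix_eq_prod:
  fixes W :: "'a :: idom poly"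
  assumes M: "M \<in> carrier_mat n n" and n: "length vs = n"
    and mult: "\<And>j. j < n \<Longrightarrow> \<exists>Q. W * monom 1 j = (\<Sum>k<n. [:M $$ (j, k):] * monom 1 k) + Q * (\<Prod>v\<leftarrow>vs. [:-v, 1:])"
  shows "det M = (\<Prod>v\<leftarrow>vs. poly W v)"
proof -
  define F where "F = (\<Prod>v\<leftarrow>vs. [:-v, 1:])"
  define nb where "nb j = (\<Prod>v\<leftarrow>take j vs. [:-v, 1:])" for j
  have dF: "degree F = n" unfolding F_def using n by (simp add: degree_prod_linear)
  have dnb: "degree (nb j) = j" if "j < n" for j
    using that n unfolding nb_def by (simp add: degree_prod_linear)
  have lnb: "coeff (nb j) j = 1" if "j < n" for j
    using lead_coeff_prod_linear[of "take j vs"] dnb[OF that] unfolding nb_def by simp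
  have expand: "nb j = (\<Sum>k<n. [:coeff (nb j) k:] * monom 1 k)" if "j < n" for j
    using that dnb[OF that] by (intro poly_eqI) (auto simp: coeff_sum coeff_eq_0 if_distrib cong: if_cong)
  \<comment> \<open>The change of basis from monomials to the Newton basis is unitriangular, so
    \<open>C * M = T * C\<close> gives equal determinants without inverting
    \<open>C\<close>.\<close>
  define C where "C = mat n n (\<lambda>(j, k). coeff (nb j) k)"
  have C: "C \<in> carrier_mat n n" by (simp add: C_def)
  \<comment> \<open>Expanding \<open>W\<close> along the roots from position \<open>j\<close> on and
    multiplying by \<open>nb j\<close> turns the partial products into \<open>nb (j + k)\<close>. So
    row \<open>j\<close> begins on the diagonal, with the value of \<open>W\<close> at the j-th
    root.\<close>
  have ex: "\<exists>t Q. W * nb j = (\<Sum>k<n - j. [:t k:] * nb (j + k)) + Q * F \<and> t 0 = poly W (vs ! j)" if "j < n" for j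
  proof -
    have ne: "drop j vs \<noteq> []" using that n by simp
    obtain t Q where tQ: "W = (\<Sum>k<length (drop j vs). [:t k:] * (\<Prod>v\<leftarrow>take k (drop j vs). [:-v, 1:])) + Q * (\<Prod>v\<leftarrow>drop j vs. [:-v, 1:])"
      "t 0 = poly W (hd (drop j vs))" using newton_expansion[of W "drop j vs"] ne by blast
    have 1: "(\<Prod>v\<leftarrow>take k (drop j vs). [:-v, 1:]) * nb j = nb (j + k)" for k
      unfolding nb_def take_add map_append prod_list.append by (rule mult.commute)
    have "F = nb j * (\<Prod>v\<leftarrow>drop j vs. [:-v, 1:])"
      unfolding F_def nb_def prod_list.append[symmetric] map_append[symmetric] append_take_drop_id ..
    hence 2: "(\<Prod>v\<leftarrow>drop j vs. [:-v, 1:]) * nb j = F"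
      by (simp only: mult.commute[of "nb j"])
    have "W * nb j = (\<Sum>k<n - j. [:t k:] * ((\<Prod>v\<leftarrow>take k (drop j vs). [:-v, 1:]) * nb j)) + Q * ((\<Prod>v\<leftarrow>drop j vs. [:-v, 1:]) * nb j)"
      by (subst tQ(1)) (simp only: length_drop n distrib_right sum_distrib_right mult.assoc)
    thus ?thesis using tQ(2) that n unfolding 1 2 by (auto simp: hd_drop_conv_nth)
  qed
  have "\<exists>t. \<forall>j. j < n \<longrightarrow> (\<exists>Q. W * nb j = (\<Sum>k<n - j. [:t j k:] * nb (j + k)) + Q * F \<and> t j 0 = poly W (vs ! j))"
    by (rule choice) (use ex in blast)
  then obtain t where t: "\<And>j. j < n \<Longrightarrow> \<exists>Q. W * nb j = (\<Sum>k<n - j. [:t j k:] * nb (j + k)) + Q * F"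
    "\<And>j. j < n \<Longrightarrow> t j 0 = poly W (vs ! j)" by blast
  define T where "T = mat n n (\<lambda>(j, k). if k < j then 0 else t j (k - j))"
  have T: "T \<in> carrier_mat n n" by (simp add: T_def)
  have matrix_sum: "(\<Sum>k<n. \<Sum>l<n. [:X $$ (j, k) * Y $$ (k, l):] * monom 1 l) = (\<Sum>l<n. [:(X * Y) $$ (j, l):] * monom 1 l)"
    if X: "X \<in> carrier_mat n n" and Y: "Y \<in> carrier_mat n n" and j: "j < n" for X Y :: "'a mat" and j
  proof (subst sum.swap, rule sum.cong[OF refl])
    fix l assume "l \<in> {..<n}"
    hence e: "(X * Y) $$ (j, l) = (\<Sum>k<n. X $$ (j, k) * Y $$ (k, l))"
      using X Y j by (simp add: scalar_prod_def atLeast0LessThan)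
    show "(\<Sum>k<n. [:X $$ (j, k) * Y $$ (k, l):] * monom 1 l) = [:(X * Y) $$ (j, l):] * monom 1 l"
      unfolding e by (simp add: Polynomial.smult_sum)
  qed
  \<comment> \<open>Row \<open>j\<close> of either side holds the coordinates of
    \<open>W * nb j\<close> modulo \<open>F\<close> in the monomial basis. They agree because a
    multiple of \<open>F\<close> with degree below n is zero.\<close>
  have "C * M = T * C"
  proof (rule eq_matI)
    fix j l assume "j < dim_row (T * C)" "l < dim_col (T * C)"
    hence jl: "j < n" "l < n" using T C by auto
    obtain Q' where Q': "\<And>k. k < n \<Longrightarrow> W * monom 1 k = (\<Sum>l<n. [:M $$ (k, l):] * monom 1 l) + Q' k * F"
      using choice[of "\<lambda>k Q. k < n \<longrightarrow> W * monom 1 k = (\<Sum>l<n. [:M $$ (k, l):] * monom 1 l) + Q * F"]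
        mult unfolding F_def by blast
    obtain Q where Q: "W * nb j = (\<Sum>k<n - j. [:t j k:] * nb (j + k)) + Q * F" using t(1)[OF jl(1)] by blast
    have "W * nb j = (\<Sum>k<n. [:C $$ (j, k):] * (W * monom 1 k))"
      using jl by (subst expand) (auto simp: C_def sum_distrib_left mult_ac)
    also have "\<dots> = (\<Sum>k<n. [:C $$ (j, k):] * ((\<Sum>l<n. [:M $$ (k, l):] * monom 1 l) + Q' k * F))"
      by (rule sum.cong) (auto simp: Q')
    also have "\<dots> = (\<Sum>k<n. \<Sum>l<n. [:C $$ (j, k) * M $$ (k, l):] * monom 1 l) + (\<Sum>k<n. [:C $$ (j, k):] * Q' k) * F"
      by (simp add: ring_distribs sum.distrib sum_distrib_left sum_distrib_right smult_sum2 mult.assoc)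
        (simp add: mult.commute)
    finally have 1: "W * nb j = (\<Sum>l<n. [:(C * M) $$ (j, l):] * monom 1 l) + (\<Sum>k<n. [:C $$ (j, k):] * Q' k) * F"
      unfolding matrix_sum[OF C M jl(1)] .
    have "(\<Sum>k<n - j. [:t j k:] * nb (j + k)) = (\<Sum>k\<in>{j..<n}. [:T $$ (j, k):] * nb k)"
      by (rule sum.reindex_bij_witness[of _ "\<lambda>k. k - j" "\<lambda>k. j + k"]) (use jl in \<open>auto simp: T_def\<close>)
    also have "\<dots> = (\<Sum>k<n. [:T $$ (j, k):] * nb k)"
      by (rule sum.mono_neutral_left) (use jl in \<open>auto simp: T_def\<close>)
    also have "\<dots> = (\<Sum>k<n. [:T $$ (j, k):] * (\<Sum>l<n. [:C $$ (k, l):] * monom 1 l))"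
    proof (intro sum.cong refl arg_cong2[of _ _ _ _ "(*)"])
      fix k assume "k \<in> {..<n}"
      thus "nb k = (\<Sum>l<n. [:C $$ (k, l):] * monom 1 l)" by (subst expand) (auto simp: C_def)
    qed
    also have "\<dots> = (\<Sum>k<n. \<Sum>l<n. [:T $$ (j, k) * C $$ (k, l):] * monom 1 l)"
      by (simp add: sum_distrib_left smult_sum2) (simp add: mult.commute)
    finally have 2: "W * nb j = (\<Sum>l<n. [:(T * C) $$ (j, l):] * monom 1 l) + Q * F"
      unfolding matrix_sum[OF T C jl(1)] using Q by simp
    define X where "X = (\<Sum>l<n. [:(C * M) $$ (j, l) - (T * C) $$ (j, l):] * monom 1 l)"
    have X_eq: "X = (Q - (\<Sum>k<n. [:C $$ (j, k):] * Q' k)) * F"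
    proof -
      have "X = (\<Sum>l<n. [:(C * M) $$ (j, l):] * monom 1 l) - (\<Sum>l<n. [:(T * C) $$ (j, l):] * monom 1 l)"
        by (simp add: X_def smult_diff_left sum_subtractf[symmetric] del: index_mult_mat)
      moreover have "a - b = q - s" if "w = a + s" "w = b + q" for a b q s w :: "'a poly"
        using that by (simp add: algebra_simps)
      ultimately show ?thesis using 1 2 by (simp only: left_diff_distrib)
    qed
    have cX: "coeff X k = (if k < n then (C * M) $$ (j, k) - (T * C) $$ (j, k) else 0)" for k
      by (simp add: X_def coeff_sum if_distrib cong: if_cong del: index_mult_mat)
    have "X = 0"
    proof (rule ccontr)
      assume nz: "X \<noteq> 0"
      hence "F dvd X" using X_eq by simp
      hence "n \<le> degree X" using nz dF dvd_imp_degree_le by blast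
      hence "coeff X (degree X) = 0" by (simp add: cX)
      thus False using nz by simp
    qed
    thus "(C * M) $$ (j, l) = (T * C) $$ (j, l)" using cX[of l] jl by simp
  qed (use C M T in auto)
  hence "det C * det M = det T * det C"
    using det_mult[OF C M] det_mult[OF T C] by metis
  moreover have "det C = 1"
  proof -
    have "det C = prod_list (diag_mat C)"
    proof (rule det_lower_triangular[OF _ C])
      fix i j assume "i < j" "j < n"
      thus "C $$ (i, j) = 0" using dnb[of i] by (simp add: C_def coeff_eq_0)
    qed
    also have "diag_mat C = map (\<lambda>_. 1) [0..<n]"
      unfolding diag_mat_def using C by (intro map_cong) (simp_all add: C_def lnb)
    also have "prod_list \<dots> = (1 :: 'a)" by (induction n) auto
    finally show ?thesis .
  qed
  moreover have "det T = (\<Prod>v\<leftarrow>vs. poly W v)"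
  proof -
    have "det T = prod_list (diag_mat T)"
      by (rule det_upper_triangular[OF _ T]) (simp add: T_def upper_triangular_def)
    also have "diag_mat T = map (poly W) vs"
    proof (rule nth_equalityI)
      fix i assume "i < length (diag_mat T)"
      hence i: "i < n" using T by (simp add: diag_mat_def)
      hence "diag_mat T ! i = T $$ (i, i)" using T by (simp add: diag_mat_def)
      also have "\<dots> = poly W (vs ! i)" using i t(2)[OF i] by (simp add: T_def)
      finally show "diag_mat T ! i = map (poly W) vs ! i" using i n by simp
    qed (use T n in \<open>simp add: diag_mat_def\<close>)
    finally show ?thesis .
  qed
  ultimately show ?thesis by simp
qed

lemma branch_coeff_subdegree_le:
  assumes "N > 0" "p \<noteq> 0"
  shows "subdegree (branch_coeff N p) \<le> N * degree p" and "branch_coeff N p \<noteq> 0"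
proof -
  have "fps_nth (branch_coeff N p) (N * degree p) \<noteq> 0"
    using assms by (simp add: branch_coeff_def ramify_nth)
  thus "subdegree (branch_coeff N p) \<le> N * degree p" "branch_coeff N p \<noteq> 0"
    by (auto intro: subdegree_leI)
qed

lemma subdegree_prod_list:
  fixes f :: "'b \<Rightarrow> complex fps"
  shows "(\<And>v. v \<in> set vs \<Longrightarrow> f v \<noteq> 0) \<Longrightarrow> subdegree (\<Prod>v\<leftarrow>vs. f v) = (\<Sum>v\<leftarrow>vs. subdegree (f v))"
proof (induction vs)
  case (Cons v vs)
  have "(\<Prod>v\<leftarrow>vs. f v) \<noteq> 0" using Cons.prems by (auto simp: prod_list_zero_iff)
  thus ?case using Cons by simp
qed simp

text \<open>The product of the values of \<open>W\<close> on all branches is the norm of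
  \<open>W\<close>, that is, the determinant of multiplication by \<open>W\<close> on C[u][v] / (f).
  It is a nonzero polynomial in u of degree at most d e, and its order at u = 0 cannot exceed its
  degree; the factor \<open>N\<close> comes from u = s^N.\<close>

theorem bezout_branches:
  fixes f W :: bipoly
  assumes N: "N > 0" and f: "lead_coeff f = 1" "degree f = d" "tdeg_le d f" and W: "tdeg_le e W"
    and vs: "branch_poly N f = (\<Prod>v\<leftarrow>vs. [:-v, 1:])"
    and nz: "\<And>v. v \<in> set vs \<Longrightarrow> poly (branch_poly N W) v \<noteq> 0"
  shows "(\<Sum>v\<leftarrow>vs. subdegree (poly (branch_poly N W) v)) \<le> N * (d * e)"
proof -
  interpret bc: comm_ring_hom "branch_coeff N" by (rule branch_coeff_hom) fact
  interpret bp: comm_ring_hom "branch_poly N" by (rule branch_poly_hom) fact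
  have lvs: "length vs = d"
  proof -
    have "degree (branch_poly N f) = d"
      unfolding branch_poly_def
    proof (rule antisym)
      show "degree (map_poly (branch_coeff N) f) \<le> d" using degree_map_poly_le[of "branch_coeff N" f] f by simp
      show "d \<le> degree (map_poly (branch_coeff N) f)" using f by (intro le_degree) (simp add: coeff_map_poly)
    qed
    thus ?thesis using degree_prod_linear[of vs] vs by simp
  qed
  have "\<exists>R. (\<exists>Q. W * monom 1 j = Q * f + R) \<and> (\<forall>k\<ge>d. coeff R k = 0) \<and> tdeg_le (e + j) R" for j
  proof -
    have "tdeg_le j (monom 1 j)"
      by (rule tdeg_leI) (auto simp: coeff_1 split: if_splits)
    thus ?thesis using monic_division_tdeg[OF f tdeg_le_mult[OF W]] by blast
  qed
  then obtain R where R: "\<And>j. \<exists>Q. W * monom 1 j = Q * f + R j" "\<And>j k. k \<ge> d \<Longrightarrow> coeff (R j) k = 0"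
    "\<And>j. tdeg_le (e + j) (R j)" by metis
  define M where "M = mat d d (\<lambda>(j, k). coeff (R j) k)"
  have M: "M \<in> carrier_mat d d" by (simp add: M_def)
  have Mdeg: "degree (det M) \<le> d * e"
  proof (rule degree_det_le[OF M])
    fix j k assume jk: "j < d" "k < d" "M $$ (j, k) \<noteq> 0"
    have "coeff (coeff (R j) k) (degree (coeff (R j) k)) \<noteq> 0" using jk by (simp add: M_def)
    thus "degree (M $$ (j, k)) + k \<le> e + j" using tdeg_leD[OF R(3)] jk by (simp add: M_def)
  qed
  have "det (map_mat (branch_coeff N) M) = (\<Prod>v\<leftarrow>vs. poly (branch_poly N W) v)"
  proof (rule det_mult_matrix_eq_prod[OF _ lvs])
    fix j assume j: "j < d"
    obtain Q where Q: "W * monom 1 j = Q * f + R j" using R(1) by blast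
    have mj: "branch_poly N (monom 1 j) = monom 1 j"
      by (rule poly_eqI) (simp add: branch_poly_def coeff_map_poly)
    have Rj: "branch_poly N (R j) = (\<Sum>k<d. [:map_mat (branch_coeff N) M $$ (j, k):] * monom 1 k)"
      using j R(2) by (intro poly_eqI) (auto simp: branch_poly_def coeff_map_poly M_def coeff_sum not_less if_distrib cong: if_cong)
    have "branch_poly N W * monom 1 j = branch_poly N Q * (\<Prod>v\<leftarrow>vs. [:-v, 1:]) + branch_poly N (R j)"
      using arg_cong[OF Q, of "branch_poly N"] by (simp only: bp.hom_mult bp.hom_add mj vs)
    thus "\<exists>Q. branch_poly N W * monom 1 j = (\<Sum>k<d. [:map_mat (branch_coeff N) M $$ (j, k):] * monom 1 k) + Q * (\<Prod>v\<leftarrow>vs. [:-v, 1:])"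
      unfolding Rj by (intro exI[of _ "branch_poly N Q"]) (simp only: add.commute)
  qed (use M in auto)
  hence prod: "branch_coeff N (det M) = (\<Prod>v\<leftarrow>vs. poly (branch_poly N W) v)" by simp
  also have "\<dots> \<noteq> 0" using nz by (auto simp: prod_list_zero_iff)
  finally have "det M \<noteq> 0" by auto
  have "(\<Sum>v\<leftarrow>vs. subdegree (poly (branch_poly N W) v)) = subdegree (branch_coeff N (det M))"
    unfolding prod using nz by (simp add: subdegree_prod_list)
  also have "\<dots> \<le> N * degree (det M)" by (rule branch_coeff_subdegree_le) fact+
  also have "\<dots> \<le> N * (d * e)" using Mdeg by simp
  finally show ?thesis .
qed

section \<open>Derivations along a branch\<close>

lemma branch_eval_hom:
  assumes "N > 0"
  shows "comm_ring_hom (\<lambda>h. poly (branch_poly N h) w)"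
proof -
  interpret bp: comm_ring_hom "branch_poly N" by (rule branch_poly_hom) fact
  show ?thesis by unfold_locales (simp_all add: bp.hom_mult bp.hom_add)
qed

lemma branch_coeff_0 [simp]: "branch_coeff N 0 = 0"
  by (simp add: branch_coeff_def)

lemma branch_poly_pCons:
  "branch_poly N (pCons p h) = pCons (branch_coeff N p) (branch_poly N h)"
  by (rule poly_eqI) (simp add: branch_poly_def coeff_map_poly coeff_pCons split: nat.split)

lemma branch_poly_const: "branch_poly N [:p:] = [:branch_coeff N p:]"
  using branch_poly_pCons[of N p 0] by (simp add: branch_poly_def)

text \<open>No nonzero polynomial in u alone vanishes on a branch. Let \<open>P\<close> have least
  degree in v among the nonzero polynomials that do. Pseudo-division gives c f = P q with c in C[u];
  if \<open>f\<close> divided \<open>q\<close>, then \<open>P\<close> would divide c and have degree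
  0, so primality gives that \<open>f\<close> divides \<open>P\<close>. Thus \<open>f\<close> has
  least degree too, and dividing \<open>h\<close> by the monic \<open>f\<close> leaves remainder
  zero.\<close>

lemma dvd_if_branch_zero:
  fixes f h :: bipoly
  assumes N: "N > 0" and prime: "prime_elem f" and monic: "lead_coeff f = 1"
    and f0: "poly (branch_poly N f) w = 0" and h0: "poly (branch_poly N h) w = 0"
  shows "f dvd h"
proof -
  define \<phi> where "\<phi> h = poly (branch_poly N h) w" for h
  interpret \<phi>: comm_ring_hom \<phi> unfolding \<phi>_def by (rule branch_eval_hom) fact
  interpret bc: comm_ring_hom "branch_coeff N" by (rule branch_coeff_hom) fact
  have fnz: "f \<noteq> 0" using monic by auto
  have "\<exists>P. P \<noteq> 0 \<and> \<phi> P = 0" using fnz f0 unfolding \<phi>_def by blast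
  then obtain P where P: "P \<noteq> 0 \<and> \<phi> P = 0" and min: "\<And>Q. Q \<noteq> 0 \<and> \<phi> Q = 0 \<Longrightarrow> degree P \<le> degree Q"
    using ex_has_least_nat[of "\<lambda>P. P \<noteq> 0 \<and> \<phi> P = 0" _ degree] by auto
  have dP: "degree P > 0"
  proof (rule ccontr)
    assume "\<not> degree P > 0"
    then obtain p where p: "P = [:p:]" by (metis degree_eq_zeroE not_gr_zero)
    hence "\<phi> P = branch_coeff N p" using N by (simp add: \<phi>_def branch_poly_const)
    thus False using P p branch_coeff_subdegree_le(2)[OF N, of p] by auto
  qed
  obtain q r where qr: "pseudo_divmod f P = (q, r)" by fastforce
  define c where "c = coeff P (degree P) ^ (Suc (degree f) - degree P)"
  have c: "c \<noteq> 0" using P by (simp add: c_def)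
  have eq: "Polynomial.smult c f = P * q + r" "r = 0 \<or> degree r < degree P"
    using pseudo_divmod[OF _ qr] P unfolding c_def by blast+
  have "\<phi> (Polynomial.smult c f) = 0"
    using \<phi>.hom_mult[of "[:c:]" f] f0 unfolding \<phi>_def by simp
  hence "\<phi> r = 0" using P unfolding eq(1) \<phi>.hom_add \<phi>.hom_mult by simp
  hence "r = 0" using min[of r] eq(2) not_le by blast
  hence eq: "Polynomial.smult c f = P * q" using eq by simp
  hence "f dvd P * q" by (metis dvd_smult dvd_refl)
  hence "f dvd P"
  proof (rule prime_elem_dvd_multD[OF prime, THEN disjE])
    assume "f dvd q"
    then obtain q' where "q = f * q'" by (elim dvdE)
    hence "f * [:c:] = f * (P * q')" using eq by (simp add: mult_ac)
    hence "P * q' = [:c:]" using fnz by (metis mult_left_cancel)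
    moreover from this have "q' \<noteq> 0" using c by auto
    ultimately have "degree P + degree q' = 0" using P by (metis degree_mult_eq degree_pCons_0)
    thus ?thesis using dP by simp
  qed
  hence df: "degree f \<le> degree P" using P dvd_imp_degree_le by blast
  obtain q' r' where qr': "pseudo_divmod h f = (q', r')" by fastforce
  have eq': "h = f * q' + r'" "r' = 0 \<or> degree r' < degree f"
    using pseudo_divmod[OF fnz qr'] monic by auto
  have "\<phi> r' = 0" using eq'(1) h0 f0 \<phi>.hom_add[of "f * q'" r'] \<phi>.hom_mult[of f q'] unfolding \<phi>_def by simp
  hence "r' = 0" using min[of r'] eq'(2) df by (metis not_le order.trans)
  thus ?thesis using eq' by simp
qed

section \<open>The derivation tangent to the curve\<close>

abbreviation deriv_u :: "bipoly \<Rightarrow> bipoly" where "deriv_u \<equiv> map_poly pderiv"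

lemma deriv_u_add: "deriv_u (F + G) = deriv_u F + deriv_u G"
  by (rule poly_eqI) (simp add: coeff_map_poly pderiv_add)

lemma deriv_u_mult: "deriv_u (F * G) = deriv_u F * G + F * deriv_u G"
  by (rule poly_eqI, simp add: coeff_map_poly coeff_mult pderiv_sum pderiv_mult flip: sum.distrib)
    (simp add: algebra_simps)

lemma deriv_u_pCons: "deriv_u (pCons p h) = pCons (pderiv p) (deriv_u h)"
  by (rule poly_eqI) (simp add: coeff_map_poly coeff_pCons split: nat.split)

lemma fps_deriv_branch_coeff:
  assumes "N > 0"
  shows "fps_deriv (branch_coeff N p) = of_nat N * fps_X ^ (N - 1) * branch_coeff N (pderiv p)"
proof -
  interpret bc: comm_ring_hom "branch_coeff N" by (rule branch_coeff_hom) fact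
  show ?thesis
  proof (induction p)
    case (pCons a p)
    have "branch_coeff N (pderiv (pCons a p)) = branch_coeff N p + fps_X ^ N * branch_coeff N (pderiv p)"
      using assms by (simp add: pderiv_pCons bc.hom_add branch_coeff_pCons)
    thus ?case using assms pCons.IH
      by (simp add: branch_coeff_pCons fps_deriv_power algebra_simps fps_of_nat)
  qed simp
qed

lemma fps_deriv_branch:
  assumes "N > 0"
  shows "fps_deriv (poly (branch_poly N h) w) =
    of_nat N * fps_X ^ (N - 1) * poly (branch_poly N (deriv_u h)) w + poly (branch_poly N (pderiv h)) w * fps_deriv w"
proof -
  interpret bp: comm_ring_hom "branch_poly N" by (rule branch_poly_hom) fact
  interpret bc: comm_ring_hom "branch_coeff N" by (rule branch_coeff_hom) fact
  show ?thesis
  proof (induction h)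
    case (pCons p h)
    show ?case using assms pCons.IH
      by (simp add: branch_poly_pCons deriv_u_pCons pderiv_pCons bp.hom_add fps_deriv_branch_coeff algebra_simps)
  qed simp
qed

text \<open>The Poisson bracket of \<open>h\<close> and \<open>f\<close>, the Jacobian determinant
  of the pair (h, f) in (u, v). It is a derivation in \<open>h\<close> that kills
  \<open>f\<close>.\<close>

definition ham :: "bipoly \<Rightarrow> bipoly \<Rightarrow> bipoly" where
  "ham f h = pderiv f * deriv_u h - deriv_u f * pderiv h"

lemma ham_add: "ham f (g + h) = ham f g + ham f h"
  by (simp add: ham_def deriv_u_add pderiv_add algebra_simps)

lemma ham_mult: "ham f (g * h) = ham f g * h + g * ham f h"
  by (simp add: ham_def deriv_u_mult pderiv_mult algebra_simps)

lemma ham_const: "ham f [:[:c:]:] = 0"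
  by (simp add: ham_def deriv_u_pCons pderiv_pCons)

text \<open>The extra factor \<open>h\<close> avoids the exponent n - 1; it is available because the
  derivation in use carries the factor x y.\<close>

lemma ham_power: "h * ham f (h ^ n) = of_nat n * h ^ n * ham f h"
proof (induction n)
  case 0
  thus ?case using ham_const[of f 1] by (simp add: one_pCons)
next
  case (Suc n)
  have "h * ham f (h ^ Suc n) = h * ham f h * h ^ n + h * (h * ham f (h ^ n))"
    by (simp add: ham_mult algebra_simps)
  thus ?case unfolding Suc by (simp add: algebra_simps)
qed

text \<open>Differentiate f(s^N, w) = 0 and h(s^N, w) with respect to s and eliminate w'. The
  identity is kept free of quotients, since neither the value of f_v nor s^(N - 1) need be a
  unit.\<close>

lemma branch_ham:
  assumes N: "N > 0" and f: "poly (branch_poly N f) w = 0"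
  shows "of_nat N * fps_X ^ (N - 1) * poly (branch_poly N (ham f h)) w =
         poly (branch_poly N (pderiv f)) w * fps_deriv (poly (branch_poly N h) w)"
proof -
  interpret bp: comm_ring_hom "branch_poly N" by (rule branch_poly_hom) fact
  define \<kappa> :: "complex fps" where "\<kappa> = of_nat N * fps_X ^ (N - 1)"
  define fu fv hu hv where "fu = poly (branch_poly N (deriv_u f)) w"
    and "fv = poly (branch_poly N (pderiv f)) w"
    and "hu = poly (branch_poly N (deriv_u h)) w"
    and "hv = poly (branch_poly N (pderiv h)) w"
  have "0 = \<kappa> * fu + fv * fps_deriv w"
    using fps_deriv_branch[OF N, of f w] f unfolding \<kappa>_def fu_def fv_def by simp
  hence 1: "fv * fps_deriv w = - (\<kappa> * fu)" by (simp add: eq_neg_iff_add_eq_0 add.commute)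
  have 2: "fps_deriv (poly (branch_poly N h) w) = \<kappa> * hu + hv * fps_deriv w"
    using fps_deriv_branch[OF N, of h w] unfolding \<kappa>_def hu_def hv_def .
  have "fv * fps_deriv (poly (branch_poly N h) w) = \<kappa> * fv * hu + hv * (fv * fps_deriv w)"
    unfolding 2 by (simp add: algebra_simps)
  also have "\<dots> = \<kappa> * (fv * hu - fu * hv)" unfolding 1 by (simp add: algebra_simps)
  also have "fv * hu - fu * hv = poly (branch_poly N (ham f h)) w"
    by (simp add: ham_def bp.hom_minus bp.hom_mult fu_def fv_def hu_def hv_def)
  finally show ?thesis unfolding \<kappa>_def fv_def by simp
qed

section \<open>Wronskians of power series\<close>

lemma fps_mult_nth_lowest:
  fixes f g :: "'a :: comm_ring_1 fps"
  assumes "\<And>i. i < n \<Longrightarrow> fps_nth f i = 0" "\<And>i. i < m \<Longrightarrow> fps_nth g i = 0"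
  shows "fps_nth (f * g) (n + m) = fps_nth f n * fps_nth g m"
proof -
  have "fps_nth (f * g) (n + m) = (\<Sum>i\<in>{n}. fps_nth f i * fps_nth g (n + m - i))"
    unfolding fps_mult_nth
  proof (rule sum.mono_neutral_right)
    show "\<forall>i\<in>{0..n + m} - {n}. fps_nth f i * fps_nth g (n + m - i) = 0"
    proof
      fix i assume i: "i \<in> {0..n + m} - {n}"
      hence "i < n \<or> n + m - i < m" by auto
      thus "fps_nth f i * fps_nth g (n + m - i) = 0" using assms by auto
    qed
  qed auto
  thus ?thesis by simp
qed

text \<open>Subtract from \<open>b\<close> the multiple of \<open>a\<close> that clears the
  coefficient at n, the order of \<open>a\<close>. If the difference \<open>d\<close> had an order
  m, comparing lowest terms of a s d' = d s a' would give m = n, where the coefficient of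
  \<open>d\<close> has just been cleared.\<close>

lemma fps_wronskian2_eq_0:
  fixes a b :: "complex fps"
  assumes a: "a \<noteq> 0" and eq: "a * fps_deriv b = b * fps_deriv a"
  shows "\<exists>c. b = fps_const c * a"
proof -
  define n where "n = subdegree a"
  define c where "c = fps_nth b n / fps_nth a n"
  define d where "d = b - fps_const c * a"
  have an: "fps_nth a n \<noteq> 0" using a by (simp add: n_def)
  have dn: "fps_nth d n = 0" using an by (simp add: d_def c_def)
  have d: "a * (fps_X * fps_deriv d) = d * (fps_X * fps_deriv a)"
    using eq by (simp add: d_def algebra_simps)
  have "d = 0"
  proof (rule ccontr)
    assume "d \<noteq> 0"
    define m where "m = subdegree d"
    have dm: "fps_nth d m \<noteq> 0" using \<open>d \<noteq> 0\<close> by (simp add: m_def)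
    have low: "fps_nth a i = 0" if "i < n" for i using that nth_less_subdegree_zero unfolding n_def by blast
    have low': "fps_nth d i = 0" if "i < m" for i using that nth_less_subdegree_zero unfolding m_def by blast
    have Xd: "fps_nth (fps_X * fps_deriv g) i = of_nat i * fps_nth g i" for g :: "complex fps" and i
      by (cases i) simp_all
    have "fps_nth (a * (fps_X * fps_deriv d)) (n + m) = fps_nth a n * (of_nat m * fps_nth d m)"
      by (subst fps_mult_nth_lowest) (simp_all only: Xd low low' mult_zero_right)
    moreover have "fps_nth (d * (fps_X * fps_deriv a)) (m + n) = fps_nth d m * (of_nat n * fps_nth a n)"
      by (subst fps_mult_nth_lowest) (simp_all only: Xd low low' mult_zero_right)
    ultimately have "m = n" using an dm d by (simp add: add.commute)
    thus False using dm dn by simp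
  qed
  thus ?thesis by (auto simp: d_def)
qed

text \<open>Given a vanishing combination \<open>a\<close> of the columns with \<open>a i \<noteq> 0\<close>, differentiating it divided by
  \<open>a i\<close> yields a relation with one column and one row less, unless all ratios \<open>a j / a i\<close> are constant.\<close>

lemma wronskian_dependent:
  fixes H :: "nat \<Rightarrow> 'i \<Rightarrow> complex fps"
  assumes q: "q \<noteq> 0" and H: "\<And>k j. j \<in> J \<Longrightarrow> q * fps_deriv (H k j) = \<kappa> * H (Suc k) j"
    and fin: "finite J" and a: "\<exists>j\<in>J. a j \<noteq> 0"
    and rel: "\<And>k. k < card J \<Longrightarrow> (\<Sum>j\<in>J. a j * H k j) = 0"
  shows "\<exists>c. (\<exists>j\<in>J. c j \<noteq> 0) \<and> (\<Sum>j\<in>J. fps_const (c j) * H 0 j) = 0"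
  using fin H a rel
proof (induction "card J" arbitrary: J a)
  case 0
  thus ?case by auto
next
  case (Suc n)
  obtain i where i: "i \<in> J" "a i \<noteq> 0" using Suc.prems by blast
  define b where "b j = a i * fps_deriv (a j) - a j * fps_deriv (a i)" for j
  have cJ: "card (J - {i}) = n" using Suc i by simp
  \<comment> \<open>Differentiating relation \<open>k\<close> produces row \<open>k + 1\<close>,
    whose contribution vanishes by the next relation. The last row has no successor, which is why
    only \<open>k < n\<close> remains.\<close>
  have deriv_rel: "(\<Sum>j\<in>J. fps_deriv (a j) * H k j) = 0" if "k < n" for k
  proof -
    have "0 = q * fps_deriv (\<Sum>j\<in>J. a j * H k j)" using Suc.prems(4)[of k] Suc.hyps(2) that by simp
    also have "\<dots> = (\<Sum>j\<in>J. q * (fps_deriv (a j) * H k j) + a j * (q * fps_deriv (H k j)))"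
      by (simp add: fps_deriv_sum sum_distrib_left algebra_simps)
    also have "\<dots> = (\<Sum>j\<in>J. q * (fps_deriv (a j) * H k j) + \<kappa> * (a j * H (Suc k) j))"
      by (rule sum.cong) (simp_all add: Suc.prems(2) mult_ac)
    also have "\<dots> = q * (\<Sum>j\<in>J. fps_deriv (a j) * H k j) + \<kappa> * (\<Sum>j\<in>J. a j * H (Suc k) j)"
      by (simp add: sum.distrib sum_distrib_left)
    also have "(\<Sum>j\<in>J. a j * H (Suc k) j) = 0" using Suc.prems(4)[of "Suc k"] Suc.hyps(2) that by simp
    finally show ?thesis using q by simp
  qed
  have b_rel: "(\<Sum>j\<in>J - {i}. b j * H k j) = 0" if "k < n" for k
  proof -
    have "(\<Sum>j\<in>J. b j * H k j) = a i * (\<Sum>j\<in>J. fps_deriv (a j) * H k j) - fps_deriv (a i) * (\<Sum>j\<in>J. a j * H k j)"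
      by (simp add: b_def sum_distrib_left sum_subtractf algebra_simps)
    also have "\<dots> = 0" using deriv_rel[OF that] Suc.prems(4)[of k] Suc.hyps(2) that by simp
    finally have "(\<Sum>j\<in>J. b j * H k j) = 0" .
    moreover have "b i = 0" by (simp add: b_def)
    ultimately show ?thesis using Suc.prems(1) i(1) by (simp add: sum.remove[of J i])
  qed
  show ?case
  proof (cases "\<exists>j\<in>J - {i}. b j \<noteq> 0")
    case True
    have "\<exists>c. (\<exists>j\<in>J - {i}. c j \<noteq> 0) \<and> (\<Sum>j\<in>J - {i}. fps_const (c j) * H 0 j) = 0"
      using Suc.hyps(1)[of "J - {i}" b] cJ Suc.prems(1,2) True b_rel by auto
    then obtain c where c: "\<exists>j\<in>J - {i}. c j \<noteq> 0" "(\<Sum>j\<in>J - {i}. fps_const (c j) * H 0 j) = 0" by blast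
    have "(\<Sum>j\<in>J. fps_const ((c(i := 0)) j) * H 0 j) = (\<Sum>j\<in>J - {i}. fps_const ((c(i := 0)) j) * H 0 j)"
      using Suc.prems(1) i(1) by (simp add: sum.remove[of J i])
    also have "\<dots> = (\<Sum>j\<in>J - {i}. fps_const (c j) * H 0 j)" by (rule sum.cong) auto
    finally show ?thesis using c by (intro exI[of _ "c(i := 0)"]) auto
  next
    case False
    have "\<exists>c. a j = fps_const c * a i" if "j \<in> J" for j
      using that False i(2) by (intro fps_wronskian2_eq_0) (cases "j = i"; auto simp: b_def)+
    then obtain c where c: "\<And>j. j \<in> J \<Longrightarrow> a j = fps_const (c j) * a i" by metis
    have "0 = (\<Sum>j\<in>J. a j * H 0 j)" using Suc.prems(4)[of 0] Suc.hyps(2) by simp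
    also have "\<dots> = a i * (\<Sum>j\<in>J. fps_const (c j) * H 0 j)"
      unfolding sum_distrib_left by (rule sum.cong) (simp_all add: c mult_ac)
    finally have "(\<Sum>j\<in>J. fps_const (c j) * H 0 j) = 0" using i(2) by simp
    moreover have "c i \<noteq> 0" using c[OF i(1)] i(2) by auto
    ultimately show ?thesis using i(1) by blast
  qed
qed

section \<open>Wronskians of monomials\<close>

text \<open>The factor \<open>x * y\<close> keeps the logarithmic derivative of a monomial polynomial.\<close>

definition euler_der :: "bipoly \<Rightarrow> bipoly \<Rightarrow> bipoly \<Rightarrow> bipoly \<Rightarrow> bipoly" where
  "euler_der f x y h = x * y * ham f h"

definition log_der :: "bipoly \<Rightarrow> bipoly \<Rightarrow> bipoly \<Rightarrow> nat \<times> nat \<Rightarrow> bipoly" where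
  "log_der f x y s = of_nat (fst s) * (y * ham f x) + of_nat (snd s) * (x * ham f y)"

text \<open>Monomials in the original coordinates. After the change of coordinates these are linear
  forms \<open>x\<close>, \<open>y\<close> in u and v, so they are kept as parameters.\<close>

definition bimonom :: "bipoly \<Rightarrow> bipoly \<Rightarrow> nat \<times> nat \<Rightarrow> bipoly" where
  "bimonom x y s = x ^ fst s * y ^ snd s"

text \<open>The cofactor of the monomial \<open>s\<close> in its \<open>k\<close>-th \<open>euler_der\<close>-derivative.\<close>

primrec wronski_entry :: "bipoly \<Rightarrow> bipoly \<Rightarrow> bipoly \<Rightarrow> nat \<times> nat \<Rightarrow> nat \<Rightarrow> bipoly" where
  "wronski_entry f x y s 0 = 1"
| "wronski_entry f x y s (Suc k) =
     euler_der f x y (wronski_entry f x y s k) + log_der f x y s * wronski_entry f x y s k"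

lemma euler_der_bimonom:
  "euler_der f x y (bimonom x y s * h) = bimonom x y s * (euler_der f x y h + log_der f x y s * h)"
proof -
  define X where "X = x ^ fst s"
  define Y where "Y = y ^ snd s"
  have 1: "x * ham f X = of_nat (fst s) * X * ham f x" unfolding X_def by (rule ham_power)
  have 2: "y * ham f Y = of_nat (snd s) * Y * ham f y" unfolding Y_def by (rule ham_power)
  have "euler_der f x y (X * Y * h) = (x * ham f X) * y * Y * h + (y * ham f Y) * x * X * h + X * Y * (x * y * ham f h)"
    by (simp add: euler_der_def ham_mult algebra_simps)
  also have "\<dots> = X * Y * (euler_der f x y h + log_der f x y s * h)"
    unfolding 1 2 by (simp add: euler_der_def log_der_def algebra_simps)
  finally show ?thesis by (simp add: bimonom_def X_def Y_def)
qed

lemma euler_der_funpow_bimonom: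
  "(euler_der f x y ^^ k) (bimonom x y s) = bimonom x y s * wronski_entry f x y s k"
  by (induction k) (simp_all add: euler_der_bimonom)

lemma euler_der_sum:
  fixes n :: nat
  shows
  "euler_der f x y (\<Sum>l<n. [:[:c l:]:] * h l) = (\<Sum>l<n. [:[:c l:]:] * euler_der f x y (h l))"
proof (induction n)
  case 0
  show ?case by (simp add: euler_der_def ham_def)
next
  case (Suc n)
  have "euler_der f x y ([:[:c n:]:] * h n) = [:[:c n:]:] * euler_der f x y (h n)"
    unfolding euler_der_def ham_mult ham_const by (simp only: mult_zero_left add_0_left mult_ac)
  moreover have "euler_der f x y (A + B) = euler_der f x y A + euler_der f x y B" for A B
    by (simp add: euler_der_def ham_add algebra_simps)
  ultimately show ?case using Suc.IH by (simp only: sum.lessThan_Suc)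
qed

lemma euler_der_funpow_sum:
  fixes n :: nat
  shows "(euler_der f x y ^^ k) (\<Sum>l<n. [:[:c l:]:] * h l) = (\<Sum>l<n. [:[:c l:]:] * (euler_der f x y ^^ k) (h l))"
  by (induction k) (simp_all only: funpow.simps o_apply id_apply euler_der_sum)

lemma tdeg_le_of_nat_mult: "tdeg_le D F \<Longrightarrow> tdeg_le D (of_nat n * F)"
  by (induction n) (auto simp: distrib_right intro: tdeg_le_add)

lemma coeff_coeff_pderiv: "coeff (coeff (pderiv F) j) i = of_nat (Suc j) * coeff (coeff F (Suc j)) i"
  for F :: bipoly
  by (simp add: coeff_pderiv of_nat_poly del: of_nat_Suc)

text \<open>The derivative lowers the degree by one and the linear factor restores it. For
  \<open>D = 0\<close> the derivative is zero; this case is separate since D - 1 truncates.\<close>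

lemma tdeg_le_mult_pderiv:
  assumes "tdeg_le D F" "tdeg_le 1 L"
  shows "tdeg_le D (L * pderiv F)"
proof (cases "D = 0")
  case True
  have "pderiv F = 0"
  proof (rule poly_eqI, rule poly_eqI)
    fix i j show "coeff (coeff (pderiv F) j) i = coeff (coeff 0 j) i"
      using tdeg_leD[OF assms(1), of "Suc j" i] True by (auto simp: coeff_coeff_pderiv)
  qed
  thus ?thesis by simp
next
  case False
  have "tdeg_le (D - 1) (pderiv F)"
  proof (rule tdeg_leI)
    fix i j assume "coeff (coeff (pderiv F) j) i \<noteq> 0"
    hence "coeff (coeff F (Suc j)) i \<noteq> 0" by (auto simp: coeff_coeff_pderiv)
    thus "i + j \<le> D - 1" using tdeg_leD[OF assms(1)] by fastforce
  qed
  thus ?thesis using tdeg_le_mult[OF assms(2), of "D - 1"] False by simp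
qed

lemma tdeg_le_mult_deriv_u:
  assumes "tdeg_le D F" "tdeg_le 1 L"
  shows "tdeg_le D (L * deriv_u F)"
proof (cases "D = 0")
  case True
  have "deriv_u F = 0"
  proof (rule poly_eqI, rule poly_eqI)
    fix i j show "coeff (coeff (deriv_u F) j) i = coeff (coeff 0 j) i"
      using tdeg_leD[OF assms(1), of j "Suc i"] True by (auto simp: coeff_pderiv coeff_map_poly)
  qed
  thus ?thesis by simp
next
  case False
  have "tdeg_le (D - 1) (deriv_u F)"
  proof (rule tdeg_leI)
    fix i j assume "coeff (coeff (deriv_u F) j) i \<noteq> 0"
    hence "coeff (coeff F j) (Suc i) \<noteq> 0" by (auto simp: coeff_pderiv coeff_map_poly)
    thus "i + j \<le> D - 1" using tdeg_leD[OF assms(1)] by fastforce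
  qed
  thus ?thesis using tdeg_le_mult[OF assms(2), of "D - 1"] False by simp
qed

lemma tdeg_le_euler_der:
  assumes "tdeg_le d f" "tdeg_le D h" "tdeg_le 1 x" "tdeg_le 1 y"
  shows "tdeg_le (d + D) (euler_der f x y h)"
proof -
  have "euler_der f x y h = (x * pderiv f) * (y * deriv_u h) - (x * deriv_u f) * (y * pderiv h)"
    by (simp add: euler_der_def ham_def algebra_simps)
  also have "tdeg_le (d + D) \<dots>"
    using assms by (intro tdeg_le_diff tdeg_le_mult tdeg_le_mult_pderiv tdeg_le_mult_deriv_u)
  finally show ?thesis .
qed

text \<open>The derivatives of the linear form \<open>x\<close> are constants, so only the
  derivatives of \<open>f\<close> count, and \<open>y\<close> restores the degree that they
  lose.\<close>

lemma tdeg_le_mult_ham_linear: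
  assumes "tdeg_le d f" "tdeg_le 1 x" "tdeg_le 1 y"
  shows "tdeg_le d (y * ham f x)"
proof -
  have "tdeg_le 0 (deriv_u x)"
    by (rule tdeg_leI) (use tdeg_leD[OF assms(2)] in \<open>fastforce simp: coeff_pderiv coeff_map_poly\<close>)
  moreover have "tdeg_le 0 (pderiv x)"
  proof (rule tdeg_leI)
    fix i j assume "coeff (coeff (pderiv x) j) i \<noteq> 0"
    hence "coeff (coeff x (Suc j)) i \<noteq> 0" by (auto simp: coeff_coeff_pderiv)
    thus "i + j \<le> 0" using tdeg_leD[OF assms(2)] by fastforce
  qed
  moreover have "y * ham f x = (y * pderiv f) * deriv_u x - (y * deriv_u f) * pderiv x"
    by (simp add: ham_def algebra_simps)
  ultimately show ?thesis using assms
    tdeg_le_mult[of d "y * pderiv f" 0 "deriv_u x"] tdeg_le_mult[of d "y * deriv_u f" 0 "pderiv x"]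
    by (auto intro!: tdeg_le_diff simp: tdeg_le_mult_pderiv tdeg_le_mult_deriv_u)
qed

lemma tdeg_le_wronski_entry:
  assumes "tdeg_le d f" "tdeg_le 1 x" "tdeg_le 1 y"
  shows "tdeg_le (k * d) (wronski_entry f x y s k)"
proof (induction k)
  case (Suc k)
  have "tdeg_le d (log_der f x y s)"
    unfolding log_der_def using assms by (intro tdeg_le_add tdeg_le_of_nat_mult tdeg_le_mult_ham_linear)
  thus ?case using Suc assms by (auto intro!: tdeg_le_add tdeg_le_euler_der tdeg_le_mult)
qed simp

text \<open>Row k has degree at most k d, so each term of the determinant has degree at most d (0 +
  1 + ... + (n - 1)). The exponents \<open>s l\<close> occur only as integer coefficients and leave
  no trace in the degree.\<close>

lemma tdeg_le_wronskian:
  assumes "tdeg_le d f" "tdeg_le 1 x" "tdeg_le 1 y"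
  shows "tdeg_le (d * (n * (n - 1) div 2)) (det (mat n n (\<lambda>(k, l). wronski_entry f x y (s l) k)))"
proof -
  define M where "M = mat n n (\<lambda>(k, l). wronski_entry f x y (s l) k)"
  have "M \<in> carrier_mat n n" by (simp add: M_def)
  hence "det M = (\<Sum>p | p permutes {0..<n}. signof p * (\<Prod>i=0..<n. M $$ (i, p i)))" by (rule det_def')
  also have "tdeg_le (\<Sum>i=0..<n. i * d) \<dots>"
  proof (rule tdeg_le_sum)
    fix p assume "p \<in> {p. p permutes {0..<n}}"
    hence p: "p permutes {0..<n}" by simp
    have "tdeg_le (\<Sum>i=0..<n. i * d) (\<Prod>i=0..<n. M $$ (i, p i))"
    proof (rule tdeg_le_prod)
      fix i assume i: "i \<in> {0..<n}"
      hence "p i \<in> {0..<n}" using permutes_in_image[OF p] by blast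
      thus "tdeg_le (i * d) (M $$ (i, p i))" using i tdeg_le_wronski_entry[OF assms] by (simp add: M_def)
    qed simp
    thus "tdeg_le (\<Sum>i=0..<n. i * d) (signof p * (\<Prod>i=0..<n. M $$ (i, p i)))"
      by (cases "sign p = 1") (auto simp: sign_def intro: tdeg_le_uminus)
  qed
  also have "(\<Sum>i=0..<n. i * d) = d * (n * (n - 1) div 2)"
  proof -
    have "(\<Sum>i=0..<n. i * d) = d * (\<Sum>i=0..<n. i)" by (simp add: sum_distrib_left mult.commute)
    also have "(\<Sum>i=0..<n. i) = n * (n - 1) div 2" by (simp add: Sum_Ico_nat)
    finally show ?thesis .
  qed
  finally show ?thesis unfolding M_def .
qed

lemma branch_euler_der:
  assumes N: "N > 0" and f: "poly (branch_poly N f) w = 0"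
  shows "poly (branch_poly N (x * y * pderiv f)) w * fps_deriv (poly (branch_poly N h) w) =
         of_nat N * fps_X ^ (N - 1) * poly (branch_poly N (euler_der f x y h)) w"
proof -
  interpret bp: comm_ring_hom "branch_poly N" by (rule branch_poly_hom) fact
  show ?thesis using branch_ham[OF N f, of h]
    by (simp add: bp.hom_mult euler_der_def algebra_simps)
qed

text \<open>Differentiation in s costs one order and cancelling s^(N - 1) costs N - 1 more, while
  the value of x y f_v can only add to the order. For e <= N the truncated difference makes the
  claim trivial.\<close>

lemma branch_euler_der_order:
  assumes N: "N > 0" and f: "poly (branch_poly N f) w = 0"
    and e: "fps_X ^ e dvd poly (branch_poly N h) w"
  shows "fps_X ^ (e - N) dvd poly (branch_poly N (euler_der f x y h)) w"
proof (cases "e > N")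
  case True
  obtain g where g: "poly (branch_poly N h) w = fps_X ^ e * g" using e by (elim dvdE)
  have 1: "fps_deriv (fps_X ^ e :: complex fps) = of_nat e * fps_X ^ (e - 1)"
    by (subst fps_deriv_power) (simp add: fps_of_nat)
  have 2: "(fps_X :: complex fps) ^ e = fps_X ^ (e - 1) * fps_X"
    using True by (intro power_minus_mult[symmetric]) simp
  have "fps_deriv (fps_X ^ e * g) = fps_X ^ (e - 1) * (of_nat e * g + fps_X * fps_deriv g)"
    unfolding fps_deriv_mult 1 by (subst 2) (simp add: algebra_simps)
  hence 3: "fps_X ^ (e - 1) dvd of_nat N * fps_X ^ (N - 1) * poly (branch_poly N (euler_der f x y h)) w"
    unfolding branch_euler_der[OF N f, symmetric] g by simp
  have "e - 1 = (N - 1) + (e - N)" using True N by simp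
  hence 4: "(fps_X :: complex fps) ^ (e - 1) = fps_X ^ (N - 1) * fps_X ^ (e - N)"
    by (simp only: power_add)
  have "fps_X ^ (N - 1) * fps_X ^ (e - N) dvd
      fps_X ^ (N - 1) * (of_nat N * poly (branch_poly N (euler_der f x y h)) w)"
    using 3 unfolding 4 by (simp only: mult_ac)
  hence "fps_X ^ (e - N) dvd of_nat N * poly (branch_poly N (euler_der f x y h)) w"
    by (subst (asm) dvd_mult_cancel_left) auto
  moreover have "(of_nat N :: complex fps) dvd 1"
    using N by (simp add: fps_is_unit_iff flip: fps_of_nat)
  ultimately show ?thesis by (simp add: dvd_mult_unit_iff')
qed simp

lemma branch_euler_der_funpow_order:
  assumes "N > 0" "poly (branch_poly N f) w = 0" "fps_X ^ e dvd poly (branch_poly N h) w"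
  shows "fps_X ^ (e - k * N) dvd poly (branch_poly N ((euler_der f x y ^^ k) h)) w"
proof (induction k)
  case (Suc k)
  show ?case using branch_euler_der_order[OF assms(1,2) Suc.IH, of x y] by (simp add: add.commute)
qed (use assms in simp)

text \<open>Otherwise \<open>f\<close> would divide its own derivative, which is nonzero of smaller
  degree. This makes the coefficient of d/ds in \<open>branch_euler_der\<close> nonzero.\<close>

lemma branch_pderiv_nonzero:
  assumes N: "N > 0" and prime: "prime_elem f" and monic: "lead_coeff f = 1"
    and f0: "poly (branch_poly N f) w = 0"
  shows "poly (branch_poly N (pderiv f)) w \<noteq> 0"
proof
  assume "poly (branch_poly N (pderiv f)) w = 0"
  hence "f dvd pderiv f" by (rule dvd_if_branch_zero[OF N prime monic f0])
  have "degree f > 0"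
  proof (rule ccontr)
    assume "\<not> degree f > 0"
    hence "f = 1" using monic by (metis degree_eq_zeroE gr0I lead_coeff_pCons(2) one_pCons)
    thus False using prime by simp
  qed
  moreover from this have "pderiv f \<noteq> 0" by (auto simp: pderiv_eq_0_iff)
  ultimately show False using dvd_imp_degree_le[OF \<open>f dvd pderiv f\<close>] degree_pderiv[of f] by simp
qed

text \<open>If \<open>W\<close> vanished on the branch, a kernel vector over C[[s]] would yield a
  relation with constant coefficients among the monomials on the branch, hence divisibility by
  \<open>f\<close>, against \<open>indep\<close>. For the second claim, a row of the adjugate
  expresses a unit times \<open>W\<close> through the derivatives of \<open>G\<close> of order below
  n, each of which has lost at most (n - 1) N in order.\<close>

lemma wronskian_branch:
  assumes N: "N > 0" and prime: "prime_elem f" and monic: "lead_coeff f = 1"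
    and f0: "poly (branch_poly N f) w = 0"
    and ux: "fps_nth (poly (branch_poly N x) w) 0 \<noteq> 0"
    and uy: "fps_nth (poly (branch_poly N y) w) 0 \<noteq> 0"
    and indep: "\<And>c. f dvd (\<Sum>l<n. [:[:c l:]:] * bimonom x y (s l)) \<Longrightarrow> \<forall>l<n. c l = 0"
  defines "W \<equiv> det (mat n n (\<lambda>(k, l). wronski_entry f x y (s l) k))"
  shows "poly (branch_poly N W) w \<noteq> 0"
    and "l0 < n \<Longrightarrow> c l0 \<noteq> 0 \<Longrightarrow> G = (\<Sum>l<n. [:[:c l:]:] * bimonom x y (s l)) \<Longrightarrow>
      subdegree (poly (branch_poly N G) w) \<le> subdegree (poly (branch_poly N W) w) + (n - 1) * N"
proof -
  define \<phi> where "\<phi> h = poly (branch_poly N h) w" for h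
  interpret \<phi>: comm_ring_hom \<phi> unfolding \<phi>_def by (rule branch_eval_hom) fact
  define M where "M = mat n n (\<lambda>(k, l). wronski_entry f x y (s l) k)"
  have M: "M \<in> carrier_mat n n" by (simp add: M_def)
  have W: "W = det M" by (simp add: W_def M_def)
  have \<phi>const: "\<phi> [:[:c:]:] = fps_const c" for c
    using N by (simp add: \<phi>_def branch_poly_const branch_coeff_pCons)
  have unit: "fps_nth (\<phi> (bimonom x y s)) 0 \<noteq> 0" for s
    using ux uy unfolding bimonom_def \<phi>.hom_mult \<phi>.hom_power unfolding \<phi>_def by (simp add: fps_nth_power_0)
  show W0: "poly (branch_poly N W) w \<noteq> 0"
  proof
    assume "poly (branch_poly N W) w = 0"
    hence "det (map_mat \<phi> M) = 0" unfolding W \<phi>_def[symmetric] by simp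
    then obtain v where v: "v \<in> carrier_vec n" "v \<noteq> 0\<^sub>v n" "map_mat \<phi> M *\<^sub>v v = 0\<^sub>v n"
      using det_0_iff_vec_prod_zero[of "map_mat \<phi> M" n] M by auto
    define H where "H k l = \<phi> ((euler_der f x y ^^ k) (bimonom x y (s l)))" for k l
    \<comment> \<open>The k-th derivative of a monomial is the monomial times its matrix entry.
      Dividing by the monomial, a unit at s = 0, turns the kernel vector into a relation among the
      derivatives themselves.\<close>
    define a where "a l = vec_index v l * inverse (\<phi> (bimonom x y (s l)))" for l
    have inv: "inverse (\<phi> (bimonom x y s)) * \<phi> (bimonom x y s) = 1" for s
      using unit by (rule inverse_mult_eq_1)
    have "\<exists>c. (\<exists>l\<in>{..<n}. c l \<noteq> 0) \<and> (\<Sum>l\<in>{..<n}. fps_const (c l) * H 0 l) = 0"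
    proof (rule wronskian_dependent)
      show "\<phi> (x * y * pderiv f) \<noteq> 0"
        using ux uy branch_pderiv_nonzero[OF N prime monic f0]
        unfolding \<phi>.hom_mult unfolding \<phi>_def by auto
      show "\<phi> (x * y * pderiv f) * fps_deriv (H k l) = of_nat N * fps_X ^ (N - 1) * H (Suc k) l" for k l
        using branch_euler_der[OF N f0] unfolding H_def \<phi>_def by simp
      obtain l where l: "l < n" "vec_index v l \<noteq> 0" using v(1,2) by (metis carrier_vecD eq_vecI index_zero_vec)
      hence "vec_index v l = a l * \<phi> (bimonom x y (s l))" using inv[of "s l"] by (simp add: a_def mult.assoc)
      hence "a l \<noteq> 0" using l by auto
      thus "\<exists>l\<in>{..<n}. a l \<noteq> 0" using l by auto
      fix k assume "k < card {..<n}"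
      hence k: "k < n" by simp
      have "(\<Sum>l<n. a l * H k l) = (\<Sum>l<n. \<phi> (wronski_entry f x y (s l) k) * vec_index v l)"
      proof (rule sum.cong)
        fix l
        have "a l * H k l = vec_index v l * (inverse (\<phi> (bimonom x y (s l))) * \<phi> (bimonom x y (s l))) * \<phi> (wronski_entry f x y (s l) k)"
          by (simp only: a_def H_def euler_der_funpow_bimonom \<phi>.hom_mult mult.assoc)
        thus "a l * H k l = \<phi> (wronski_entry f x y (s l) k) * vec_index v l"
          unfolding inv by (simp add: mult.commute)
      qed simp
      also have "\<dots> = vec_index (map_mat \<phi> M *\<^sub>v v) k"
        using k v(1) M by (simp add: scalar_prod_def atLeast0LessThan M_def)
      finally show "(\<Sum>l\<in>{..<n}. a l * H k l) = 0" using v(3) k by simp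
    qed simp
    then obtain c where c: "\<exists>l<n. c l \<noteq> 0" "(\<Sum>l<n. fps_const (c l) * H 0 l) = 0" by auto
    have "\<phi> (\<Sum>l<n. [:[:c l:]:] * bimonom x y (s l)) = 0"
      using c(2) by (simp only: \<phi>.hom_sum \<phi>.hom_mult \<phi>const H_def funpow_0 id_apply)
    hence "f dvd (\<Sum>l<n. [:[:c l:]:] * bimonom x y (s l))"
      unfolding \<phi>_def by (rule dvd_if_branch_zero[OF N prime monic f0])
    thus False using indep[of c] c(1) by blast
  qed
  show "subdegree (poly (branch_poly N G) w) \<le> subdegree (poly (branch_poly N W) w) + (n - 1) * N"
    if l0: "l0 < n" "c l0 \<noteq> 0" and G: "G = (\<Sum>l<n. [:[:c l:]:] * bimonom x y (s l))"
  proof -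
    \<comment> \<open>Row \<open>l0\<close> of the adjugate eliminates all terms of \<open>G\<close>
      but the one at \<open>l0\<close>, whose coefficient is nonzero.\<close>
    define A where "A = adj_mat M"
    have A: "A \<in> carrier_mat n n" and AM: "A * M = W \<cdot>\<^sub>m 1\<^sub>m n"
      using adj_mat[OF M] by (simp_all add: A_def W)
    have row: "(\<Sum>k<n. A $$ (l0, k) * M $$ (k, l)) = (if l = l0 then W else 0)" if "l < n" for l
    proof -
      have "(\<Sum>k<n. A $$ (l0, k) * M $$ (k, l)) = (A * M) $$ (l0, l)"
        using that l0 A M by (simp add: scalar_prod_def atLeast0LessThan)
      also have "\<dots> = (if l = l0 then W else 0)" unfolding AM using that l0 by simp
      finally show ?thesis .
    qed
    have EG: "(euler_der f x y ^^ k) G = (\<Sum>l<n. [:[:c l:]:] * bimonom x y (s l) * M $$ (k, l))" if "k < n" for k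
      unfolding G euler_der_funpow_sum euler_der_funpow_bimonom
      using that by (intro sum.cong) (simp_all add: M_def mult.assoc)
    have "(\<Sum>k<n. A $$ (l0, k) * (euler_der f x y ^^ k) G) =
          (\<Sum>k<n. \<Sum>l<n. [:[:c l:]:] * bimonom x y (s l) * (A $$ (l0, k) * M $$ (k, l)))"
      by (rule sum.cong) (simp_all only: EG lessThan_iff sum_distrib_left mult_ac)
    also have "\<dots> = (\<Sum>l<n. [:[:c l:]:] * bimonom x y (s l) * (\<Sum>k<n. A $$ (l0, k) * M $$ (k, l)))"
      by (subst sum.swap) (simp only: sum_distrib_left)
    also have "\<dots> = (\<Sum>l<n. if l = l0 then [:[:c l:]:] * bimonom x y (s l) * W else 0)"
      by (rule sum.cong) (auto simp: row)
    also have "\<dots> = [:[:c l0:]:] * bimonom x y (s l0) * W" using l0 by simp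
    finally have key: "(\<Sum>k<n. A $$ (l0, k) * (euler_der f x y ^^ k) G) = [:[:c l0:]:] * bimonom x y (s l0) * W" .
    define e where "e = subdegree (\<phi> G) - (n - 1) * N"
    have XG: "fps_X ^ subdegree (\<phi> G) dvd \<phi> G"
      by (metis dvd_triv_right subdegree_decompose)
    have "fps_X ^ e dvd \<phi> (\<Sum>k<n. A $$ (l0, k) * (euler_der f x y ^^ k) G)"
      unfolding \<phi>.hom_sum \<phi>.hom_mult
    proof (intro dvd_sum dvd_mult)
      fix k assume "k \<in> {..<n}"
      hence "k * N \<le> (n - 1) * N" by auto
      hence "(fps_X :: complex fps) ^ e dvd fps_X ^ (subdegree (\<phi> G) - k * N)"
        unfolding e_def by (intro le_imp_power_dvd diff_le_mono2)
      also have "\<dots> dvd \<phi> ((euler_der f x y ^^ k) G)"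
        using branch_euler_der_funpow_order[OF N f0, of "subdegree (\<phi> G)" G k x y] XG unfolding \<phi>_def by simp
      finally show "fps_X ^ e dvd \<phi> ((euler_der f x y ^^ k) G)" .
    qed
    hence "fps_X ^ e dvd (fps_const (c l0) * \<phi> (bimonom x y (s l0))) * \<phi> W"
      unfolding key \<phi>.hom_mult \<phi>const .
    moreover have "fps_const (c l0) * \<phi> (bimonom x y (s l0)) dvd 1"
      using l0 unit by (simp add: fps_is_unit_iff)
    ultimately have "fps_X ^ e dvd \<phi> W" by (simp only: dvd_mult_unit_iff')
    hence "e \<le> subdegree (\<phi> W)"
      using W0 fps_dvd_iff[of "fps_X ^ e" "\<phi> W"] by (simp add: \<phi>_def fps_X_power_subdegree)
    thus ?thesis unfolding e_def \<phi>_def by linarith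
  qed
qed

section \<open>Choice of the monomials and the bound over all branches\<close>

text \<open>Take \<open>J\<close> of least size. A relation modulo \<open>f\<close> with nonzero
  coefficient at \<open>k\<close> could be used to remove \<open>k\<close> from \<open>J\<close>, so
  there is none. As \<open>f\<close> does not divide \<open>G\<close>, some coefficient is nonzero,
  which Cramer's rule needs.\<close>

lemma minimal_support_mod:
  fixes f G :: bipoly and \<mu> :: "'s \<Rightarrow> bipoly"
  assumes fin: "finite S" and G: "G = (\<Sum>s\<in>S. [:[:\<gamma> s:]:] * \<mu> s)" and nd: "\<not> f dvd G"
  obtains J c i where "J \<subseteq> S" "i \<in> J" "c i \<noteq> 0" "f dvd G - (\<Sum>s\<in>J. [:[:c s:]:] * \<mu> s)"
    "\<forall>c'. f dvd (\<Sum>s\<in>J. [:[:c' s:]:] * \<mu> s) \<longrightarrow> (\<forall>s\<in>J. c' s = 0)"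
proof -
  define good where "good J \<longleftrightarrow> J \<subseteq> S \<and> (\<exists>c. f dvd G - (\<Sum>s\<in>J. [:[:c s:]:] * \<mu> s))" for J
  have "good S" unfolding good_def using G by (auto intro!: exI[of _ \<gamma>])
  then obtain J where J: "good J" and min: "\<And>J'. good J' \<Longrightarrow> card J \<le> card J'"
    using ex_has_least_nat[of good S card] by blast
  then obtain c where c: "J \<subseteq> S" "f dvd G - (\<Sum>s\<in>J. [:[:c s:]:] * \<mu> s)" unfolding good_def by blast
  have finJ: "finite J" using c(1) fin finite_subset by blast
  have "\<exists>i\<in>J. c i \<noteq> 0"
  proof (rule ccontr)
    assume "\<not> ?thesis"
    hence "(\<Sum>s\<in>J. [:[:c s:]:] * \<mu> s) = 0" by (intro sum.neutral) auto
    thus False using c(2) nd by simp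
  qed
  then obtain i where i: "i \<in> J" "c i \<noteq> 0" by blast
  have indep: "\<forall>s\<in>J. c' s = 0" if dvd: "f dvd (\<Sum>s\<in>J. [:[:c' s:]:] * \<mu> s)" for c'
  proof (rule ccontr)
    assume "\<not> ?thesis"
    then obtain k where k: "k \<in> J" "c' k \<noteq> 0" by blast
    define r where "r = c k / c' k"
    define c2 where "c2 s = c s - r * c' s" for s
    have "c2 k = 0" using k by (simp add: c2_def r_def)
    hence "(\<Sum>s\<in>J - {k}. [:[:c2 s:]:] * \<mu> s) = (\<Sum>s\<in>J. [:[:c2 s:]:] * \<mu> s)"
      using k(1) finJ by (simp add: sum.remove[of J k])
    also have "\<dots> = (\<Sum>s\<in>J. [:[:c s:]:] * \<mu> s - [:[:r:]:] * ([:[:c' s:]:] * \<mu> s))"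
    proof (rule sum.cong[OF refl])
      fix s
      have "[:[:c2 s:]:] = [:[:c s:]:] - [:[:r:]:] * [:[:c' s:]:]" by (simp add: c2_def)
      thus "[:[:c2 s:]:] * \<mu> s = [:[:c s:]:] * \<mu> s - [:[:r:]:] * ([:[:c' s:]:] * \<mu> s)"
        by (simp only: left_diff_distrib mult.assoc)
    qed
    also have "\<dots> = (\<Sum>s\<in>J. [:[:c s:]:] * \<mu> s) - [:[:r:]:] * (\<Sum>s\<in>J. [:[:c' s:]:] * \<mu> s)"
      by (simp only: sum_subtractf sum_distrib_left)
    finally have e: "G - (\<Sum>s\<in>J - {k}. [:[:c2 s:]:] * \<mu> s) =
        (G - (\<Sum>s\<in>J. [:[:c s:]:] * \<mu> s)) + [:[:r:]:] * (\<Sum>s\<in>J. [:[:c' s:]:] * \<mu> s)"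
      by (simp only: algebra_simps)
    have "f dvd G - (\<Sum>s\<in>J - {k}. [:[:c2 s:]:] * \<mu> s)"
      unfolding e by (intro dvd_add dvd_mult c(2) dvd)
    hence "good (J - {k})" using c(1) unfolding good_def by blast
    hence "card J \<le> card (J - {k})" by (rule min)
    moreover have "card J > 0" using k finJ card_gt_0_iff by blast
    ultimately show False using k finJ by simp
  qed
  show ?thesis by (rule that[OF c(1) i c(2)]) (use indep in blast)
qed

theorem branch_orders_bound:
  fixes f G x y :: bipoly
  assumes N: "N > 0" and prime: "prime_elem f" and monic: "lead_coeff f = 1"
    and deg: "degree f = d" and tdeg: "tdeg_le d f" "tdeg_le 1 x" "tdeg_le 1 y"
    and vs: "branch_poly N f = (\<Prod>v\<leftarrow>vs. [:-v, 1:])"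
    and ux: "\<And>w. w \<in> set vs \<Longrightarrow> fps_nth (poly (branch_poly N x) w) 0 \<noteq> 0"
    and uy: "\<And>w. w \<in> set vs \<Longrightarrow> fps_nth (poly (branch_poly N y) w) 0 \<noteq> 0"
    and fin: "finite S" and G: "G = (\<Sum>s\<in>S. [:[:\<gamma> s:]:] * bimonom x y s)" and nd: "\<not> f dvd G"
  shows "(\<Sum>w\<leftarrow>vs. subdegree (poly (branch_poly N G) w)) \<le> N * (d\<^sup>2 * (card S)\<^sup>2)"
    and "\<And>w. w \<in> set vs \<Longrightarrow> poly (branch_poly N G) w \<noteq> 0"
proof -
  interpret bc: comm_ring_hom "branch_coeff N" by (rule branch_coeff_hom) fact
  have root: "poly (branch_poly N f) w = 0" if "w \<in> set vs" for w
    unfolding vs using that by (induction vs) auto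
  show nz: "poly (branch_poly N G) w \<noteq> 0" if "w \<in> set vs" for w
    using dvd_if_branch_zero[OF N prime monic root[OF that]] nd by blast
  obtain J c i where J: "J \<subseteq> S" "i \<in> J" "c i \<noteq> 0" "f dvd G - (\<Sum>s\<in>J. [:[:c s:]:] * bimonom x y s)"
    and indep: "\<forall>c'. f dvd (\<Sum>s\<in>J. [:[:c' s:]:] * bimonom x y s) \<longrightarrow> (\<forall>s\<in>J. c' s = 0)"
    by (rule minimal_support_mod[OF fin G nd])
  have finJ: "finite J" using J(1) fin finite_subset by blast
  define n where "n = card J"
  have n: "n \<ge> 1" "n \<le> card S"
    using J finJ fin by (auto simp: n_def Suc_le_eq card_gt_0_iff intro: card_mono)
  obtain s where s: "bij_betw s {..<n} J"
    using ex_bij_betw_nat_finite[OF finJ] by (auto simp: n_def atLeast0LessThan)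
  have reindex: "(\<Sum>l<n. h (s l)) = (\<Sum>s\<in>J. h s)" for h :: "nat \<times> nat \<Rightarrow> bipoly"
    by (rule sum.reindex_bij_betw[OF s])
  define G' where "G' = (\<Sum>s\<in>J. [:[:c s:]:] * bimonom x y s)"
  have G': "G' = (\<Sum>l<n. [:[:c (s l):]:] * bimonom x y (s l))"
    unfolding G'_def by (rule reindex[symmetric])
  obtain l0 where l0: "l0 < n" "s l0 = i" using s J(2) by (auto simp: bij_betw_def)
  define idx where "idx = inv_into {..<n} s"
  have idx: "idx (s l) = l" if "l < n" for l
    unfolding idx_def using s that by (intro bij_betw_inv_into_left) auto
  have indep': "\<forall>l<n. c' l = 0" if "f dvd (\<Sum>l<n. [:[:c' l:]:] * bimonom x y (s l))" for c'
  proof -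
    have "(\<Sum>l<n. [:[:c' l:]:] * bimonom x y (s l)) = (\<Sum>l<n. [:[:c' (idx (s l)):]:] * bimonom x y (s l))"
      by (rule sum.cong) (auto simp: idx)
    also have "\<dots> = (\<Sum>s\<in>J. [:[:c' (idx s):]:] * bimonom x y s)" by (rule reindex)
    finally have "\<forall>s\<in>J. c' (idx s) = 0" using indep[rule_format, of "\<lambda>s. c' (idx s)"] that by simp
    thus ?thesis using s idx by (metis bij_betwE lessThan_iff)
  qed
  define W where "W = det (mat n n (\<lambda>(k, l). wronski_entry f x y (s l) k))"
  have W: "poly (branch_poly N W) w \<noteq> 0"
    and GW: "subdegree (poly (branch_poly N G) w) \<le> subdegree (poly (branch_poly N W) w) + (n - 1) * N"
    if w: "w \<in> set vs" for w
  proof -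
    note wb = wronskian_branch[where s = s, OF N prime monic root[OF w] ux[OF w] uy[OF w] indep', folded W_def]
    show "poly (branch_poly N W) w \<noteq> 0" by (rule wb(1))
    interpret \<phi>: comm_ring_hom "\<lambda>h. poly (branch_poly N h) w" by (rule branch_eval_hom) fact
    \<comment> \<open>\<open>f\<close> vanishes on the branch, so \<open>G\<close> may be replaced
      by its representative with minimal support without changing the order.\<close>
    have "poly (branch_poly N (G - G')) w = 0"
      using J(4) root[OF w] unfolding G'_def[symmetric] by (metis \<phi>.hom_mult dvdE mult_zero_left)
    hence "poly (branch_poly N G) w = poly (branch_poly N G') w" unfolding \<phi>.hom_minus by simp
    thus "subdegree (poly (branch_poly N G) w) \<le> subdegree (poly (branch_poly N W) w) + (n - 1) * N"
      using wb(2)[of l0 "\<lambda>l. c (s l)" G'] l0 J(3) G' by simp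
  qed
  have lvs: "length vs \<le> d"
    using degree_prod_linear[of vs] degree_map_poly_le[of "branch_coeff N" f] deg
    unfolding vs[symmetric] branch_poly_def by simp
  have "(\<Sum>w\<leftarrow>vs. subdegree (poly (branch_poly N G) w)) \<le>
        (\<Sum>w\<leftarrow>vs. subdegree (poly (branch_poly N W) w) + (n - 1) * N)"
    by (rule sum_list_mono) (rule GW)
  also have "\<dots> = (\<Sum>w\<leftarrow>vs. subdegree (poly (branch_poly N W) w)) + length vs * ((n - 1) * N)"
    by (simp add: sum_list_addf sum_list_triv)
  also have "(\<Sum>w\<leftarrow>vs. subdegree (poly (branch_poly N W) w)) \<le> N * (d * (d * (n * (n - 1) div 2)))"
    unfolding W_def
    by (rule bezout_branches[OF N monic deg tdeg(1) tdeg_le_wronskian[OF tdeg] vs]) (use W in \<open>simp add: W_def\<close>)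
  \<comment> \<open>The loss of (n - 1) N occurs once per branch. There are at most d branches, and
    d <= d^2 merges this with the Bezout term.\<close>
  also have "length vs * ((n - 1) * N) \<le> N * (d\<^sup>2 * (n - 1))"
  proof -
    have "length vs \<le> d\<^sup>2" using lvs by (cases d) (auto simp: power2_eq_square)
    hence "length vs * ((n - 1) * N) \<le> d\<^sup>2 * ((n - 1) * N)" by (rule mult_right_mono) simp
    thus ?thesis by (simp add: mult_ac)
  qed
  also have "N * (d * (d * (n * (n - 1) div 2))) + N * (d\<^sup>2 * (n - 1)) = N * (d\<^sup>2 * (n * (n - 1) div 2 + (n - 1)))"
    by (simp add: power2_eq_square algebra_simps)
  also have "n * (n - 1) div 2 + (n - 1) \<le> n\<^sup>2"
  proof -
    obtain k where k: "n = Suc k" using n by (cases n) auto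
    have "n * (n - 1) div 2 \<le> n * (n - 1)" by simp
    thus ?thesis unfolding k by (simp add: power2_eq_square)
  qed
  also have "n\<^sup>2 \<le> (card S)\<^sup>2" using n by (simp add: power_mono)
  finally show "(\<Sum>w\<leftarrow>vs. subdegree (poly (branch_poly N G) w)) \<le> N * (d\<^sup>2 * (card S)\<^sup>2)"
    by (simp add: mult_left_mono)
qed

lemma beval_pCons: "beval (pCons p h) a b = poly p a + b * beval h a b"
proof -
  have "map_poly (\<lambda>c. poly c a) (pCons p h) = pCons (poly p a) (map_poly (\<lambda>c. poly c a) h)"
    by (rule poly_eqI) (simp add: coeff_map_poly coeff_pCons split: nat.split)
  thus ?thesis by (simp add: beval_def)
qed

lemma branch_nth_0:
  assumes N: "N > 0"
  shows "fps_nth (poly (branch_poly N h) w) 0 = beval h 0 (fps_nth w 0)"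
proof (induction h)
  case (pCons p h)
  have "fps_nth (branch_coeff N p) 0 = poly p 0"
    using N by (simp add: branch_coeff_def ramify_nth poly_0_coeff_0)
  thus ?case using pCons by (simp add: branch_poly_pCons beval_pCons)
qed (simp add: branch_poly_def beval_def)

text \<open>The ramification index multiplies both the dimension and the bound on the orders, so it
  cancels. \<open>unit\<close> must cover all zeros of \<open>f\<close> on u = 0, whereas
  \<open>indep\<close> and \<open>H0\<close> concern the origin only: the orders at the other points
  are nonnegative and are simply included in the sum.\<close>

theorem local_intersection_bound:
  fixes f G x y :: bipoly and P :: "nat \<Rightarrow> bipoly"
  assumes prime: "prime_elem f" and monic: "lead_coeff f = 1"
    and deg: "degree f = d" and tdeg: "tdeg_le d f" "tdeg_le 1 x" "tdeg_le 1 y"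
    and unit: "\<And>v. beval f 0 v = 0 \<Longrightarrow> beval x 0 v \<noteq> 0 \<and> beval y 0 v \<noteq> 0"
    and fin: "finite S" and G: "G = (\<Sum>s\<in>S. [:[:\<gamma> s:]:] * bimonom x y s)" and nd: "\<not> f dvd G"
    and H0: "H0 * [:monom 1 r:] = U0 * f + V0 * G" "beval H0 0 0 \<noteq> 0"
    and indep: "\<And>c U V H. beval H 0 0 \<noteq> 0 \<Longrightarrow> H * (\<Sum>j<m. [:[:c j:]:] * P j) = U * f + V * G
                 \<Longrightarrow> \<forall>j<m. c j = 0"
  shows "m \<le> d\<^sup>2 * (card S)\<^sup>2"
proof -
  have "coeff (map_poly fps_of_poly f) d = 1"
    using monic deg by (simp add: coeff_map_poly)
  moreover have "degree (map_poly fps_of_poly f) \<le> d"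
    using degree_map_poly_le[of fps_of_poly f] deg by simp
  ultimately have "lead_coeff (map_poly fps_of_poly f) = 1"
    using le_degree[of "map_poly fps_of_poly f" d] by simp
  then obtain N vs where N: "N > 0" and "map_poly (ramify N) (map_poly fps_of_poly f) = (\<Prod>v\<leftarrow>vs. [:-v, 1:])"
    using puiseux by blast
  moreover have "map_poly (ramify N) (map_poly fps_of_poly f) = branch_poly N f"
    by (rule poly_eqI) (simp add: branch_poly_def branch_coeff_def coeff_map_poly)
  ultimately have vs: "branch_poly N f = (\<Prod>v\<leftarrow>vs. [:-v, 1:])" by simp
  have "beval f 0 (fps_nth w 0) = 0" if "w \<in> set vs" for w
  proof -
    have "poly (branch_poly N f) w = 0" unfolding vs using that by (induction vs) auto
    thus ?thesis using branch_nth_0[OF N, of f w] by simp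
  qed
  hence u: "fps_nth (poly (branch_poly N x) w) 0 \<noteq> 0" "fps_nth (poly (branch_poly N y) w) 0 \<noteq> 0"
    if "w \<in> set vs" for w using unit that by (simp_all add: branch_nth_0[OF N])
  note bounds = branch_orders_bound[OF N prime monic deg tdeg vs u fin G nd]
  have "N * m \<le> (\<Sum>v\<leftarrow>vs. subdegree (poly (branch_poly N G) v))"
    by (rule intersection_dim_le_branch_orders[OF N vs bounds(2) H0 indep])
  also have "\<dots> \<le> N * (d\<^sup>2 * (card S)\<^sup>2)" by (rule bounds(1))
  finally show ?thesis using N by simp
qed

section \<open>Shears\<close>

abbreviation bconst :: "complex \<Rightarrow> bipoly" where "bconst k \<equiv> [:[:k:]:]"

definition xsubst :: "bipoly \<Rightarrow> complex poly \<Rightarrow> bipoly" where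
  "xsubst x p = poly (map_poly bconst p) x"

definition bisubst :: "bipoly \<Rightarrow> bipoly \<Rightarrow> bipoly \<Rightarrow> bipoly" where
  "bisubst x y F = poly (map_poly (xsubst x) F) y"

lemma poly_map_poly_hom:
  assumes "comm_ring_hom h"
  shows "comm_ring_hom (\<lambda>F. poly (map_poly h F) y)"
proof -
  interpret mh: comm_ring_hom "map_poly h" by (rule comm_ring_hom_map_poly) fact
  show ?thesis by unfold_locales (simp_all add: mh.hom_mult mh.hom_add)
qed

lemma xsubst_hom: "comm_ring_hom (xsubst x)"
proof -
  have "comm_ring_hom bconst" by unfold_locales (simp_all add: one_pCons)
  from poly_map_poly_hom[OF this, of x] show ?thesis by (simp add: xsubst_def[abs_def])
qed

lemma bisubst_hom: "comm_ring_hom (bisubst x y)"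
  using poly_map_poly_hom[OF xsubst_hom, of x y] by (simp add: bisubst_def[abs_def])

lemma beval_hom: "comm_ring_hom (\<lambda>F. beval F a b)"
proof -
  have "comm_ring_hom (\<lambda>p :: complex poly. poly p a)" by unfold_locales simp_all
  from poly_map_poly_hom[OF this, of b] show ?thesis by (simp add: beval_def)
qed

lemma map_poly_pCons_0: "h 0 = 0 \<Longrightarrow> map_poly h (pCons p F) = pCons (h p) (map_poly h F)"
  by (rule poly_eqI) (simp add: coeff_map_poly coeff_pCons split: nat.split)

lemma xsubst_pCons: "xsubst x (pCons k p) = bconst k + x * xsubst x p"
  by (simp add: xsubst_def map_poly_pCons_0)

lemma xsubst_0 [simp]: "xsubst x 0 = 0"
  by (simp add: xsubst_def)

lemma bisubst_pCons: "bisubst x y (pCons p F) = xsubst x p + y * bisubst x y F"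
  by (simp add: bisubst_def map_poly_pCons_0)

lemma bisubst_0 [simp]: "bisubst x y 0 = 0"
  by (simp add: bisubst_def)

lemma beval_0 [simp]: "beval 0 a b = 0"
  by (simp add: beval_def)

lemma bisubst_const: "bisubst x y (bconst k) = bconst k"
  by (simp add: bisubst_pCons xsubst_pCons)

lemma beval_const: "beval (bconst k) a b = k"
  by (simp add: beval_pCons)

lemma beval_bisubst: "beval (bisubst x y F) a b = beval F (beval x a b) (beval y a b)"
proof -
  interpret e: comm_ring_hom "\<lambda>F. beval F a b" by (rule beval_hom)
  have 1: "beval (xsubst x p) a b = poly p (beval x a b)" for p
    by (induction p) (simp_all add: xsubst_pCons e.hom_add e.hom_mult beval_const)
  show ?thesis
    by (induction F) (simp_all add: bisubst_pCons beval_pCons e.hom_add e.hom_mult 1)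
qed

lemma bisubst_bisubst: "bisubst x' y' (bisubst x y F) = bisubst (bisubst x' y' x) (bisubst x' y' y) F"
proof -
  interpret s: comm_ring_hom "bisubst x' y'" by (rule bisubst_hom)
  have 1: "bisubst x' y' (xsubst x p) = xsubst (bisubst x' y' x) p" for p
    by (induction p) (simp_all add: xsubst_pCons s.hom_add s.hom_mult bisubst_const)
  show ?thesis
    by (induction F) (simp_all add: bisubst_pCons s.hom_add s.hom_mult 1)
qed

lemma bisubst_id: "bisubst [:[:0, 1:]:] [:0, 1:] F = F"
proof -
  have 1: "xsubst [:[:0, 1:]:] p = [:p:]" for p by (induction p) (simp_all add: xsubst_pCons)
  show ?thesis by (induction F) (simp_all add: bisubst_pCons 1)
qed

section \<open>Monomial expansions and total degree\<close>

lemma finite_bsupport: "finite (bsupport F)"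
proof (rule finite_subset)
  show "bsupport F \<subseteq> (\<Union>j\<in>{..degree F}. (\<lambda>i. (i, j)) ` {..degree (coeff F j)})"
  proof
    fix s assume "s \<in> bsupport F"
    then obtain i j where s: "s = (i, j)" "coeff (coeff F j) i \<noteq> 0" by (auto simp: bsupport_def bcoeff_def)
    hence "i \<le> degree (coeff F j)" "coeff F j \<noteq> 0" by (auto intro: le_degree)
    hence "j \<le> degree F" by (intro le_degree)
    thus "s \<in> (\<Union>j\<in>{..degree F}. (\<lambda>i. (i, j)) ` {..degree (coeff F j)})"
      using s \<open>i \<le> _\<close> by auto
  qed
qed auto

lemma bipoly_eq_sum_monomials:
  "F = (\<Sum>s\<in>bsupport F. bconst (bcoeff F (fst s) (snd s)) * bimonom [:[:0, 1:]:] [:0, 1:] s)"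
proof (rule poly_eqI, rule poly_eqI)
  fix j i
  have x: "[:[:0, 1:]:] ^ n = [:monom 1 n :: complex poly:]" for n
    by (induction n) (simp_all add: monom_Suc monom_0 one_pCons)
  have y: "[:0, 1:] ^ n = monom (1 :: complex poly) n" for n
    by (induction n) (simp_all add: monom_Suc monom_0)
  have m: "coeff (coeff (bconst k * bimonom [:[:0, 1:]:] [:0, 1:] s) j) i = (if s = (i, j) then k else 0)" for k s
    unfolding bimonom_def x y by (cases s) auto
  have "coeff (coeff (\<Sum>s\<in>bsupport F. bconst (bcoeff F (fst s) (snd s)) * bimonom [:[:0, 1:]:] [:0, 1:] s) j) i
      = (\<Sum>s\<in>bsupport F. if s = (i, j) then bcoeff F (fst s) (snd s) else 0)"
    by (simp only: coeff_sum m)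
  also have "\<dots> = coeff (coeff F j) i"
    using finite_bsupport[of F] by (subst sum.delta) (auto simp: bsupport_def bcoeff_def)
  finally show "coeff (coeff F j) i = coeff (coeff (\<Sum>s\<in>bsupport F. bconst (bcoeff F (fst s) (snd s)) * bimonom [:[:0, 1:]:] [:0, 1:] s) j) i" ..
qed

text \<open>Sparsity is preserved in this form: expanded in u and v the number of terms may grow,
  but as a combination of monomials in \<open>x\<close> and \<open>y\<close> it stays the
  same.\<close>

lemma bisubst_eq_sum:
  "bisubst x y F = (\<Sum>s\<in>bsupport F. bconst (bcoeff F (fst s) (snd s)) * bimonom x y s)"
proof -
  interpret s: comm_ring_hom "bisubst x y" by (rule bisubst_hom)
  interpret xs: comm_ring_hom "xsubst x" by (rule xsubst_hom)
  have "bisubst x y [:[:0, 1:]:] = x" "bisubst x y [:0, 1:] = y"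
    using xs.hom_one by (simp_all add: bisubst_pCons xsubst_pCons flip: one_pCons)
  hence "bisubst x y (bimonom [:[:0, 1:]:] [:0, 1:] s) = bimonom x y s" for s
    by (simp add: bimonom_def s.hom_mult s.hom_power)
  thus ?thesis
    by (subst bipoly_eq_sum_monomials[of F]) (simp only: s.hom_sum s.hom_mult bisubst_const)
qed

lemma tdeg_le_total_degree: "tdeg_le (total_degree F) F"
proof (cases "F = 0")
  case False
  show ?thesis unfolding tdeg_le_def
  proof (intro allI impI)
    fix i j assume "bcoeff F i j \<noteq> 0"
    hence "i + j \<in> (\<lambda>(i, j). i + j) ` bsupport F" by (force simp: bsupport_def)
    thus "i + j \<le> total_degree F" using False finite_bsupport[of F] by (simp add: total_degree_def)
  qed
qed simp

lemma total_degree_attained: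
  assumes "F \<noteq> 0"
  obtains i j where "bcoeff F i j \<noteq> 0" "i + j = total_degree F"
proof -
  have "bsupport F \<noteq> {}"
    using assms by (auto simp: bsupport_def bcoeff_def poly_eq_iff)
  hence "total_degree F \<in> (\<lambda>(i, j). i + j) ` bsupport F"
    using finite_bsupport[of F] assms unfolding total_degree_def by (auto intro!: Max_in)
  thus ?thesis using that by (auto simp: bsupport_def)
qed

section \<open>Shears centred at a point\<close>

text \<open>The substitution is x = a + u + c v, y = b + v. It moves (a, b) to the origin, and u = 0
  becomes the line through (a, b) with direction (c, 1).\<close>

definition shear_x :: "complex \<Rightarrow> complex \<Rightarrow> bipoly" where "shear_x a c = [:[:a, 1:], [:c:]:]"
definition shear_y :: "complex \<Rightarrow> bipoly" where "shear_y b = [:[:b:], 1:]"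

lemma tdeg_le_shear: "tdeg_le 1 (shear_x a c)" "tdeg_le 1 (shear_y b)"
  by (rule tdeg_leI; auto simp: shear_x_def shear_y_def coeff_pCons coeff_1 split: nat.splits if_splits)+

text \<open>Solving for the new coordinates gives v = y - b and u = x - c y + (c b - a).\<close>

lemma shear_inverse:
  "bisubst (shear_x (c * b - a) (- c)) (shear_y (- b)) (bisubst (shear_x a c) (shear_y b) F) = F"
  "bisubst (shear_x a c) (shear_y b) (bisubst (shear_x (c * b - a) (- c)) (shear_y (- b)) F) = F"
proof -
  have "bisubst (shear_x (c * b - a) (- c)) (shear_y (- b)) (shear_x a c) = [:[:0, 1:]:]"
       "bisubst (shear_x (c * b - a) (- c)) (shear_y (- b)) (shear_y b) = [:0, 1:]"
       "bisubst (shear_x a c) (shear_y b) (shear_x (c * b - a) (- c)) = [:[:0, 1:]:]"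
       "bisubst (shear_x a c) (shear_y b) (shear_y (- b)) = [:0, 1:]"
    by (simp_all add: shear_x_def shear_y_def bisubst_pCons xsubst_pCons one_pCons)
  thus "bisubst (shear_x (c * b - a) (- c)) (shear_y (- b)) (bisubst (shear_x a c) (shear_y b) F) = F"
       "bisubst (shear_x a c) (shear_y b) (bisubst (shear_x (c * b - a) (- c)) (shear_y (- b)) F) = F"
    unfolding bisubst_bisubst by (simp_all only: bisubst_id)
qed

lemma tdeg_le_bimonom: "tdeg_le 1 x \<Longrightarrow> tdeg_le 1 y \<Longrightarrow> tdeg_le (fst s + snd s) (bimonom x y s)"
  unfolding bimonom_def using tdeg_le_mult[OF tdeg_le_power tdeg_le_power, of 1 x 1 y "fst s" "snd s"] by simp

lemma tdeg_le_bisubst: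
  assumes "tdeg_le D F" "tdeg_le 1 x" "tdeg_le 1 y"
  shows "tdeg_le D (bisubst x y F)"
  unfolding bisubst_eq_sum
proof (rule tdeg_le_sum)
  fix s assume "s \<in> bsupport F"
  hence "fst s + snd s \<le> D" using assms(1) by (auto simp: bsupport_def tdeg_le_def)
  hence "tdeg_le D (bimonom x y s)" using tdeg_le_bimonom[OF assms(2,3)] tdeg_le_mono by blast
  thus "tdeg_le D (bconst (bcoeff F (fst s) (snd s)) * bimonom x y s)"
    using tdeg_le_mult[OF tdeg_le_const[of 0]] by fastforce
qed

lemma coeff_mult_top:
  fixes p q :: "'a :: comm_semiring_1 poly"
  assumes "degree p \<le> i" "degree q \<le> j"
  shows "coeff (p * q) (i + j) = coeff p i * coeff q j"
proof -
  have "coeff (p * q) (i + j) = (\<Sum>k\<in>{i}. coeff p k * coeff q (i + j - k))"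
    unfolding coeff_mult
  proof (rule sum.mono_neutral_right)
    show "\<forall>k\<in>{..i + j} - {i}. coeff p k * coeff q (i + j - k) = 0"
    proof
      fix k assume "k \<in> {..i + j} - {i}"
      hence "k > degree p \<or> i + j - k > degree q" using assms by auto
      thus "coeff p k * coeff q (i + j - k) = 0" by (auto simp: coeff_eq_0)
    qed
  qed auto
  thus ?thesis by simp
qed

text \<open>The homogeneous part of top degree, dehomogenized at y = 1; its value at c is its value
  at the direction (c, 1).\<close>

definition top_form :: "bipoly \<Rightarrow> complex poly" where
  "top_form F = (\<Sum>s\<in>{s\<in>bsupport F. fst s + snd s = total_degree F}. monom (bcoeff F (fst s) (snd s)) (fst s))"

lemma top_form_nonzero:
  assumes "F \<noteq> 0"
  shows "top_form F \<noteq> 0"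
proof -
  obtain i j where ij: "bcoeff F i j \<noteq> 0" "i + j = total_degree F" using total_degree_attained[OF assms] .
  have "coeff (top_form F) i = (\<Sum>s\<in>{s\<in>bsupport F. fst s + snd s = total_degree F}. if s = (i, j) then bcoeff F i j else 0)"
    unfolding top_form_def coeff_sum by (rule sum.cong) (use ij in auto)
  also have "\<dots> = bcoeff F i j" using ij finite_bsupport[of F] by (subst sum.delta) (auto simp: bsupport_def)
  finally show ?thesis using ij by auto
qed

text \<open>By the bound on the total degree this coefficient is free of u and may be computed at u
  = 0. There only monomials of top degree reach v^D, and x^i y^j contributes c^i.\<close>

lemma coeff_shear_top:
  "coeff (bisubst (shear_x a c) (shear_y b) F) (total_degree F) = [:poly (top_form F) c:]"
proof (rule poly_eqI)
  fix i
  define D where "D = total_degree F"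
  define x where "x = shear_x a c"
  define y where "y = shear_y b"
  show "coeff (coeff (bisubst x y F) (total_degree F)) i = coeff [:poly (top_form F) c:] i"
  proof (cases "i = 0")
    case False
    have "tdeg_le D (bisubst x y F)" unfolding D_def x_def y_def
      by (intro tdeg_le_bisubst tdeg_le_total_degree tdeg_le_shear)
    from tdeg_leD[OF this, of D i] False show ?thesis by (cases i) (auto simp: D_def)
  next
    case True
    define \<psi> where "\<psi> = map_poly (\<lambda>p :: complex poly. poly p 0)"
    have "comm_ring_hom (\<lambda>p :: complex poly. poly p 0)" by unfold_locales simp_all
    hence "comm_ring_hom \<psi>" unfolding \<psi>_def by (rule comm_ring_hom_map_poly)
    then interpret \<psi>: comm_ring_hom \<psi> .
    have \<psi>x: "\<psi> x = [:a, c:]" and \<psi>y: "\<psi> y = [:b, 1:]" and \<psi>k: "\<psi> (bconst k) = [:k:]" for k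
      by (simp_all add: \<psi>_def x_def y_def shear_x_def shear_y_def map_poly_pCons_0)
    have c\<psi>: "coeff (\<psi> h) n = coeff (coeff h n) 0" for h n
      by (simp add: \<psi>_def coeff_map_poly poly_0_coeff_0)
    have "coeff (coeff (bisubst x y F) D) 0 = coeff (\<psi> (bisubst x y F)) D" by (simp add: c\<psi>)
    also have "\<dots> = (\<Sum>s\<in>bsupport F. bcoeff F (fst s) (snd s) * coeff ([:a, c:] ^ fst s * [:b, 1:] ^ snd s) D)"
      unfolding bisubst_eq_sum bimonom_def
      by (simp only: \<psi>.hom_sum \<psi>.hom_mult \<psi>.hom_power \<psi>x \<psi>y \<psi>k coeff_sum) simp
    also have "\<dots> = (\<Sum>s\<in>bsupport F. if fst s + snd s = D then bcoeff F (fst s) (snd s) * c ^ fst s else 0)"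
    proof (rule sum.cong[OF refl])
      fix s assume s: "s \<in> bsupport F"
      have d1: "degree ([:a, c:] ^ fst s) \<le> fst s"
        by (rule order.trans[OF degree_power_le]) simp
      have d2: "degree ([:b, 1:] ^ snd s) \<le> snd s"
        by (rule order.trans[OF degree_power_le]) simp
      have "coeff ([:a, c:] ^ fst s * [:b, 1:] ^ snd s) (fst s + snd s) = c ^ fst s"
        by (simp only: coeff_mult_top[OF d1 d2]) (simp add: coeff_linear_poly_power coeff_linear_power)
      moreover have "coeff ([:a, c:] ^ fst s * [:b, 1:] ^ snd s) D = 0" if "fst s + snd s \<noteq> D"
      proof (rule coeff_eq_0)
        have "fst s + snd s \<le> D" using tdeg_le_total_degree[of F] s
          by (auto simp: tdeg_le_def bsupport_def D_def)
        thus "degree ([:a, c:] ^ fst s * [:b, 1:] ^ snd s) < D"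
          using that degree_mult_le[of "[:a, c:] ^ fst s" "[:b, 1:] ^ snd s"] d1 d2 by linarith
      qed
      ultimately show "bcoeff F (fst s) (snd s) * coeff ([:a, c:] ^ fst s * [:b, 1:] ^ snd s) D =
          (if fst s + snd s = D then bcoeff F (fst s) (snd s) * c ^ fst s else 0)" by auto
    qed
    also have "\<dots> = (\<Sum>s\<in>{s\<in>bsupport F. fst s + snd s = D}. bcoeff F (fst s) (snd s) * c ^ fst s)"
      using finite_bsupport[of F] by (intro sum.inter_filter[symmetric])
    also have "\<dots> = poly (top_form F) c" by (simp add: top_form_def D_def poly_sum poly_monom)
    finally show ?thesis using True by (simp add: D_def)
  qed
qed

lemma degree_shear:
  assumes "poly (top_form F) c \<noteq> 0"
  shows "degree (bisubst (shear_x a c) (shear_y b) F) = total_degree F"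
proof (rule antisym)
  have t: "tdeg_le (total_degree F) (bisubst (shear_x a c) (shear_y b) F)"
    by (intro tdeg_le_bisubst tdeg_le_total_degree tdeg_le_shear)
  show "degree (bisubst (shear_x a c) (shear_y b) F) \<le> total_degree F"
  proof (rule degree_le, intro allI impI, rule poly_eqI)
    fix j i assume "total_degree F < j"
    thus "coeff (coeff (bisubst (shear_x a c) (shear_y b) F) j) i = coeff 0 i"
      using tdeg_leD[OF t, of j i] by auto
  qed
  show "total_degree F \<le> degree (bisubst (shear_x a c) (shear_y b) F)"
    using assms by (intro le_degree) (simp add: coeff_shear_top)
qed

text \<open>Choose \<open>c\<close> at which none of the three top forms vanishes. After the shear,
  total degree is degree in v, which is additive.\<close>

lemma total_degree_mult:
  assumes "F \<noteq> 0" "G \<noteq> 0"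
  shows "total_degree (F * G) = total_degree F + total_degree G"
proof -
  have "top_form F * top_form G * top_form (F * G) \<noteq> 0" using assms by (simp add: top_form_nonzero)
  then obtain c where "poly (top_form F * top_form G * top_form (F * G)) c \<noteq> 0"
    by (metis poly_all_0_iff_0)
  hence c: "poly (top_form F) c \<noteq> 0" "poly (top_form G) c \<noteq> 0" "poly (top_form (F * G)) c \<noteq> 0" by auto
  interpret s: comm_ring_hom "bisubst (shear_x 0 c) (shear_y 0)" by (rule bisubst_hom)
  have nz: "bisubst (shear_x 0 c) (shear_y 0) F \<noteq> 0" "bisubst (shear_x 0 c) (shear_y 0) G \<noteq> 0"
    using coeff_shear_top[of 0 c 0 F] coeff_shear_top[of 0 c 0 G] c by auto
  show ?thesis
    using degree_mult_eq[OF nz] degree_shear[OF c(1), of 0 0] degree_shear[OF c(2), of 0 0]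
      degree_shear[OF c(3), of 0 0] by (simp add: s.hom_mult)
qed

lemma prime_elem_bisubst_shear:
  assumes "prime_elem q"
  shows "prime_elem (bisubst (shear_x a c) (shear_y b) q)"
proof -
  define \<sigma> where "\<sigma> = bisubst (shear_x a c) (shear_y b)"
  define \<tau> where "\<tau> = bisubst (shear_x (c * b - a) (- c)) (shear_y (- b))"
  have inv: "\<tau> (\<sigma> F) = F" "\<sigma> (\<tau> F) = F" for F
    unfolding \<sigma>_def \<tau>_def by (rule shear_inverse)+
  interpret \<sigma>: comm_ring_hom \<sigma> unfolding \<sigma>_def by (rule bisubst_hom)
  interpret \<tau>: comm_ring_hom \<tau> unfolding \<tau>_def by (rule bisubst_hom)
  have dvd: "\<sigma> q dvd h \<longleftrightarrow> q dvd \<tau> h" for h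
    by (metis \<sigma>.hom_dvd \<tau>.hom_dvd inv)
  have "prime_elem (\<sigma> q)"
  proof (rule prime_elemI)
    show "\<sigma> q \<noteq> 0" using assms inv(1)[of q] by (metis \<tau>.hom_zero prime_elem_not_zeroI)
    show "\<not> \<sigma> q dvd 1" unfolding dvd \<tau>.hom_one using assms by (rule prime_elem_not_unit)
    fix g h assume "\<sigma> q dvd g * h"
    thus "\<sigma> q dvd g \<or> \<sigma> q dvd h" unfolding dvd \<tau>.hom_mult using assms by (rule prime_elem_dvd_multD[rotated])
  qed
  thus ?thesis by (simp add: \<sigma>_def)
qed

text \<open>If q = l h, then \<open>q\<close> divides \<open>l\<close>, which fails at (a, b), or
  \<open>q\<close> divides \<open>h\<close>, which makes \<open>l\<close> a unit although it has a
  zero. Applied to the two axes, which miss (a, b).\<close>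

lemma prime_elem_not_multiple:
  assumes "prime_elem q" "beval q a b = 0" "beval l a b \<noteq> 0" "beval l a' b' = 0"
  shows "\<not> l dvd q"
proof
  interpret e: comm_ring_hom "\<lambda>F. beval F a b" by (rule beval_hom)
  interpret e': comm_ring_hom "\<lambda>F. beval F a' b'" by (rule beval_hom)
  assume "l dvd q"
  then obtain h where h: "q = l * h" by (elim dvdE)
  hence "q dvd l \<or> q dvd h" using prime_elem_dvd_multD[OF assms(1), of l h] by simp
  thus False
  proof
    assume "q dvd l"
    then obtain k where "l = q * k" by (elim dvdE)
    thus False using assms(2,3) e.hom_mult[of q k] by simp
  next
    assume "q dvd h"
    then obtain k where "h = q * k" by (elim dvdE)
    hence "q = l * (q * k)" using h by metis
    hence "q * 1 = q * (l * k)" by (metis mult.left_commute mult_1_right)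
    hence "1 = l * k" using assms(1) by (metis mult_left_cancel prime_elem_not_zeroI)
    hence "beval 1 a' b' = 0" using assms(4) e'.hom_mult[of l k] by simp
    thus False by simp
  qed
qed

lemma finite_poly_vimage_zero: "(p :: complex poly) \<noteq> 0 \<Longrightarrow> inj g \<Longrightarrow> finite {c. poly p (g c) = 0}"
  using finite_vimageI[OF poly_roots_finite[of p], of g] by (simp add: vimage_def)

text \<open>The line through (a, b) with direction (c, 1) meets the axes in (a - c b, 0) and (0, b -
  a / c). Both restrictions of \<open>q\<close> to the axes are nonzero, and both points vary
  injectively with c because a and b are nonzero, so each condition excludes finitely many
  c.\<close>

lemma generic_shear:
  assumes prime: "prime_elem q" and q0: "beval q a b = 0" and a: "a \<noteq> 0" and b: "b \<noteq> 0"
  obtains c where "c \<noteq> 0" "poly (top_form q) c \<noteq> 0" "beval q (a - c * b) 0 \<noteq> 0" "beval q 0 (b - a / c) \<noteq> 0"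
proof -
  define p1 where "p1 = coeff q 0"
  define p2 where "p2 = map_poly (\<lambda>p. poly p 0) q"
  have e1: "beval q z 0 = poly p1 z" for z
    by (simp add: beval_def p1_def poly_0_coeff_0 coeff_map_poly)
  have e2: "beval q 0 z = poly p2 z" for z by (simp add: beval_def p2_def)
  have "\<not> [:0, 1:] dvd q"
    by (rule prime_elem_not_multiple[OF prime q0, of _ 0 0]) (use b in \<open>auto simp: beval_pCons\<close>)
  hence p1: "p1 \<noteq> 0" using poly_eq_0_iff_dvd[of q 0] by (simp add: p1_def poly_0_coeff_0)
  have "\<not> [:[:0, 1:]:] dvd q"
    by (rule prime_elem_not_multiple[OF prime q0, of _ 0 0]) (use a in \<open>auto simp: beval_pCons\<close>)
  then obtain n where "\<not> [:0, 1:] dvd coeff q n" by (auto simp: const_poly_dvd_iff)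
  hence "coeff p2 n \<noteq> 0" by (simp add: p2_def coeff_map_poly poly_eq_0_iff_dvd)
  hence p2: "p2 \<noteq> 0" by auto
  have "inj (\<lambda>c. a - c * b)" using b by (auto intro!: injI)
  from finite_poly_vimage_zero[OF p1 this] have f1: "finite {c. poly p1 (a - c * b) = 0}" .
  \<comment> \<open>With a / 0 = 0 the map is injective on all of the complex numbers, 0
    included.\<close>
  have "inj (\<lambda>c. b - a / c)" using a by (auto intro!: injI simp: divide_eq_eq eq_divide_eq split: if_splits)
  from finite_poly_vimage_zero[OF p2 this] have f2: "finite {c. poly p2 (b - a / c) = 0}" .
  have "q \<noteq> 0" using prime by auto
  hence f3: "finite {c. poly (top_form q) c = 0}" by (intro poly_roots_finite top_form_nonzero)
  have "finite (insert 0 ({c. poly p1 (a - c * b) = 0} \<union> {c. poly p2 (b - a / c) = 0} \<union> {c. poly (top_form q) c = 0}))"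
    using f1 f2 f3 by simp
  from ex_new_if_finite[OF infinite_UNIV_char_0 this] show ?thesis
    using that unfolding e1 e2 by auto
qed

text \<open>\<open>alg\<close> is the form in which finiteness of the multiplicity arrives: every
  \<open>z\<close> is algebraic over C modulo the local ideal. It is applied to the coordinate u;
  all other data are carried to the sheared coordinates and back.\<close>

theorem prime_component_bound:
  fixes q G :: bipoly and P :: "nat \<Rightarrow> bipoly"
  assumes prime: "prime_elem q" and q0: "beval q a b = 0" and a: "a \<noteq> 0" and b: "b \<noteq> 0"
    and alg: "\<And>z. \<exists>K c H U V. (\<exists>k<K. c k \<noteq> 0) \<and> beval H a b \<noteq> 0 \<and>
                H * (\<Sum>k<K. bconst (c k) * z ^ k) = U * q + V * G"
    and indep: "\<And>c U V H. beval H a b \<noteq> 0 \<Longrightarrow> H * (\<Sum>j<m. bconst (c j) * P j) = U * q + V * G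
                 \<Longrightarrow> \<forall>j<m. c j = 0"
  shows "m \<le> (total_degree q)\<^sup>2 * (num_monomials G)\<^sup>2"
proof -
  define d where "d = total_degree q"
  obtain c where c: "c \<noteq> 0" "poly (top_form q) c \<noteq> 0" "beval q (a - c * b) 0 \<noteq> 0" "beval q 0 (b - a / c) \<noteq> 0"
    using generic_shear[OF prime q0 a b] .
  define \<sigma> where "\<sigma> = bisubst (shear_x a c) (shear_y b)"
  define \<tau> where "\<tau> = bisubst (shear_x (c * b - a) (- c)) (shear_y (- b))"
  have inv: "\<tau> (\<sigma> F) = F" "\<sigma> (\<tau> F) = F" for F
    unfolding \<sigma>_def \<tau>_def by (rule shear_inverse)+
  interpret \<sigma>: comm_ring_hom \<sigma> unfolding \<sigma>_def by (rule bisubst_hom)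
  interpret \<tau>: comm_ring_hom \<tau> unfolding \<tau>_def by (rule bisubst_hom)
  have \<sigma>const: "\<sigma> (bconst k) = bconst k" for k unfolding \<sigma>_def by (rule bisubst_const)
  have \<tau>const: "\<tau> (bconst k) = bconst k" for k unfolding \<tau>_def by (rule bisubst_const)
  have eval_\<sigma>: "beval (\<sigma> F) 0 v = beval F (a + c * v) (b + v)" for F v
    unfolding \<sigma>_def beval_bisubst by (simp add: shear_x_def shear_y_def beval_pCons mult.commute)
  define lc where "lc = poly (top_form q) c"
  define f where "f = bconst (1 / lc) * \<sigma> q"
  have lc: "lc \<noteq> 0" using c by (simp add: lc_def)
  have f_smult: "f = Polynomial.smult [:1 / lc:] (\<sigma> q)" by (simp add: f_def)
  have deg: "degree f = d"
    using degree_shear[OF c(2), of a b] lc unfolding f_smult d_def \<sigma>_def by simp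
  have monic: "lead_coeff f = 1"
    using coeff_shear_top[of a c b q] lc unfolding deg unfolding f_smult d_def \<sigma>_def
    by (simp add: lc_def one_pCons)
  have tdeg: "tdeg_le d f"
    using tdeg_le_mult[OF tdeg_le_const[of 0 "1 / lc"] tdeg_le_bisubst[OF tdeg_le_total_degree tdeg_le_shear]]
    unfolding f_def d_def \<sigma>_def by simp
  have "bconst (1 / lc) * bconst lc = 1" using lc by (simp add: one_pCons)
  hence unit: "bconst (1 / lc) dvd 1" by (metis dvd_triv_left)
  have fprime: "prime_elem f"
    unfolding f_def \<sigma>_def using prime_elem_bisubst_shear[OF prime] by (simp only: prime_elem_mult_unit_left[OF unit])
  have f0: "beval f 0 v = 0 \<longleftrightarrow> beval (\<sigma> q) 0 v = 0" for v
  proof -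
    interpret e: comm_ring_hom "\<lambda>F. beval F 0 v" by (rule beval_hom)
    show ?thesis unfolding f_def e.hom_mult using lc by (simp add: beval_const)
  qed
  \<comment> \<open>A zero of \<open>f\<close> on u = 0 that lies on an axis would be one of the two
    points excluded by the choice of \<open>c\<close>.\<close>
  have units: "beval (shear_x a c) 0 v \<noteq> 0 \<and> beval (shear_y b) 0 v \<noteq> 0" if "beval f 0 v = 0" for v
  proof -
    have q: "beval q (a + c * v) (b + v) = 0" using that f0 eval_\<sigma> by simp
    have "b + v \<noteq> 0"
    proof
      assume "b + v = 0"
      hence "v = - b" by (simp add: eq_neg_iff_add_eq_0 add.commute)
      thus False using q c(3) by simp
    qed
    moreover have "a + c * v \<noteq> 0"
    proof
      assume 0: "a + c * v = 0"
      hence "v = - (a / c)" using c(1) by (simp add: field_simps eq_neg_iff_add_eq_0 add.commute)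
      thus False using q c(4) 0 by simp
    qed
    ultimately show ?thesis by (simp add: shear_x_def shear_y_def beval_pCons mult.commute)
  qed
  have pull: "\<exists>U V. \<tau> H * T = U * q + V * G" if "H * \<sigma> T = U' * f + V' * \<sigma> G" for H T U' V'
  proof -
    have "\<tau> (H * \<sigma> T) = \<tau> (U' * f + V' * \<sigma> G)" using that by simp
    hence "\<tau> H * T = (\<tau> U' * bconst (1 / lc)) * q + \<tau> V' * G"
      by (simp only: \<tau>.hom_mult \<tau>.hom_add inv f_def \<tau>const mult.assoc)
    thus ?thesis by blast
  qed
  have push: "\<exists>U V. \<sigma> H * \<sigma> T = U * f + V * \<sigma> G" if "H * T = U' * q + V' * G" for H T U' V'
  proof -
    have "\<sigma> q = bconst lc * f" unfolding f_smult using lc by (simp add: one_pCons[symmetric])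
    moreover have "\<sigma> (H * T) = \<sigma> (U' * q + V' * G)" using that by simp
    ultimately have "\<sigma> H * \<sigma> T = (\<sigma> U' * bconst lc) * f + \<sigma> V' * \<sigma> G"
      by (simp only: \<sigma>.hom_mult \<sigma>.hom_add mult.assoc)
    thus ?thesis by blast
  qed
  have evH: "beval (\<sigma> H) 0 0 = beval H a b" for H using eval_\<sigma>[of H 0] by simp
  have evH': "beval (\<tau> H) a b = beval H 0 0" for H using evH[of "\<tau> H"] inv by simp
  \<comment> \<open>\<open>z\<close> is the pullback of u, so the relation becomes a nonzero
    polynomial \<open>p\<close> in u that lies in the ideal up to a unit. Splitting off the factor
    p' with p'(0) nonzero, again a unit at the origin, leaves u^r.\<close>
  obtain K k H U V where kK: "\<exists>i<K. k i \<noteq> 0" and H: "beval H a b \<noteq> 0"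
    "H * (\<Sum>i<K. bconst (k i) * \<tau> [:[:0, 1:]:] ^ i) = U * q + V * G"
    using alg[of "\<tau> [:[:0, 1:]:]"] by blast
  define p where "p = (\<Sum>i<K. monom (k i) i)"
  have "coeff p i = (if i < K then k i else 0)" for i by (simp add: p_def coeff_sum)
  hence p: "p \<noteq> 0" using kK by (metis coeff_0)
  have sp: "\<sigma> (\<Sum>i<K. bconst (k i) * \<tau> [:[:0, 1:]:] ^ i) = [:p:]"
  proof -
    have x: "[:[:0, 1:]:] ^ n = [:monom 1 n :: complex poly:]" for n
      by (induction n) (simp_all add: monom_Suc monom_0 one_pCons)
    have "\<sigma> (\<Sum>i<K. bconst (k i) * \<tau> [:[:0, 1:]:] ^ i) = (\<Sum>i<K. bconst (k i) * [:monom 1 i:])"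
      by (simp only: \<sigma>.hom_sum \<sigma>.hom_mult \<sigma>.hom_power \<sigma>const inv x)
    also have "\<dots> = (\<Sum>i<K. [:monom (k i) i:])" by (rule sum.cong) (simp_all add: smult_monom)
    also have "\<dots> = [:p:]" unfolding p_def by (induction K) simp_all
    finally show ?thesis .
  qed
  obtain U1 V1 where UV1: "\<sigma> H * [:p:] = U1 * f + V1 * \<sigma> G"
    using push[OF H(2)] unfolding sp by blast
  obtain p' where p': "p = [:- 0, 1:] ^ order 0 p * p'" "\<not> [:- 0, 1:] dvd p'"
    using order_decomp[OF p] by blast
  define r where "r = order 0 p"
  have pr: "p = monom 1 r * p'" using p'(1) by (simp add: r_def monom_altdef)
  have "poly p' 0 \<noteq> 0" using p'(2) by (simp add: poly_eq_0_iff_dvd)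
  define H0 where "H0 = \<sigma> H * [:p':]"
  have evH0: "beval H0 0 0 \<noteq> 0"
  proof -
    interpret e: comm_ring_hom "\<lambda>F. beval F 0 0" by (rule beval_hom)
    show ?thesis unfolding H0_def e.hom_mult using H(1) \<open>poly p' 0 \<noteq> 0\<close> by (simp add: evH beval_pCons)
  qed
  have "[:p:] = [:p':] * [:monom 1 r:]" using pr by (simp add: mult.commute)
  hence H0: "H0 * [:monom 1 r:] = U1 * f + V1 * \<sigma> G"
    using UV1 unfolding H0_def by (simp only: mult.assoc)
  \<comment> \<open>Otherwise \<open>f\<close> divides H0 u^r. It vanishes at the origin where
    \<open>H0\<close> does not, and being monic in v of positive degree it cannot divide a power of
    u.\<close>
  have "\<not> f dvd \<sigma> G"
  proof
    assume "f dvd \<sigma> G"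
    hence "f dvd H0 * [:monom 1 r:]" unfolding H0 by (intro dvd_add dvd_mult) auto
    hence "f dvd H0 \<or> f dvd [:monom 1 r:]" by (rule prime_elem_dvd_multD[OF fprime])
    thus False
    proof
      assume "f dvd H0"
      then obtain h where "H0 = f * h" by (elim dvdE)
      moreover interpret e: comm_ring_hom "\<lambda>F. beval F 0 0" by (rule beval_hom)
      have "beval f 0 0 = 0" using f0[of 0] evH[of q] q0 by simp
      ultimately show False using evH0 e.hom_mult[of f h] by simp
    next
      assume "f dvd [:monom 1 r:]"
      hence "degree f \<le> degree [:monom (1 :: complex) r:]" by (rule dvd_imp_degree_le) (simp add: monom_eq_0_iff)
      hence "degree f = 0" by simp
      hence "f = 1" using monic by (metis degree_eq_zeroE lead_coeff_pCons(2) one_pCons)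
      thus False using fprime by simp
    qed
  qed
  have "m \<le> d\<^sup>2 * (card (bsupport G))\<^sup>2"
  proof (rule local_intersection_bound[OF fprime monic deg tdeg tdeg_le_shear units finite_bsupport _ \<open>\<not> f dvd \<sigma> G\<close> H0 evH0])
    show "\<sigma> G = (\<Sum>s\<in>bsupport G. bconst (bcoeff G (fst s) (snd s)) * bimonom (shear_x a c) (shear_y b) s)"
      unfolding \<sigma>_def by (rule bisubst_eq_sum)
    fix k U' V' H' assume *: "beval H' 0 0 \<noteq> 0" "H' * (\<Sum>j<m. bconst (k j) * \<sigma> (P j)) = U' * f + V' * \<sigma> G"
    have "(\<Sum>j<m. bconst (k j) * \<sigma> (P j)) = \<sigma> (\<Sum>j<m. bconst (k j) * P j)"
      by (simp only: \<sigma>.hom_sum \<sigma>.hom_mult \<sigma>const)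
    from pull[OF *(2)[unfolded this]]
    obtain U V where "\<tau> H' * (\<Sum>j<m. bconst (k j) * P j) = U * q + V * G" by blast
    thus "\<forall>j<m. k j = 0" using indep[of "\<tau> H'"] *(1) evH' by simp
  qed
  thus ?thesis by (simp add: d_def num_monomials_def)
qed

section \<open>Ideals of the local ring\<close>

abbreviation emb :: "bipoly \<Rightarrow> bipoly fract" where "emb P \<equiv> Fract P 1"

lemma beval_nonzero: "beval g a b \<noteq> 0 \<Longrightarrow> g \<noteq> 0"
  by auto

lemma beval_mult: "beval (F * G) a b = beval F a b * beval G a b"
proof -
  interpret e: comm_ring_hom "\<lambda>F. beval F a b" by (rule beval_hom)
  show ?thesis by (rule e.hom_mult)
qed

lemma beval_1: "beval 1 a b = 1"
  using beval_const[of 1 a b] by (simp add: one_pCons)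

lemma emb_hom: "comm_ring_hom emb"
  by unfold_locales (simp_all add: Zero_fract_def One_fract_def)

lemma inverse_emb: "H \<noteq> 0 \<Longrightarrow> Fract 1 H * emb H = 1"
proof -
  assume "H \<noteq> 0"
  hence "Fract (1 * H) (H * 1) = Fract 1 1" by (subst eq_fract) auto
  thus ?thesis by (simp only: mult_fract One_fract_def)
qed

lemma const_fract_eq: "const_fract k = emb (bconst k)"
  by (simp add: const_fract_def)

lemma const_fract_mult: "const_fract (x * y) = const_fract x * const_fract y"
proof -
  interpret emb: comm_ring_hom emb by (rule emb_hom)
  show ?thesis unfolding const_fract_eq emb.hom_mult[symmetric] by simp
qed

lemma local_ringI: "beval g a b \<noteq> 0 \<Longrightarrow> Fract f g \<in> local_ring a b"
  unfolding local_ring_def by blast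

lemma local_ringE:
  assumes "r \<in> local_ring a b"
  obtains f g where "r = Fract f g" "beval g a b \<noteq> 0" "g \<noteq> 0"
  using assms beval_nonzero unfolding local_ring_def by blast

lemma local_ring_emb: "emb P \<in> local_ring a b"
  by (rule local_ringI) (simp add: beval_1)

lemma local_ring_add: "r \<in> local_ring a b \<Longrightarrow> s \<in> local_ring a b \<Longrightarrow> r + s \<in> local_ring a b"
  by (elim local_ringE) (simp add: local_ringI beval_mult)

lemma local_ring_mult: "r \<in> local_ring a b \<Longrightarrow> s \<in> local_ring a b \<Longrightarrow> r * s \<in> local_ring a b"
  by (elim local_ringE) (simp add: local_ringI beval_mult)

lemma local_ring_const: "const_fract k \<in> local_ring a b"
  unfolding const_fract_eq by (rule local_ring_emb)

lemma loc_idealI: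
  "u \<in> local_ring a b \<Longrightarrow> v \<in> local_ring a b \<Longrightarrow> u * emb F + v * emb G \<in> loc_ideal a b F G"
  unfolding loc_ideal_def by blast

lemma loc_idealE:
  assumes "r \<in> loc_ideal a b F G"
  obtains u v where "r = u * emb F + v * emb G" "u \<in> local_ring a b" "v \<in> local_ring a b"
  using assms unfolding loc_ideal_def by blast

lemma loc_ideal_add:
  assumes "r \<in> loc_ideal a b F G" "s \<in> loc_ideal a b F G"
  shows "r + s \<in> loc_ideal a b F G"
proof -
  obtain u v u' v' where "r = u * emb F + v * emb G" "s = u' * emb F + v' * emb G"
    and l: "u \<in> local_ring a b" "v \<in> local_ring a b" "u' \<in> local_ring a b" "v' \<in> local_ring a b"
    using assms by (elim loc_idealE)
  hence "r + s = (u + u') * emb F + (v + v') * emb G" by (simp only: algebra_simps)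
  thus ?thesis using l by (simp only: loc_idealI local_ring_add)
qed

lemma loc_ideal_mult:
  assumes "s \<in> local_ring a b" "r \<in> loc_ideal a b F G"
  shows "s * r \<in> loc_ideal a b F G"
proof -
  obtain u v where "r = u * emb F + v * emb G" and l: "u \<in> local_ring a b" "v \<in> local_ring a b"
    using assms(2) by (elim loc_idealE)
  hence "s * r = (s * u) * emb F + (s * v) * emb G" by (simp only: algebra_simps)
  thus ?thesis using l assms(1) by (simp only: loc_idealI local_ring_mult)
qed

lemma loc_ideal_0: "0 \<in> loc_ideal a b F G"
proof -
  have "0 = emb 0 * emb F + emb 0 * emb G" by (simp flip: Zero_fract_def)
  also have "\<dots> \<in> loc_ideal a b F G" by (intro loc_idealI local_ring_emb)
  finally show ?thesis .
qed

lemma loc_ideal_sum: "(\<And>i. i \<in> I \<Longrightarrow> f i \<in> loc_ideal a b F G) \<Longrightarrow> (\<Sum>i\<in>I. f i) \<in> loc_ideal a b F G"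
  by (induction I rule: infinite_finite_induct) (auto intro: loc_ideal_add loc_ideal_0)

lemma loc_ideal_mult_left_subset: "loc_ideal a b (F1 * F2) G \<subseteq> loc_ideal a b F1 G" (is ?A)
  and loc_ideal_mult_right_subset: "loc_ideal a b (F1 * F2) G \<subseteq> loc_ideal a b F2 G" (is ?B)
proof -
  interpret emb: comm_ring_hom emb by (rule emb_hom)
  have "u * emb (F1 * F2) + v * emb G \<in> loc_ideal a b F1 G"
       "u * emb (F1 * F2) + v * emb G \<in> loc_ideal a b F2 G"
    if "u \<in> local_ring a b" "v \<in> local_ring a b" for u v
  proof -
    have "u * emb (F1 * F2) + v * emb G = (u * emb F2) * emb F1 + v * emb G"
      by (simp only: emb.hom_mult mult_ac)
    also have "\<dots> \<in> loc_ideal a b F1 G" by (intro loc_idealI local_ring_mult local_ring_emb that)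
    finally show "u * emb (F1 * F2) + v * emb G \<in> loc_ideal a b F1 G" .
    have "u * emb (F1 * F2) + v * emb G = (u * emb F1) * emb F2 + v * emb G"
      by (simp only: emb.hom_mult mult_ac)
    also have "\<dots> \<in> loc_ideal a b F2 G" by (intro loc_idealI local_ring_mult local_ring_emb that)
    finally show "u * emb (F1 * F2) + v * emb G \<in> loc_ideal a b F2 G" .
  qed
  thus ?A ?B by (auto elim!: loc_idealE)
qed

text \<open>Together with its converse \<open>emb_in_loc_idealD\<close> this trades membership in
  the local ideal for a polynomial identity with a multiplier \<open>H\<close> that is a unit at the
  point.\<close>

lemma emb_in_loc_idealI:
  assumes "beval H a b \<noteq> 0" "H * P = U * F + V * G"
  shows "emb P \<in> loc_ideal a b F G"
proof -
  interpret emb: comm_ring_hom emb by (rule emb_hom)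
  have "H \<noteq> 0" using assms(1) by auto
  hence inv: "Fract 1 H * emb H = 1" by (rule inverse_emb)
  have "emb P = Fract 1 H * emb (H * P)" using inv by (simp only: emb.hom_mult mult.assoc[symmetric] mult_1_left)
  also have "\<dots> = Fract 1 H * (emb U * emb F + emb V * emb G)"
    unfolding assms(2) by (simp only: emb.hom_mult emb.hom_add)
  also have "\<dots> \<in> loc_ideal a b F G"
    by (intro loc_ideal_mult loc_idealI local_ring_emb local_ringI assms(1))
  finally show ?thesis .
qed

lemma emb_in_loc_idealD:
  assumes "emb P \<in> loc_ideal a b F G"
  shows "\<exists>H U V. beval H a b \<noteq> 0 \<and> H * P = U * F + V * G"
proof -
  obtain u v where uv: "emb P = u * emb F + v * emb G" "u \<in> local_ring a b" "v \<in> local_ring a b"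
    using assms by (elim loc_idealE)
  obtain u1 u2 where u: "u = Fract u1 u2" "beval u2 a b \<noteq> 0" "u2 \<noteq> 0" using uv(2) by (elim local_ringE)
  obtain v1 v2 where v: "v = Fract v1 v2" "beval v2 a b \<noteq> 0" "v2 \<noteq> 0" using uv(3) by (elim local_ringE)
  have "(u2 * v2) * P = (u1 * v2) * F + (v1 * u2) * G"
    using uv(1) u(3) v(3) unfolding u(1) v(1) by (simp add: eq_fract algebra_simps)
  moreover have "beval (u2 * v2) a b \<noteq> 0" using u v by (simp add: beval_mult)
  ultimately show ?thesis by blast
qed

lemma emb_sum_const: "emb (\<Sum>k<n. bconst (c k) * P k) = (\<Sum>k<n. const_fract (c k) * emb (P k))"
proof -
  interpret emb: comm_ring_hom emb by (rule emb_hom)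
  show ?thesis unfolding const_fract_eq by (simp only: emb.hom_sum emb.hom_mult)
qed

text \<open>Multiplying the whole list by a common denominator, a unit of the local ring, keeps it
  independent and makes its members polynomials.\<close>

lemma indep_mod_clear_denominators:
  assumes "indep_mod a b F G rs"
  shows "\<exists>P. \<forall>c U V H. beval H a b \<noteq> 0 \<longrightarrow> H * (\<Sum>j<length rs. bconst (c j) * P j) = U * F + V * G
     \<longrightarrow> (\<forall>j<length rs. c j = 0)"
proof -
  interpret emb: comm_ring_hom emb by (rule emb_hom)
  define n where "n = length rs"
  have "\<forall>k. \<exists>A B. k < n \<longrightarrow> rs ! k = Fract A B \<and> beval B a b \<noteq> 0"
    using assms unfolding indep_mod_def local_ring_def n_def by (auto dest!: nth_mem)
  then obtain A B where AB: "\<And>k. k < n \<Longrightarrow> rs ! k = Fract (A k) (B k)" "\<And>k. k < n \<Longrightarrow> beval (B k) a b \<noteq> 0"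
    by metis
  define D where "D = (\<Prod>k<n. B k)"
  define P where "P k = A k * (\<Prod>j\<in>{..<n} - {k}. B j)" for k
  have D: "beval D a b \<noteq> 0"
  proof -
    interpret e: comm_ring_hom "\<lambda>F. beval F a b" by (rule beval_hom)
    show ?thesis unfolding D_def e.hom_prod using AB(2) by simp
  qed
  hence D0: "D \<noteq> 0" by auto
  have P: "Fract 1 D * emb (P k) = rs ! k" if "k < n" for k
  proof -
    have "B k \<noteq> 0" using AB(2)[OF that] by auto
    moreover have "D = B k * (\<Prod>j\<in>{..<n} - {k}. B j)" unfolding D_def using that by (simp add: prod.remove)
    ultimately show ?thesis using D0 unfolding AB(1)[OF that] P_def by (simp add: eq_fract mult_ac)
  qed
  have "\<forall>j<n. c j = 0" if H: "beval H a b \<noteq> 0" "H * (\<Sum>j<n. bconst (c j) * P j) = U * F + V * G" for c U V H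
  proof -
    have "Fract 1 D * emb (\<Sum>j<n. bconst (c j) * P j) \<in> loc_ideal a b F G"
      by (intro loc_ideal_mult emb_in_loc_idealI[OF H] local_ringI D)
    also have "Fract 1 D * emb (\<Sum>j<n. bconst (c j) * P j) = (\<Sum>j<n. const_fract (c j) * (Fract 1 D * emb (P j)))"
      unfolding emb_sum_const by (simp only: sum_distrib_left mult.left_commute)
    also have "\<dots> = (\<Sum>j<n. const_fract (c j) * rs ! j)" by (rule sum.cong) (simp_all only: P lessThan_iff)
    finally show ?thesis using assms unfolding indep_mod_def n_def by blast
  qed
  thus ?thesis unfolding n_def by blast
qed

section \<open>Spanning lists and subadditivity\<close>

text \<open>The multiplicity is a supremum over independent lists, but upper bounds for a product
  are built from spanning lists, which can be concatenated.\<close>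

definition spans_mod :: "complex \<Rightarrow> complex \<Rightarrow> bipoly \<Rightarrow> bipoly \<Rightarrow> bipoly fract list \<Rightarrow> bool" where
  "spans_mod a b F G es \<longleftrightarrow> set es \<subseteq> local_ring a b \<and>
     (\<forall>r\<in>local_ring a b. \<exists>c. r - (\<Sum>k<length es. const_fract (c k) * es ! k) \<in> loc_ideal a b F G)"

lemma indep_le_spans:
  assumes "spans_mod a b F G es" "indep_mod a b F G rs"
  shows "length rs \<le> length es"
proof (rule ccontr)
  interpret emb: comm_ring_hom emb by (rule emb_hom)
  have c_add: "const_fract (x + y) = const_fract x + const_fract y" for x y
    unfolding const_fract_eq emb.hom_add[symmetric] by simp
  have c_0: "const_fract 0 = 0" by (simp add: const_fract_eq flip: Zero_fract_def)
  have c_sum: "const_fract (\<Sum>i\<in>I. f i) = (\<Sum>i\<in>I. const_fract (f i))" for I :: "nat set" and f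
    by (induction I rule: infinite_finite_induct) (simp_all add: c_0 c_add)
  assume "\<not> length rs \<le> length es"
  hence card: "card {..<length rs} > length es" by simp
  have "\<forall>j. \<exists>c. j < length rs \<longrightarrow> rs ! j - (\<Sum>k<length es. const_fract (c k) * es ! k) \<in> loc_ideal a b F G"
    using assms unfolding spans_mod_def indep_mod_def by (metis nth_mem subsetD)
  then obtain m where m: "\<And>j. j < length rs \<Longrightarrow> rs ! j - (\<Sum>k<length es. const_fract (m j k) * es ! k) \<in> loc_ideal a b F G"
    by metis
  obtain c where c: "\<exists>j\<in>{..<length rs}. c j \<noteq> 0" "\<And>k. k < length es \<Longrightarrow> (\<Sum>j<length rs. c j * m j k) = 0"
    using nontrivial_relation[OF _ card, of m] by auto
  have "(\<Sum>j<length rs. const_fract (c j) * (rs ! j - (\<Sum>k<length es. const_fract (m j k) * es ! k))) \<in> loc_ideal a b F G"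
    by (intro loc_ideal_sum loc_ideal_mult local_ring_const m) simp
  also have "(\<Sum>j<length rs. const_fract (c j) * (rs ! j - (\<Sum>k<length es. const_fract (m j k) * es ! k))) =
     (\<Sum>j<length rs. const_fract (c j) * rs ! j) - (\<Sum>j<length rs. \<Sum>k<length es. const_fract (c j * m j k) * es ! k)"
    by (simp only: right_diff_distrib sum_subtractf sum_distrib_left const_fract_mult mult.assoc)
  also have "(\<Sum>j<length rs. \<Sum>k<length es. const_fract (c j * m j k) * es ! k) = 
     (\<Sum>k<length es. const_fract (\<Sum>j<length rs. c j * m j k) * es ! k)"
    by (subst sum.swap) (simp only: c_sum sum_distrib_right)
  also have "\<dots> = 0" using c(2) by (simp add: c_0)
  finally have "(\<Sum>j<length rs. const_fract (c j) * rs ! j) \<in> loc_ideal a b F G" by simp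
  hence "\<forall>j<length rs. c j = 0" using assms(2) unfolding indep_mod_def by blast
  thus False using c(1) by auto
qed

lemma maximal_indep_spans:
  assumes ind: "indep_mod a b F G rs" and max: "\<And>rs'. indep_mod a b F G rs' \<Longrightarrow> length rs' \<le> length rs"
  shows "spans_mod a b F G rs"
  unfolding spans_mod_def
proof (intro conjI ballI)
  interpret emb: comm_ring_hom emb by (rule emb_hom)
  show rs: "set rs \<subseteq> local_ring a b" using ind by (simp add: indep_mod_def)
  fix r assume r: "r \<in> local_ring a b"
  have "\<not> indep_mod a b F G (rs @ [r])" using max[of "rs @ [r]"] by auto
  then obtain c k where c: "(\<Sum>k<Suc (length rs). const_fract (c k) * (rs @ [r]) ! k) \<in> loc_ideal a b F G"
    "k < Suc (length rs)" "c k \<noteq> 0" using rs r unfolding indep_mod_def by auto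
  define s where "s = (\<Sum>k<length rs. const_fract (c k) * rs ! k)"
  have "(\<Sum>k<length rs. const_fract (c k) * (rs @ [r]) ! k) = s"
    unfolding s_def by (rule sum.cong) (auto simp: nth_append)
  hence sr: "s + const_fract (c (length rs)) * r \<in> loc_ideal a b F G" using c(1) by simp
  define z where "z = c (length rs)"
  have z: "z \<noteq> 0"
  proof
    assume "z = 0"
    hence "s \<in> loc_ideal a b F G" using sr by (simp add: z_def const_fract_def flip: Zero_fract_def)
    hence "\<forall>k<length rs. c k = 0" using ind unfolding indep_mod_def s_def by blast
    thus False using c(2,3) \<open>z = 0\<close> by (auto simp: z_def less_Suc_eq)
  qed
  have "const_fract (1 / z) * (s + const_fract z * r) \<in> loc_ideal a b F G"
    using sr unfolding z_def by (intro loc_ideal_mult local_ring_const)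
  also have "const_fract (1 / z) * (s + const_fract z * r) = const_fract (1 / z * z) * r + const_fract (1 / z) * s"
    by (simp only: const_fract_mult algebra_simps)
  also have "const_fract (1 / z * z) * r = r"
    using z by (simp add: const_fract_def flip: one_pCons One_fract_def)
  also have "const_fract (1 / z) * s = - (\<Sum>k<length rs. const_fract (- c k / z) * rs ! k)"
  proof -
    have "const_fract (- c k / z) = - (const_fract (1 / z) * const_fract (c k))" for k
      unfolding const_fract_mult[symmetric] const_fract_eq emb.hom_uminus[symmetric] by simp
    thus ?thesis unfolding s_def by (simp add: sum_distrib_left sum_negf mult.assoc)
  qed
  finally have "r - (\<Sum>k<length rs. const_fract (- c k / z) * rs ! k) \<in> loc_ideal a b F G" by simp
  thus "\<exists>c. r - (\<Sum>k<length rs. const_fract (c k) * rs ! k) \<in> loc_ideal a b F G"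
    by (rule exI[of _ "\<lambda>k. - c k / z"])
qed

lemma spans_mod_unit:
  assumes "beval F a b \<noteq> 0"
  shows "spans_mod a b F G []"
proof -
  have "r \<in> loc_ideal a b F G" if r: "r \<in> local_ring a b" for r
  proof -
    have "F \<noteq> 0" using assms by auto
    hence "Fract 1 F * emb F = 1" by (rule inverse_emb)
    hence "r = (r * Fract 1 F) * emb F + emb 0 * emb G"
      by (simp only: mult.assoc mult_1_right Zero_fract_def[symmetric] mult_zero_left add_0_right)
    also have "\<dots> \<in> loc_ideal a b F G"
      by (intro loc_idealI local_ring_mult r local_ringI assms local_ring_emb)
    finally show ?thesis .
  qed
  thus ?thesis by (simp add: spans_mod_def)
qed

text \<open>Expand \<open>r\<close> modulo (F1, G), then expand the cofactor of \<open>F1\<close>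
  modulo (F2, G).\<close>

lemma spans_mod_mult:
  assumes 1: "spans_mod a b F1 G es1" and 2: "spans_mod a b F2 G es2"
  shows "spans_mod a b (F1 * F2) G (es1 @ map (\<lambda>e. emb F1 * e) es2)"
  unfolding spans_mod_def
proof (intro conjI ballI)
  interpret emb: comm_ring_hom emb by (rule emb_hom)
  show "set (es1 @ map (\<lambda>e. emb F1 * e) es2) \<subseteq> local_ring a b"
    using assms by (auto simp: spans_mod_def intro: local_ring_mult local_ring_emb)
  fix r assume r: "r \<in> local_ring a b"
  obtain c1 where "r - (\<Sum>k<length es1. const_fract (c1 k) * es1 ! k) \<in> loc_ideal a b F1 G"
    using 1 r unfolding spans_mod_def by blast
  then obtain u v where uv: "r - (\<Sum>k<length es1. const_fract (c1 k) * es1 ! k) = u * emb F1 + v * emb G"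
    "u \<in> local_ring a b" "v \<in> local_ring a b" by (elim loc_idealE)
  obtain c2 where "u - (\<Sum>k<length es2. const_fract (c2 k) * es2 ! k) \<in> loc_ideal a b F2 G"
    using 2 uv(2) unfolding spans_mod_def by blast
  then obtain u' v' where uv': "u - (\<Sum>k<length es2. const_fract (c2 k) * es2 ! k) = u' * emb F2 + v' * emb G"
    "u' \<in> local_ring a b" "v' \<in> local_ring a b" by (elim loc_idealE)
  define n1 where "n1 = length es1"
  define n2 where "n2 = length es2"
  define es where "es = es1 @ map (\<lambda>e. emb F1 * e) es2"
  define c where "c k = (if k < n1 then c1 k else c2 (k - n1))" for k
  have "(\<Sum>k<n1 + n2. const_fract (c k) * es ! k) =
      (\<Sum>k<n1. const_fract (c k) * es ! k) + (\<Sum>k<n2. const_fract (c (n1 + k)) * es ! (n1 + k))"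
    by (induction n2) (simp_all add: algebra_simps)
  also have "(\<Sum>k<n1. const_fract (c k) * es ! k) = (\<Sum>k<n1. const_fract (c1 k) * es1 ! k)"
    by (rule sum.cong) (auto simp: c_def es_def nth_append n1_def)
  also have "(\<Sum>k<n2. const_fract (c (n1 + k)) * es ! (n1 + k)) = emb F1 * (\<Sum>k<n2. const_fract (c2 k) * es2 ! k)"
    unfolding sum_distrib_left by (rule sum.cong) (auto simp: c_def es_def nth_append n1_def n2_def mult_ac)
  finally have sum: "(\<Sum>k<n1 + n2. const_fract (c k) * es ! k) =
      (\<Sum>k<n1. const_fract (c1 k) * es1 ! k) + emb F1 * (\<Sum>k<n2. const_fract (c2 k) * es2 ! k)" .
  have ring: "r - (s1 + f * s2) = u' * (f * e) + (v + f * v') * g"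
    if "r - s1 = u * f + v * g" "u - s2 = u' * e + v' * g" for s1 s2 f e g :: "bipoly fract"
  proof -
    have u: "u = (u' * e + v' * g) + s2" using that(2) by (simp only: diff_eq_eq)
    have "r = (u * f + v * g) + s1" using that(1) by (simp only: diff_eq_eq)
    thus ?thesis unfolding u by (simp add: algebra_simps)
  qed
  have "r - (\<Sum>k<n1 + n2. const_fract (c k) * es ! k) = u' * emb (F1 * F2) + (v + emb F1 * v') * emb G"
    unfolding sum emb.hom_mult unfolding n1_def n2_def by (rule ring[OF uv(1) uv'(1)])
  also have "\<dots> \<in> loc_ideal a b (F1 * F2) G"
    by (intro loc_idealI local_ring_add local_ring_mult local_ring_emb uv uv')
  finally show "\<exists>c. r - (\<Sum>k<length (es1 @ map (\<lambda>e. emb F1 * e) es2). const_fract (c k) * (es1 @ map (\<lambda>e. emb F1 * e) es2) ! k)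
      \<in> loc_ideal a b (F1 * F2) G"
    unfolding es_def n1_def n2_def by (intro exI[of _ c]) simp
qed

lemma indep_mod_antimono:
  "indep_mod a b F G rs \<Longrightarrow> loc_ideal a b F' G \<subseteq> loc_ideal a b F G \<Longrightarrow> indep_mod a b F' G rs"
  unfolding indep_mod_def by blast

text \<open>The K + 1 powers 1, z, ..., z^K exceed the bound on independent lists.\<close>

lemma powers_dependent:
  assumes bound: "\<And>rs. indep_mod a b F G rs \<Longrightarrow> length rs \<le> K"
  shows "\<exists>K c H U V. (\<exists>k<K. c k \<noteq> 0) \<and> beval H a b \<noteq> 0 \<and>
           H * (\<Sum>k<K. bconst (c k) * z ^ k) = U * F + V * G"
proof -
  define rs where "rs = map (\<lambda>k. emb (z ^ k)) [0..<Suc K]"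
  have "\<not> indep_mod a b F G rs" using bound[of rs] by (auto simp: rs_def)
  moreover have "set rs \<subseteq> local_ring a b" by (auto simp: rs_def local_ring_emb)
  ultimately obtain c where c: "(\<Sum>k<Suc K. const_fract (c k) * rs ! k) \<in> loc_ideal a b F G" "\<exists>k<Suc K. c k \<noteq> 0"
    unfolding indep_mod_def by (auto simp: rs_def simp del: upt_Suc)
  have "(\<Sum>k<Suc K. const_fract (c k) * rs ! k) = emb (\<Sum>k<Suc K. bconst (c k) * z ^ k)"
    unfolding emb_sum_const by (rule sum.cong) (simp_all add: rs_def del: upt_Suc)
  from emb_in_loc_idealD[OF c(1)[unfolded this]] c(2) show ?thesis by blast
qed

lemma spans_prime_component:
  assumes prime: "prime_elem q" and a: "a \<noteq> 0" and b: "b \<noteq> 0"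
    and bound: "\<And>rs. indep_mod a b q G rs \<Longrightarrow> length rs \<le> K"
  shows "\<exists>es. spans_mod a b q G es \<and> length es \<le> (total_degree q)\<^sup>2 * (num_monomials G)\<^sup>2"
proof (cases "beval q a b = 0")
  case False
  thus ?thesis using spans_mod_unit by fastforce
next
  case True
  have "indep_mod a b q G []" by (simp add: indep_mod_def)
  then obtain rs where rs: "indep_mod a b q G rs" "\<forall>rs'. indep_mod a b q G rs' \<longrightarrow> length rs' \<le> length rs"
    using ex_has_greatest_nat[of "indep_mod a b q G" "[]" length "Suc K"] bound by (auto simp: less_Suc_eq_le)
  have "length rs \<le> (total_degree q)\<^sup>2 * (num_monomials G)\<^sup>2"
  proof -
    obtain P where P: "\<forall>c U V H. beval H a b \<noteq> 0 \<longrightarrow> H * (\<Sum>j<length rs. bconst (c j) * P j) = U * q + V * G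
       \<longrightarrow> (\<forall>j<length rs. c j = 0)"
      using indep_mod_clear_denominators[OF rs(1)] by blast
    show ?thesis
      by (rule prime_component_bound[OF prime True a b powers_dependent[OF bound], where P = P]) (use P in blast)+
  qed
  moreover have "spans_mod a b q G rs" using maximal_indep_spans[OF rs(1)] rs(2) by blast
  ultimately show ?thesis by blast
qed

text \<open>Finiteness, expressed by some bound \<open>K\<close>, passes to each factor: a list
  independent modulo the larger ideal of a factor is independent modulo that of the product. The
  explicit bound is superadditive in F because total degrees add and the sum of two squares is at
  most the square of the sum. Factors that miss the point contribute the empty list.\<close>

lemma spans_of_bounded:
  assumes a: "a \<noteq> 0" and b: "b \<noteq> 0" and "F \<noteq> 0"
    and "\<And>rs. indep_mod a b F G rs \<Longrightarrow> length rs \<le> K"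
  shows "\<exists>es. spans_mod a b F G es \<and> length es \<le> (total_degree F)\<^sup>2 * (num_monomials G)\<^sup>2"
  using assms(3,4)
proof (induction F rule: prime_divisors_induct)
  case zero
  thus ?case by simp
next
  case (unit F)
  then obtain k where "1 = F * k" by (elim dvdE)
  hence "beval F a b * beval k a b = 1" using beval_mult[of F k a b] beval_1[of a b] by simp
  hence "beval F a b \<noteq> 0" by auto
  thus ?case using spans_mod_unit by fastforce
next
  case (factor p F)
  define t where "t = num_monomials G"
  have nz: "p \<noteq> 0" "F \<noteq> 0" using factor.prems by auto
  have "length rs \<le> K" if "indep_mod a b p G rs" for rs
    using that by (intro factor.prems indep_mod_antimono[OF _ loc_ideal_mult_left_subset])
  then obtain es1 where es1: "spans_mod a b p G es1" "length es1 \<le> (total_degree p)\<^sup>2 * t\<^sup>2"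
    using spans_prime_component[OF _ a b] factor.hyps unfolding t_def by blast
  have "length rs \<le> K" if "indep_mod a b F G rs" for rs
    using that by (intro factor.prems indep_mod_antimono[OF _ loc_ideal_mult_right_subset])
  then obtain es2 where es2: "spans_mod a b F G es2" "length es2 \<le> (total_degree F)\<^sup>2 * t\<^sup>2"
    using factor.IH nz unfolding t_def by blast
  have "length (es1 @ map (\<lambda>e. emb p * e) es2) \<le> ((total_degree p)\<^sup>2 + (total_degree F)\<^sup>2) * t\<^sup>2"
    using es1(2) es2(2) by (simp add: distrib_right)
  also have "\<dots> \<le> (total_degree p + total_degree F)\<^sup>2 * t\<^sup>2"
    by (intro mult_right_mono) (simp_all add: power2_sum)
  finally show ?case
    using spans_mod_mult[OF es1(1) es2(1)] nz unfolding t_def total_degree_mult[OF nz] by blast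
qed

theorem mainTheorem1:
  fixes F G :: bipoly and a b :: complex and d t :: nat
  assumes "total_degree F = d" and "d \<ge> 1"
    and "num_monomials G = t" and "t \<ge> 1"
    and "a \<noteq> 0" and "b \<noteq> 0"
    and "beval F a b = 0" and "beval G a b = 0"
    and "int_mult F G a b < \<infinity>"
  shows "real (the_enat (int_mult F G a b)) \<le> 5 / 2 * real d ^ 2 * real t ^ 2"
proof -
  have F: "F \<noteq> 0" using assms(1,2) by (auto simp: total_degree_def)
  obtain M where M: "int_mult F G a b = enat M" using assms(9) by (cases "int_mult F G a b") auto
  have "length rs \<le> M" if "indep_mod a b F G rs" for rs
  proof -
    have "enat (length rs) \<le> int_mult F G a b" unfolding int_mult_def by (rule Sup_upper) (use that in blast)
    thus ?thesis using M by simp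
  qed
  then obtain es where es: "spans_mod a b F G es" "length es \<le> d\<^sup>2 * t\<^sup>2"
    using spans_of_bounded[OF assms(5,6) F] assms(1,3) by blast
  have "int_mult F G a b \<le> enat (d\<^sup>2 * t\<^sup>2)"
    unfolding int_mult_def
  proof (rule Sup_least)
    fix x assume "x \<in> {enat (length rs) |rs. indep_mod a b F G rs}"
    then obtain rs where "x = enat (length rs)" "indep_mod a b F G rs" by blast
    thus "x \<le> enat (d\<^sup>2 * t\<^sup>2)" using indep_le_spans[OF es(1)] es(2) by fastforce
  qed
  hence "real M \<le> real (d\<^sup>2 * t\<^sup>2)" unfolding M by (simp only: enat_ord_simps of_nat_le_iff)
  also have "\<dots> \<le> 5 / 2 * real d ^ 2 * real t ^ 2" by simp
  finally show ?thesis by (simp add: M)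
qed

end
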